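(* Let $(X,d,\sigma)$ be a compatible metric-topological space with $(X,d)$ complete, let $\phi:X\to(-\infty,\infty]$ be proper, satisfy the LSCC assumptions with coercivity constant $\mathsf B$, and be $\lambda$-geodesically convex with $\lambda=0$. Let $\varepsilon>0$ with $\frac1{16\varepsilon}>\mathsf B$ and let $u_\varepsilon\in\mathcal M_\varepsilon(\bar u)$. Then: (1) $t\mapsto\frac12|u_\varepsilon'|^2(t)$ admits a locally Lipschitz continuous pointwise representative on $(0,\infty)$; (2) $t\mapsto|u_\varepsilon'|(t)$ and $t\mapsto\phi(u_\varepsilon(t))$ are nonincreasing; (3) $t\mapsto\phi(u_\varepsilon(t))$ is convex; (4) in $\mathcal D'(0,\infty)$ there holds $$-\varepsilon\frac{d^2}{dt^2}\Big(\frac12|u_\varepsilon'|^2(t)\Big)+\frac{d}{dt}\frac12|u_\varepsilon'|^2(t)=-\frac{d^2}{dt^2}\phi(u_\varepsilon(t))-\frac{d}{dt}\frac12|u_\varepsilon'|^2(t)\le0 .$$ Hence, the function $t\mapsto\phi(u_\varepsilon(t))$ is continuous on $(0,\infty)$ and right-continuous at $t=0$.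
   Context: **Setting.** $(X,d)$ is a complete metric space and $\sigma$ is a Hausdorff topology on $X$; $(X,d,\sigma)$ is called compatible if (MT1) $u_n\to u$ and $v_n\to v$ in $\sigma$ imply $\liminf_n d(u_n,v_n)\ge d(u,v)$; (MT2) for every $\sigma$-open set $U$ and $x\in U$ there exist a $\sigma$-open neighborhood $V$ of $x$ and $\delta>0$ such that $d(y,V)<\delta$ implies $y\in U$, where $d(y,V)=\inf_{v\in V}d(y,v)$. For an interval $I\subset\mathbb R$ and $p\in[1,\infty]$, $AC^p(I;X)$ is the set of curves $u:I\to X$ for which there is $m\in L^p(I)$ with $d(u(s),u(t))\le\int_s^t m(r)\,dr$ for all $s\le t$ in $I$; $AC^p_{\rm loc}(I;X)$ is the set of curves belonging to $AC^p(J;X)$ for every compact interval $J\subset I$. The metric derivative $|u'|(t)=\lim_{s\to t}\frac{d(u(s),u(t))}{|t-s|}$ exists for a.e. $t\in I$. **LSCC assumptions.** $\phi:X\to(-\infty,\infty]$ is proper, $D(\phi)=\{\phi<\infty\}$, and: (Lower semicontinuity) if $\sup_{n,m}d(u_n,u_m)<\infty$ and $u_n\to u$ in $\sigma$, then $\liminf_n\phi(u_n)\ge\phi(u)$; (Compactness) every sequence with $\sup_n\phi(u_n)<\infty$ and $\sup_{n,m}d(u_n,u_m)<\infty$ has a $\sigma$-convergent subsequence; (Coercivity) there are $u_*\in X$ and constants $\mathsf A,\mathsf B\ge0$ such that $\phi(u)\ge-\mathsf B\,d^2(u,v)-\mathsf Q(v)$ for all $u,v\in X$, where $\mathsf Q(v)=\mathsf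 B\,d^2(v,u_* )+\mathsf A$. **Geodesic convexity.** A geodesic is a curve $\gamma:[0,1]\to X$ with $d(\gamma(s),\gamma(t))=|t-s|\,d(\gamma(0),\gamma(1))$ for all $s,t$. $\phi$ is $\lambda$-geodesically convex if for all $v_0,v_1\in D(\phi)$ there is a geodesic $\gamma$ with $\gamma(0)=v_0$, $\gamma(1)=v_1$ and $\phi(\gamma(t))\le(1-t)\phi(v_0)+t\phi(v_1)-\frac\lambda2t(1-t)d^2(v_0,v_1)$ for all $t\in[0,1]$. **WED functional.** $\mu_\varepsilon$ is the probability measure on $(0,\infty)$ with density $\frac1\varepsilon e^{-t/\varepsilon}$; $\mathcal I_\varepsilon[u]=\int_0^\infty\big(\frac\varepsilon2|u'|^2+\phi(u)\big)\,d\mu_\varepsilon$ for $u\in\mathscr C_\varepsilon(\bar u)=\{u\in AC^2_{\rm loc}([0,\infty);X): u(0)=\bar u,\ \int_0^\infty|u'|^2\,d\mu_\varepsilon<\infty\}$; $\mathcal M_\varepsilon(\bar u)$ is the set of minimizers of $\mathcal I_\varepsilon$ in $\mathscr C_\varepsilon(\bar u)$ (understood to be empty if the infimum is $+\infty$). $|u_\varepsilon'|$ in (2) is identified with its continuous representative. *)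

theory Defs
  imports "HOL-Analysis.Analysis"
begin

text \<open>The complete metric space is a type of class \<open>complete_space\<close>; the second topology is a
  value \<open>\<sigma>\<close> of type \<open>'a topology\<close> whose underlying set is the whole type.\<close>

definition compatible :: "'a::complete_space topology \<Rightarrow> bool" where
  "compatible \<sigma> \<longleftrightarrow>
     topspace \<sigma> = UNIV \<and> Hausdorff_space \<sigma> \<and>
     (\<forall>U V u v. limitin \<sigma> U u sequentially \<and> limitin \<sigma> V v sequentially \<longrightarrow>
        ereal (dist u v) \<le> liminf (\<lambda>n. ereal (dist (U n) (V n)))) \<and>
     (\<forall>U x. openin \<sigma> U \<and> x \<in> U \<longrightarrow>
        (\<exists>V \<delta>. openin \<sigma> V \<and> x \<in> V \<and> 0 < \<delta> \<and> (\<forall>y. infdist y V < \<delta> \<longrightarrow> y \<in> U)))"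

definition proper :: "('a \<Rightarrow> ereal) \<Rightarrow> bool" where
  "proper \<phi> \<longleftrightarrow> (\<forall>x. \<phi> x \<noteq> -\<infinity>) \<and> (\<exists>x. \<phi> x \<noteq> \<infinity>)"

definition eff_domain :: "('a \<Rightarrow> ereal) \<Rightarrow> 'a set" where
  "eff_domain \<phi> = {x. \<phi> x < \<infinity>}"

definition lsc_bounded :: "'a::metric_space topology \<Rightarrow> ('a \<Rightarrow> ereal) \<Rightarrow> bool" where
  "lsc_bounded \<sigma> \<phi> \<longleftrightarrow>
     (\<forall>U u. bounded (range U) \<and> limitin \<sigma> U u sequentially \<longrightarrow> \<phi> u \<le> liminf (\<lambda>n. \<phi> (U n)))"

definition sublevels_compact :: "'a::metric_space topology \<Rightarrow> ('a \<Rightarrow> ereal) \<Rightarrow> bool" where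
  "sublevels_compact \<sigma> \<phi> \<longleftrightarrow>
     (\<forall>U. (SUP n. \<phi> (U n)) < \<infinity> \<and> bounded (range U) \<longrightarrow>
        (\<exists>r u. strict_mono (r :: nat \<Rightarrow> nat) \<and> limitin \<sigma> (U \<circ> r) u sequentially))"

definition coercive :: "('a::metric_space \<Rightarrow> ereal) \<Rightarrow> real \<Rightarrow> bool" where
  "coercive \<phi> B \<longleftrightarrow> 0 \<le> B \<and>
     (\<exists>ustar A. 0 \<le> A \<and>
        (\<forall>u v. ereal (- B * (dist u v)\<^sup>2 - (B * (dist v ustar)\<^sup>2 + A)) \<le> \<phi> u))"

text \<open>The coercivity constant \<open>B\<close> is a parameter because the smallness condition on \<open>\<epsilon>\<close> refers to it.\<close>

definition LSCC :: "'a::metric_space topology \<Rightarrow> ('a \<Rightarrow> ereal) \<Rightarrow> real \<Rightarrow> bool" where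
  "LSCC \<sigma> \<phi> B \<longleftrightarrow> lsc_bounded \<sigma> \<phi> \<and> sublevels_compact \<sigma> \<phi> \<and> coercive \<phi> B"

definition geodesic :: "(real \<Rightarrow> 'a::metric_space) \<Rightarrow> bool" where
  "geodesic \<gamma> \<longleftrightarrow>
     (\<forall>s\<in>{0..1}. \<forall>t\<in>{0..1}. dist (\<gamma> s) (\<gamma> t) = \<bar>t - s\<bar> * dist (\<gamma> 0) (\<gamma> 1))"

definition geodesically_convex :: "real \<Rightarrow> ('a::metric_space \<Rightarrow> ereal) \<Rightarrow> bool" where
  "geodesically_convex l \<phi> \<longleftrightarrow>
     (\<forall>v0\<in>eff_domain \<phi>. \<forall>v1\<in>eff_domain \<phi>.
        \<exists>\<gamma>. geodesic \<gamma> \<and> \<gamma> 0 = v0 \<and> \<gamma> 1 = v1 \<and>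
          (\<forall>t\<in>{0..1}. \<phi> (\<gamma> t) \<le> ereal (1 - t) * \<phi> v0 + ereal t * \<phi> v1
                               - ereal (l / 2 * t * (1 - t) * (dist v0 v1)\<^sup>2)))"

text \<open>Curves on \<open>I\<close> are total functions on \<open>real\<close> of which only the values on \<open>I\<close> matter.
  The exponent \<open>p\<close> is finite here.\<close>

definition AC :: "real \<Rightarrow> real set \<Rightarrow> (real \<Rightarrow> 'a::metric_space) \<Rightarrow> bool" where
  "AC p I u \<longleftrightarrow>
     (\<exists>m. set_borel_measurable lborel I m \<and> set_integrable lborel I (\<lambda>r. \<bar>m r\<bar> powr p) \<and>
        (\<forall>s\<in>I. \<forall>t\<in>I. s \<le> t \<longrightarrow> dist (u s) (u t) \<le> (LINT r:{s..t}|lborel. m r)))"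

definition AC_loc :: "real \<Rightarrow> real set \<Rightarrow> (real \<Rightarrow> 'a::metric_space) \<Rightarrow> bool" where
  "AC_loc p I u \<longleftrightarrow> (\<forall>a b. {a..b} \<subseteq> I \<longrightarrow> AC p {a..b} u)"

text \<open>\<open>Lim\<close> is an unspecified value where the limit does not exist; for absolutely continuous
  curves this only concerns a null set of times.\<close>

definition metric_deriv :: "real set \<Rightarrow> (real \<Rightarrow> 'a::metric_space) \<Rightarrow> real \<Rightarrow> real" where
  "metric_deriv I u t = Lim (at t within I) (\<lambda>s. dist (u s) (u t) / \<bar>t - s\<bar>)"

text \<open>Integral of an extended-real function as positive part minus negative part. In \<open>ereal\<close>,
  \<open>\<infinity> - \<infinity> = \<infinity>\<close>; for the functional below the negative part is finite by coercivity.\<close>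

definition ereal_integral :: "'b measure \<Rightarrow> ('b \<Rightarrow> ereal) \<Rightarrow> ereal" where
  "ereal_integral M f =
     enn2ereal (\<integral>\<^sup>+x. e2ennreal (f x) \<partial>M) - enn2ereal (\<integral>\<^sup>+x. e2ennreal (- f x) \<partial>M)"

definition wed_measure :: "real \<Rightarrow> real measure" where
  "wed_measure \<epsilon> = density lborel (\<lambda>t. ennreal (exp (- t / \<epsilon>) / \<epsilon>) * indicator {0<..} t)"

definition wed_curves :: "real \<Rightarrow> 'a::metric_space \<Rightarrow> (real \<Rightarrow> 'a) set" where
  "wed_curves \<epsilon> ubar =
     {u. AC_loc 2 {0..} u \<and> u 0 = ubar \<and>
         (\<integral>\<^sup>+t. ennreal ((metric_deriv {0..} u t)\<^sup>2) \<partial>wed_measure \<epsilon>) < \<infinity>}"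

definition wed :: "real \<Rightarrow> ('a::metric_space \<Rightarrow> ereal) \<Rightarrow> (real \<Rightarrow> 'a) \<Rightarrow> ereal" where
  "wed \<epsilon> \<phi> u =
     ereal_integral (wed_measure \<epsilon>)
       (\<lambda>t. ereal (\<epsilon> / 2 * (metric_deriv {0..} u t)\<^sup>2) + \<phi> (u t))"

definition wed_minimizers ::
    "real \<Rightarrow> ('a::metric_space \<Rightarrow> ereal) \<Rightarrow> 'a \<Rightarrow> (real \<Rightarrow> 'a) set" where
  "wed_minimizers \<epsilon> \<phi> ubar =
     (if (INF v\<in>wed_curves \<epsilon> ubar. wed \<epsilon> \<phi> v) = \<infinity> then {}
      else {u \<in> wed_curves \<epsilon> ubar. \<forall>v\<in>wed_curves \<epsilon> ubar. wed \<epsilon> \<phi> u \<le> wed \<epsilon> \<phi> v})"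

definition locally_lipschitz_on :: "real set \<Rightarrow> (real \<Rightarrow> real) \<Rightarrow> bool" where
  "locally_lipschitz_on S f \<longleftrightarrow> (\<forall>t\<in>S. \<exists>\<delta>>0. \<exists>L. L-lipschitz_on (ball t \<delta> \<inter> S) f)"

definition ereal_convex_on :: "real set \<Rightarrow> (real \<Rightarrow> ereal) \<Rightarrow> bool" where
  "ereal_convex_on S F \<longleftrightarrow>
     (\<forall>s\<in>S. \<forall>t\<in>S. \<forall>a\<in>{0..1}. F ((1 - a) * s + a * t) \<le> ereal (1 - a) * F s + ereal a * F t)"

definition test_functions :: "real set \<Rightarrow> (real \<Rightarrow> real) set" where
  "test_functions S =
     {\<psi>. (\<forall>n t. (deriv ^^ n) \<psi> field_differentiable at t) \<and>
         compact (closure {t. \<psi> t \<noteq> 0}) \<and> closure {t. \<psi> t \<noteq> 0} \<subseteq> S}"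

text \<open>The \<open>n\<close>-th distributional derivative on \<open>S\<close> of (the distribution given by) a locally integrable
  \<open>F\<close>, applied to a test function. With the measure \<open>lebesgue\<close> (rather than \<open>lborel\<close>) the integral
  does not depend on the values of \<open>F\<close> on a null set.\<close>

definition distr_deriv :: "real set \<Rightarrow> nat \<Rightarrow> (real \<Rightarrow> real) \<Rightarrow> (real \<Rightarrow> real) \<Rightarrow> real" where
  "distr_deriv S n F \<psi> = (- 1) ^ n * (LINT t:S|lebesgue. F t * (deriv ^^ n) \<psi> t)"

end

theory Submission
  imports Defs
begin

text \<open>Parametrize the minimizer \<open>u\<close> by its arclength \<open>s\<close>. Replacing a piece of \<open>u\<close> by a geodesic run with the
  same speed shows that the potential is a convex function of \<open>s\<close>, and stopping \<open>u\<close> shows that it is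
  nonincreasing. What remains is a convex problem in one dimension. The value function \<open>G\<close> along \<open>u\<close> is convex
  in \<open>s\<close> as well, since the convex combination of two tails of \<open>u\<close> is a competitor for a third one.
  Comparison with motions of constant speed yields \<open>\<phi> (u t) - G t = \<epsilon> / 2 * |u'|\<^sup>2\<close> and \<open>G' = - |u'|\<^sup>2\<close> for almost
  every \<open>t\<close>. Hence \<open>- |u'|\<close> is the slope of \<open>G\<close> with respect to \<open>s\<close>, so \<open>|u'|\<close> is nonincreasing and \<open>s\<close> is concave
  in time. A convex nonincreasing function of a concave one is convex, so \<open>\<phi> \<circ> u\<close> is convex, therefore
  continuous, and both identities hold everywhere. The equation between distributions follows by integration by
  parts, and the inequality is the convexity of \<open>\<phi> \<circ> u - G / 2\<close>, read off from second differences.\<close>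

section \<open>Lebesgue differentiation on the line\<close>

lemma set_integrable_of_integrable:
  fixes f :: "'b \<Rightarrow> real"
  assumes "integrable M f" "A \<in> sets M"
  shows "set_integrable M A f"
  unfolding set_integrable_def by (rule integrable_mult_indicator[OF assms(2,1)])

lemma set_integrable_const_interval:
  fixes q a b :: real
  shows "set_integrable lborel {a<..<b} (\<lambda>x. q)" "set_integrable lborel {a..b} (\<lambda>x. q)"
  unfolding set_integrable_def
  by (cases "a \<le> b"; auto intro!: integrable_scaleR_left integrable_real_indicator simp del: real_scaleR_def)+

lemma set_integral_atMost_diff:
  fixes f :: "real \<Rightarrow> real"
  assumes "integrable lborel f" "a \<le> b"
  shows "(LINT r:{..b}|lborel. f r) - (LINT r:{..a}|lborel. f r) = (LINT r:{a..b}|lborel. f r)"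
proof -
  have int: "set_integrable lborel A f" if "A \<in> sets borel" for A
    using assms that by (simp add: set_integrable_of_integrable)
  have "(LINT r:{..a} \<union> {a<..b}|lborel. f r) = (LINT r:{..a}|lborel. f r) + (LINT r:{a<..b}|lborel. f r)"
    by (rule set_integral_Un) (auto intro: int)
  moreover have "{..a} \<union> {a<..b} = {..b}"
    using assms by auto
  moreover have "(LINT r:{a<..b}|lborel. f r) = (LINT r:{a..b}|lborel. f r)"
    by (rule set_integral_discrete_difference[where X="{a}"]) auto
  ultimately show ?thesis by simp
qed

lemma negligible_large_averages:
  fixes f :: "real \<Rightarrow> real"
  assumes f: "integrable lborel f" and "q < c"
  shows "negligible {x. \<bar>x\<bar> < n \<and> f x < q \<and>
           (\<forall>d>0. \<exists>a b. a \<le> x \<and> x \<le> b \<and> a < b \<and> b - a < d \<and> c * (b - a) < (LINT r:{a..b}|lborel. f r))}"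
    (is "negligible ?A")
  unfolding negligible_outer_le
proof (intro allI impI)
  fix e :: real assume "0 < e"
  define \<eta> where "\<eta> = e * (c - q)"
  have "\<eta> > 0" using \<open>0 < e\<close> \<open>q < c\<close> by (simp add: \<eta>_def)
  have [measurable]: "f \<in> borel_measurable borel"
    using f by (simp add: borel_measurable_integrable)
  define k where "k x = indicator {-n<..<n} x * (\<bar>f x\<bar> + \<bar>q\<bar>)" for x
  have k_int: "integrable lborel k"
  proof -
    have "set_integrable lborel {-n<..<n} (\<lambda>x. \<bar>f x\<bar> + \<bar>q\<bar>)"
      by (intro set_integral_add set_integrable_const_interval set_integrable_of_integrable) (use f in auto)
    then show ?thesis unfolding k_def set_integrable_def by simp
  qed
  have k_nn: "k x \<ge> 0" for x by (simp add: k_def)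
  define \<nu> where "\<nu> = density lborel (\<lambda>x. ennreal (k x))"
  have sets_nu: "sets \<nu> = sets borel" by (simp add: \<nu>_def)
  have [measurable]: "k \<in> borel_measurable borel" using k_int by (simp add: borel_measurable_integrable)
  have nu: "emeasure \<nu> S = ennreal (LINT x|lborel. indicator S x * k x)" if "S \<in> sets borel" for S
  proof -
    have "emeasure \<nu> S = (\<integral>\<^sup>+x. ennreal (indicator S x * k x) \<partial>lborel)"
      using that by (auto simp: \<nu>_def emeasure_density ennreal_mult' ennreal_indicator mult.commute intro!: nn_integral_cong split: split_indicator)
    also have "\<dots> = ennreal (LINT x|lborel. indicator S x * k x)"
      using that k_int k_nn by (intro nn_integral_eq_integral) (auto intro!: integrable_mult_indicator[where 'b=real, unfolded real_scaleR_def])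
    finally show ?thesis .
  qed
  define B where "B = {x. f x < q} \<inter> {-n<..<n}"
  have B[measurable]: "B \<in> sets borel" unfolding B_def by measurable
  have "emeasure \<nu> (space \<nu>) \<noteq> \<infinity>"
    by (subst nu) (auto simp: \<nu>_def)
  then have "emeasure \<nu> B = (INF U \<in> {U. B \<subseteq> U \<and> open U}. emeasure \<nu> U)"
    by (intro outer_regular sets_nu B)
  moreover have "emeasure \<nu> B < emeasure \<nu> B + ennreal \<eta>"
    using nu[OF B] \<open>\<eta> > 0\<close> by (simp add: ennreal_less_top ennreal_add_left_cancel_less[of _ 0, simplified])
  ultimately obtain U0 where U0: "B \<subseteq> U0" "open U0" "emeasure \<nu> U0 < emeasure \<nu> B + ennreal \<eta>"
    by (auto simp: INF_less_iff)
  define U where "U = U0 \<inter> {-n<..<n}"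
  have U: "B \<subseteq> U" "open U" "U \<subseteq> {-n<..<n}"
    using U0 by (auto simp: U_def B_def)
  have [measurable]: "U \<in> sets borel" "U0 \<in> sets borel" using U U0 by auto
  have kint: "integrable lborel (\<lambda>x. indicator S x * k x)" if "S \<in> sets borel" for S
    using that k_int by (auto intro!: integrable_mult_indicator[where 'b=real, unfolded real_scaleR_def])
  have "(LINT x|lborel. indicator U0 x * k x) < (LINT x|lborel. indicator B x * k x) + \<eta>"
    using U0(3) \<open>\<eta> > 0\<close> k_nn by (simp add: nu ennreal_plus[symmetric] ennreal_less_iff integral_nonneg_AE del: ennreal_plus)
  moreover have "(LINT x|lborel. indicator U x * k x) \<le> (LINT x|lborel. indicator U0 x * k x)"
    using k_nn by (intro integral_mono kint) (auto simp: U_def split: split_indicator)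
  moreover have "(LINT x|lborel. indicator U x * k x) - (LINT x|lborel. indicator B x * k x) = (LINT x|lborel. indicator (U - B) x * k x)"
    using U(1) by (subst Bochner_Integration.integral_diff[symmetric]) (auto intro!: kint Bochner_Integration.integral_cong split: split_indicator)
  ultimately have UB: "(LINT x|lborel. indicator (U - B) x * k x) \<le> \<eta>" by linarith
  define K where "K = {(a,b). a < b \<and> {a..b} \<subseteq> U \<and> c * (b - a) < (LINT r:{a..b}|lborel. f r)}"
  define cen where "cen = (\<lambda>(a::real,b). (a + b) / 2)"
  define rad where "rad = (\<lambda>(a::real,b). (b - a) / 2)"
  have cb: "cball (cen i) (rad i) = {fst i..snd i}" for i
    by (cases i) (auto simp: cen_def rad_def cball_eq_atLeastAtMost field_simps)
  have "\<exists>i. i \<in> K \<and> x \<in> cball (cen i) (rad i) \<and> rad i < d" if x: "x \<in> ?A" and "0 < d" for x d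
  proof -
    have "x \<in> U" using x U by (auto simp: B_def abs_less_iff)
    then obtain r where r: "r > 0" "ball x r \<subseteq> U" using U(2) openE by blast
    obtain a b where ab: "a \<le> x" "x \<le> b" "a < b" "b - a < min r d" "c * (b - a) < (LINT r:{a..b}|lborel. f r)"
      using x r \<open>0 < d\<close> by (auto dest: spec[of _ "min r d"])
    have "{a..b} \<subseteq> ball x r" using ab by (auto simp: dist_real_def)
    then show ?thesis
      using ab r(2) unfolding K_def cb by (intro exI[of _ "(a,b)"]) (auto simp: rad_def)
  qed
  note fine = this
  have radpos: "0 < rad i" if "i \<in> K" for i
    using that by (cases i) (simp add: K_def rad_def)
  obtain C where C: "countable C" "C \<subseteq> K"
     "pairwise (\<lambda>i j. disjnt (cball (cen i) (rad i)) (cball (cen j) (rad j))) C"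
     "negligible(?A - (\<Union>i \<in> C. cball (cen i) (rad i)))"
    by (rule Vitali_covering_theorem_cballs[of K rad ?A cen, OF radpos fine])
  define I where "I = (\<Union>i\<in>C. {fst i..snd i})"
  have fin: "measure lebesgue (\<Union>i\<in>D. {fst i..snd i}) \<le> e" if D: "D \<subseteq> C" "finite D" for D
  proof -
    have dis: "disjoint_family_on (\<lambda>i. {fst i..snd i}) D"
      unfolding disjoint_family_on_def
    proof (intro ballI impI)
      fix i j assume "i \<in> D" "j \<in> D" "i \<noteq> j"
      then have "disjnt (cball (cen i) (rad i)) (cball (cen j) (rad j))"
        using D(1) by (intro pairwiseD[OF C(3)]) auto
      then show "{fst i..snd i} \<inter> {fst j..snd j} = {}" by (simp only: cb disjnt_def)
    qed
    have sub: "{fst i..snd i} \<subseteq> U" if "i \<in> D" for i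
    proof -
      have "i \<in> K" using that D C(2) by blast
      then show ?thesis by (cases i) (simp add: K_def)
    qed
    have DK: "fst i < snd i" "c * (snd i - fst i) < (LINT r:{fst i..snd i}|lborel. f r)" if "i \<in> D" for i
    proof -
      have "i \<in> K" using that D C(2) by blast
      then show "fst i < snd i" "c * (snd i - fst i) < (LINT r:{fst i..snd i}|lborel. f r)" by (cases i; simp add: K_def)+
    qed
    have "measure lebesgue (\<Union>i\<in>D. {fst i..snd i}) = (\<Sum>i\<in>D. measure lebesgue {fst i..snd i})"
      using dis D by (intro measure_finite_Union) (auto simp: emeasure_lborel_Icc_eq)
    also have "\<dots> = (\<Sum>i\<in>D. snd i - fst i)"
      using DK by (intro sum.cong) (auto simp: less_imp_le)
    finally have m: "measure lebesgue (\<Union>i\<in>D. {fst i..snd i}) = (\<Sum>i\<in>D. snd i - fst i)" .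
    have int: "integrable lborel (\<lambda>x. indicator {fst i..snd i} x * (f x - q))" for i
    proof -
      have "set_integrable lborel {fst i..snd i} (\<lambda>x. f x - q)"
        by (intro set_integral_diff set_integrable_const_interval set_integrable_of_integrable f) simp
      then show ?thesis unfolding set_integrable_def by simp
    qed
    have 1: "(c - q) * (snd i - fst i) \<le> (LINT x|lborel. indicator {fst i..snd i} x * (f x - q))" if "i \<in> D" for i
    proof -
      have i: "fst i < snd i" "c * (snd i - fst i) < (LINT r:{fst i..snd i}|lborel. f r)"
        using DK that by blast+
      have "(LINT x|lborel. indicator {fst i..snd i} x * (f x - q)) = (LINT x:{fst i..snd i}|lborel. f x - q)"
        by (simp add: set_lebesgue_integral_def)
      also have "\<dots> = (LINT x:{fst i..snd i}|lborel. f x) - (LINT x:{fst i..snd i}|lborel. q)"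
        by (intro set_integral_diff set_integrable_const_interval set_integrable_of_integrable f) simp
      also have "(LINT x:{fst i..snd i}|lborel. q) = q * (snd i - fst i)"
        using i by (simp add: set_lebesgue_integral_def)
      finally show ?thesis using i by (simp add: algebra_simps)
    qed
    have "(c - q) * (\<Sum>i\<in>D. snd i - fst i) \<le> (\<Sum>i\<in>D. (LINT x|lborel. indicator {fst i..snd i} x * (f x - q)))"
      by (subst sum_distrib_left) (intro sum_mono 1)
    also have "\<dots> = (LINT x|lborel. (\<Sum>i\<in>D. indicator {fst i..snd i} x * (f x - q)))"
      by (rule Bochner_Integration.integral_sum[symmetric]) (rule int)
    also have "\<dots> \<le> (LINT x|lborel. indicator (U - B) x * k x)"
    proof (intro integral_mono kint Bochner_Integration.integrable_sum int)
      fix x :: real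
      have "(\<Sum>i\<in>D. indicator {fst i..snd i} x * (f x - q)) = indicator (\<Union>i\<in>D. {fst i..snd i}) x * (f x - q)"
        using dis D by (simp add: sum_distrib_right[symmetric] indicator_UN_disjoint)
      also have "\<dots> \<le> indicator (U - B) x * k x"
      proof (cases "x \<in> (\<Union>i\<in>D. {fst i..snd i})")
        case True
        then have "x \<in> U" using sub by blast
        then have "x \<in> {-n<..<n}" using U by auto
        then show ?thesis using True \<open>x \<in> U\<close>
          by (cases "x \<in> B") (auto simp: k_def B_def)
      qed (use k_nn in simp)
      finally show "(\<Sum>i\<in>D. indicator {fst i..snd i} x * (f x - q)) \<le> indicator (U - B) x * k x" .
    qed simp
    also have "\<dots> \<le> \<eta>" by (rule UB)
    finally show ?thesis using \<open>q < c\<close> m by (simp add: \<eta>_def mult.commute)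
  qed
  have I: "I \<in> lmeasurable" "measure lebesgue I \<le> e"
    unfolding I_def
    by (rule fmeasurable_UN_bound[OF C(1) _ fin] measure_UN_bound[OF C(1) _ fin]; simp)+
  let ?T = "(?A - I) \<union> I"
  have neg: "negligible (?A - I)" using C(4) by (simp add: I_def cb)
  show "\<exists>T. ?A \<subseteq> T \<and> T \<in> lmeasurable \<and> measure lebesgue T \<le> e"
  proof (intro exI[of _ ?T] conjI)
    show "?T \<in> lmeasurable"
      by (intro fmeasurable.Un I negligible_imp_measurable neg)
    have "measure lebesgue ?T \<le> measure lebesgue (?A - I) + measure lebesgue I"
      using I neg by (intro measure_Un_le) (auto dest: negligible_imp_measurable)
    also have "measure lebesgue (?A - I) = 0" using neg by (simp add: negligible_imp_measure0)
    finally show "measure lebesgue ?T \<le> e" using I by simp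
  qed auto
qed

lemma AE_averages_le:
  fixes f :: "real \<Rightarrow> real"
  assumes f: "integrable lborel f"
  shows "AE x in lborel. \<forall>c>f x. \<exists>d>0. \<forall>a b. a \<le> x \<and> x \<le> b \<and> a < b \<and> b - a < d \<longrightarrow>
           (LINT r:{a..b}|lborel. f r) \<le> c * (b - a)"
proof -
  define N where "N n q c = {x. \<bar>x\<bar> < n \<and> f x < q \<and>
           (\<forall>d>0. \<exists>a b. a \<le> x \<and> x \<le> b \<and> a < b \<and> b - a < d \<and> c * (b - a) < (LINT r:{a..b}|lborel. f r))}" for n q c :: real
  have "AE x in lborel. x \<notin> N (real n) q c" if "q < c" for n q c
    using negligible_large_averages[OF f that, of n] unfolding N_def[symmetric]
    by (metis AE_completion_iff AE_not_in negligible_iff_null_sets)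
  then have "AE x in lborel. \<forall>n::nat. \<forall>q\<in>\<rat>. \<forall>c\<in>\<rat>. q < c \<longrightarrow> x \<notin> N (real n) q c"
    by (auto simp: AE_all_countable AE_ball_countable countable_rat intro: AE_impI)
  then show ?thesis
  proof eventually_elim
    case (elim x)
    show ?case
    proof (intro allI impI)
      fix c assume "f x < c"
      obtain q where q: "q \<in> \<rat>" "f x < q" "q < c" using Rats_dense_in_real \<open>f x < c\<close> by blast
      obtain c' where c': "c' \<in> \<rat>" "q < c'" "c' < c" using Rats_dense_in_real \<open>q < c\<close> by blast
      obtain n :: nat where "\<bar>x\<bar> < real n" using reals_Archimedean2 by blast
      moreover have "x \<notin> N (real n) q c'" using elim q(1) c'(1,2) by blast
      ultimately obtain d where d0: "d > 0"
          "\<not> (\<exists>a b. a \<le> x \<and> x \<le> b \<and> a < b \<and> b - a < d \<and> c' * (b - a) < (LINT r:{a..b}|lborel. f r))"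
        using q(2) unfolding N_def mem_Collect_eq by blast
      then have d: "d > 0" "\<And>a b. a \<le> x \<Longrightarrow> x \<le> b \<Longrightarrow> a < b \<Longrightarrow> b - a < d \<Longrightarrow> (LINT r:{a..b}|lborel. f r) \<le> c' * (b - a)"
        by (simp, metis not_less)
      show "\<exists>d>0. \<forall>a b. a \<le> x \<and> x \<le> b \<and> a < b \<and> b - a < d \<longrightarrow> (LINT r:{a..b}|lborel. f r) \<le> c * (b - a)"
      proof (intro exI[of _ d] conjI d(1) allI impI, elim conjE)
        fix a b assume ab: "a \<le> x" "x \<le> b" "a < b" "b - a < d"
        have "(LINT r:{a..b}|lborel. f r) \<le> c' * (b - a)" using d(2) ab by blast
        also have "\<dots> \<le> c * (b - a)" using c' ab by (intro mult_right_mono) auto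
        finally show "(LINT r:{a..b}|lborel. f r) \<le> c * (b - a)" .
      qed
    qed
  qed
qed

lemma difference_quotient_close:
  fixes D h f e :: real
  assumes "h > 0" "e > 0" "D \<le> (f + e/2) * h" "- D \<le> (- f + e/2) * h"
  shows "\<bar>D / h - f\<bar> < e"
proof -
  have "(f - e/2) * h \<le> D" using assms(4) by (simp add: algebra_simps)
  then have "f - e/2 \<le> D / h" "D / h \<le> f + e/2"
    using assms by (simp_all add: pos_divide_le_eq pos_le_divide_eq)
  then show ?thesis using assms(2) by linarith
qed

theorem Lebesgue_differentiation:
  fixes f :: "real \<Rightarrow> real"
  assumes f: "integrable lborel f"
  shows "AE x in lborel. ((\<lambda>x. LINT r:{..x}|lborel. f r) has_real_derivative f x) (at x)"
proof -
  define F where "F x = (LINT r:{..x}|lborel. f r)" for x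
  have F: "F b - F a = (LINT r:{a..b}|lborel. f r)" if "a \<le> b" for a b
    unfolding F_def by (rule set_integral_atMost_diff[OF f that])
  have "integrable lborel (\<lambda>x. - f x)" using f by simp
  note AE_averages_le[OF f] AE_averages_le[OF this]
  then show ?thesis unfolding F_def[symmetric]
  proof eventually_elim
    case (elim x)
    show ?case
      unfolding has_field_derivative_iff LIM_eq
    proof (intro allI impI)
      fix e :: real assume "e > 0"
      obtain d1 where d1: "d1 > 0" "\<And>a b. a \<le> x \<Longrightarrow> x \<le> b \<Longrightarrow> a < b \<Longrightarrow> b - a < d1 \<Longrightarrow>
          F b - F a \<le> (f x + e/2) * (b - a)"
      proof -
        have "f x < f x + e/2" using \<open>e > 0\<close> by simp
        from elim(1)[THEN spec, THEN mp, OF this] obtain d where "d > 0"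
          "\<forall>a b. a \<le> x \<and> x \<le> b \<and> a < b \<and> b - a < d \<longrightarrow> (LINT r:{a..b}|lborel. f r) \<le> (f x + e/2) * (b - a)"
          by blast
        then show thesis by (intro that[of d]) (simp_all add: F)
      qed
      obtain d2 where d2: "d2 > 0" "\<And>a b. a \<le> x \<Longrightarrow> x \<le> b \<Longrightarrow> a < b \<Longrightarrow> b - a < d2 \<Longrightarrow>
          - (F b - F a) \<le> (- f x + e/2) * (b - a)"
      proof -
        have "- f x < - f x + e/2" using \<open>e > 0\<close> by simp
        from elim(2)[THEN spec, THEN mp, OF this] obtain d where "d > 0"
          "\<forall>a b. a \<le> x \<and> x \<le> b \<and> a < b \<and> b - a < d \<longrightarrow> (LINT r:{a..b}|lborel. - f r) \<le> (- f x + e/2) * (b - a)"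
          by blast
        moreover have "(LINT r:{a..b}|lborel. - f r) = - (LINT r:{a..b}|lborel. f r)" for a b
          by (simp add: set_lebesgue_integral_def)
        ultimately show thesis by (intro that[of d]) (simp_all add: F del: minus_diff_eq)
      qed
      show "\<exists>s>0. \<forall>y. y \<noteq> x \<and> norm (y - x) < s \<longrightarrow> norm ((F y - F x) / (y - x) - f x) < e"
      proof (intro exI[of _ "min d1 d2"] conjI allI impI, use d1 d2 in simp, elim conjE)
        fix y assume y: "y \<noteq> x" "norm (y - x) < min d1 d2"
        have yd: "\<bar>y - x\<bar> < d1" "\<bar>y - x\<bar> < d2" using y by auto
        have "y < x \<or> y > x" using y(1) by auto
        then consider "y < x" | "y > x" by blast
        then show "norm ((F y - F x) / (y - x) - f x) < e"
        proof cases
          case 1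
          have "F x - F y \<le> (f x + e/2) * (x - y)" "- (F x - F y) \<le> (- f x + e/2) * (x - y)"
            using d1(2)[of y x] d2(2)[of y x] 1 yd by simp_all
          from difference_quotient_close[OF _ \<open>e > 0\<close> this] 1
          have "\<bar>(F x - F y) / (x - y) - f x\<bar> < e" by simp
          moreover have "(F y - F x) / (y - x) = (F x - F y) / (x - y)" using 1 by (simp add: field_simps)
          ultimately show ?thesis by simp
        next
          case 2
          have "F y - F x \<le> (f x + e/2) * (y - x)" "- (F y - F x) \<le> (- f x + e/2) * (y - x)"
            using d1(2)[of x y] d2(2)[of x y] 2 yd by simp_all
          from difference_quotient_close[OF _ \<open>e > 0\<close> this] 2 show ?thesis by simp
        qed
      qed
    qed
  qed
qed

section \<open>Absolutely continuous functions as integrals\<close>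

lemma continuous_indefinite_integral:
  fixes g :: "real \<Rightarrow> real"
  assumes g: "integrable lborel g"
  shows "isCont (\<lambda>x. LINT r:{..x}|lborel. g r) x"
proof -
  let ?a = "x - 1" and ?b = "x + 1"
  have "set_integrable lborel {?a..?b} g" using g by (simp add: set_integrable_of_integrable)
  then have "g integrable_on {?a..?b}" by (rule set_borel_integral_eq_integral)
  then have "continuous_on {?a..?b} (\<lambda>y. integral {?a..y} g)"
    by (rule indefinite_integral_continuous_1)
  then have "continuous_on {?a..?b} (\<lambda>y. (LINT r:{..?a}|lborel. g r) + integral {?a..y} g)"
    by (intro continuous_intros)
  moreover have "(LINT r:{..?a}|lborel. g r) + integral {?a..y} g = (LINT r:{..y}|lborel. g r)" if "y \<in> {?a..?b}" for y
  proof -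
    have "integral {?a..y} g = (LINT r:{?a..y}|lborel. g r)"
      using g by (intro set_borel_integral_eq_integral(2)[symmetric] set_integrable_of_integrable) auto
    then show ?thesis using set_integral_atMost_diff[OF g, of ?a y] that by simp
  qed
  ultimately have "continuous_on {?a..?b} (\<lambda>y. LINT r:{..y}|lborel. g r)"
    by (rule continuous_on_eq)
  then have "continuous_on {?a<..<?b} (\<lambda>y. LINT r:{..y}|lborel. g r)"
    by (rule continuous_on_subset) auto
  then show ?thesis
    by (simp add: continuous_on_eq_continuous_at)
qed

text \<open>An absolutely continuous function is the difference of two increasing ones. Their interval measures
  add up to a density, so each of them is dominated by it and Radon--Nikodym applies.\<close>

lemma interval_measure_add_eq_density:
  fixes F1 F2 g :: "real \<Rightarrow> real"
  assumes mono: "\<And>x y. x \<le> y \<Longrightarrow> F1 x \<le> F1 y" "\<And>x y. x \<le> y \<Longrightarrow> F2 x \<le> F2 y"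
    and cont: "\<And>x. isCont F1 x" "\<And>x. isCont F2 x"
    and g: "integrable lborel g" "\<And>x. 0 \<le> g x"
    and sum: "\<And>a b. a \<le> b \<Longrightarrow> (F1 b - F1 a) + (F2 b - F2 a) = (LINT r:{a..b}|lborel. g r)"
    and A: "A \<in> sets borel"
  shows "emeasure (interval_measure F1) (A \<inter> {a<..b}) + emeasure (interval_measure F2) (A \<inter> {a<..b})
       = emeasure (density lborel (\<lambda>x. ennreal (g x))) (A \<inter> {a<..b})"
proof -
  let ?M1 = "interval_measure F1" and ?M2 = "interval_measure F2" and ?N = "density lborel (\<lambda>x. ennreal (g x))"
  have [measurable]: "g \<in> borel_measurable borel" using g by (simp add: borel_measurable_integrable)
  have rc: "continuous (at_right x) F1" "continuous (at_right x) F2" for x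
    using cont by (auto intro: continuous_at_imp_continuous_at_within)
  have 1: "emeasure ?M1 {a<..b} = ennreal (if a \<le> b then F1 b - F1 a else 0)"
          "emeasure ?M2 {a<..b} = ennreal (if a \<le> b then F2 b - F2 a else 0)" for a b
    using emeasure_interval_measure_Ioc[OF _ mono(1) rc(1)] emeasure_interval_measure_Ioc[OF _ mono(2) rc(2)] by auto
  have N: "emeasure ?N {a<..b} = ennreal (LINT r:{a..b}|lborel. g r)" for a b
  proof -
    have "emeasure ?N {a<..b} = (\<integral>\<^sup>+x. ennreal (indicator {a<..b} x * g x) \<partial>lborel)"
      by (auto simp: emeasure_density intro!: nn_integral_cong split: split_indicator)
    also have "\<dots> = ennreal (LINT x|lborel. indicator {a<..b} x * g x)"
      using g set_integrable_of_integrable[OF g(1), of "{a<..b}"]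
      by (intro nn_integral_eq_integral) (auto simp: set_integrable_def)
    also have "(LINT x|lborel. indicator {a<..b} x * g x) = (LINT r:{a<..b}|lborel. g r)"
      by (simp add: set_lebesgue_integral_def)
    also have "\<dots> = (LINT r:{a..b}|lborel. g r)"
      by (rule set_integral_discrete_difference[where X="{a}"]) auto
    finally show ?thesis .
  qed
  have Ioc: "emeasure ?M1 {a<..b} + emeasure ?M2 {a<..b} = emeasure ?N {a<..b}" for a b
    using mono[of a b] sum[of a b] by (auto simp: 1 N ennreal_plus[symmetric] set_lebesgue_integral_def simp del: ennreal_plus)
  have fin: "emeasure ?M1 {a<..b} \<noteq> \<infinity>" "emeasure ?M2 {a<..b} \<noteq> \<infinity>" for a b
    by (auto simp: 1)
  have finN: "emeasure ?N {a<..b} \<noteq> \<infinity>" for a b by (simp add: N)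
  have diffs: "(x - y) + (x' - y') = (x + x') - (y + y')"
    if "y \<le> x" "y' \<le> x'" "x \<noteq> \<infinity>" "x' \<noteq> \<infinity>" for x y x' y' :: ennreal
    using that by (cases x; cases y; cases x'; cases y')
      (auto simp: ennreal_minus ennreal_plus[symmetric] top_unique simp del: ennreal_plus)
  define W where "W = {a<..b}"
  have W[measurable]: "W \<in> sets borel" by (simp add: W_def)
  have gen: "A \<in> sigma_sets UNIV (range (\<lambda>(a, b). {a<..b::real}))"
    using A unfolding borel_sigma_sets_Ioc by simp
  have stable: "Int_stable (range (\<lambda>(a, b). {a<..b::real}))"
  proof (rule Int_stableI, clarify)
    fix a b c d :: real
    have "{a<..b} \<inter> {c<..d} = {max a c<..min b d}" by auto
    then show "{a<..b} \<inter> {c<..d} \<in> range (\<lambda>(a, b). {a<..b})" by auto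
  qed
  have closed: "range (\<lambda>(a, b). {a<..b::real}) \<subseteq> Pow UNIV" by simp
  from stable closed gen have "emeasure ?M1 (A \<inter> W) + emeasure ?M2 (A \<inter> W) = emeasure ?N (A \<inter> W)"
  proof (induct rule: sigma_sets_induct_disjoint)
    case (basic B)
    then obtain c d where "B = {c<..d}" by auto
    then have "B \<inter> W = {max a c<..min b d}" by (auto simp: W_def)
    then show ?case by (simp only: Ioc)
  next
    case (compl B)
    then have [measurable]: "B \<in> sets borel" unfolding borel_sigma_sets_Ioc by simp
    have eq: "(UNIV - B) \<inter> W = W - B \<inter> W" by auto
    have d: "emeasure M (W - B \<inter> W) = emeasure M W - emeasure M (B \<inter> W)"
      if "sets M = sets borel" "emeasure M W \<noteq> \<infinity>" for M
    proof (rule emeasure_Diff)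
      have "emeasure M (B \<inter> W) \<le> emeasure M W"
        using that by (intro emeasure_mono) auto
      then show "emeasure M (B \<inter> W) \<noteq> \<infinity>" using that by (auto simp: top_unique)
    qed (use that in auto)
    have le: "emeasure M (B \<inter> W) \<le> emeasure M W" if "sets M = sets borel" for M
      using that by (intro emeasure_mono) auto
    have "emeasure ?M1 (W - B \<inter> W) + emeasure ?M2 (W - B \<inter> W) =
      (emeasure ?M1 W - emeasure ?M1 (B \<inter> W)) + (emeasure ?M2 W - emeasure ?M2 (B \<inter> W))"
      using fin[of a b] by (simp add: d W_def[symmetric])
    also have "\<dots> = (emeasure ?M1 W + emeasure ?M2 W) - (emeasure ?M1 (B \<inter> W) + emeasure ?M2 (B \<inter> W))"
      using fin[of a b] by (intro diffs le) (auto simp: W_def)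
    also have "\<dots> = emeasure ?N W - emeasure ?N (B \<inter> W)"
      using compl Ioc[of a b] by (simp add: W_def)
    also have "\<dots> = emeasure ?N (W - B \<inter> W)"
      using finN[of a b] by (simp add: d W_def[symmetric])
    finally show ?case by (simp only: eq)
  next
    case (union B)
    then have [measurable]: "B i \<in> sets borel" for i unfolding borel_sigma_sets_Ioc by auto
    have s: "emeasure M ((\<Union>i. B i) \<inter> W) = (\<Sum>i. emeasure M (B i \<inter> W))" if "sets M = sets borel" for M
    proof -
      have "emeasure M (\<Union>i. B i \<inter> W) = (\<Sum>i. emeasure M (B i \<inter> W))"
        using that union(1) by (intro suminf_emeasure[symmetric]) (auto simp: disjoint_family_on_def)
      then show ?thesis by simp
    qed
    have "emeasure ?M1 ((\<Union>i. B i) \<inter> W) + emeasure ?M2 ((\<Union>i. B i) \<inter> W) = (\<Sum>i. emeasure ?M1 (B i \<inter> W) + emeasure ?M2 (B i \<inter> W))"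
      by (simp add: s suminf_add)
    also have "\<dots> = (\<Sum>i. emeasure ?N (B i \<inter> W))" using union by simp
    also have "\<dots> = emeasure ?N ((\<Union>i. B i) \<inter> W)" by (simp add: s)
    finally show ?case .
  qed (auto simp: W_def)
  then show ?thesis by (simp add: W_def)
qed

lemma interval_measure_le_density:
  fixes F1 F2 g :: "real \<Rightarrow> real"
  assumes mono: "\<And>x y. x \<le> y \<Longrightarrow> F1 x \<le> F1 y" "\<And>x y. x \<le> y \<Longrightarrow> F2 x \<le> F2 y"
    and cont: "\<And>x. isCont F1 x" "\<And>x. isCont F2 x"
    and g: "integrable lborel g" "\<And>x. 0 \<le> g x"
    and sum: "\<And>a b. a \<le> b \<Longrightarrow> (F1 b - F1 a) + (F2 b - F2 a) = (LINT r:{a..b}|lborel. g r)"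
    and A: "A \<in> sets borel"
  shows "emeasure (interval_measure F1) A \<le> emeasure (density lborel (\<lambda>x. ennreal (g x))) A"
proof -
  let ?M = "interval_measure F1" and ?N = "density lborel (\<lambda>x. ennreal (g x))"
  define B where "B n = A \<inter> {- real n<..real n}" for n
  have [measurable]: "B n \<in> sets borel" for n using A by (simp add: B_def)
  have inc: "incseq B" by (force simp: incseq_def B_def)
  have UB: "(\<Union>n. B n) = A"
  proof -
    have "\<exists>n. - real n < x \<and> x \<le> real n" for x
    proof -
      obtain n where "\<bar>x\<bar> < real n" using reals_Archimedean2 by blast
      then show ?thesis by (intro exI[of _ n]) auto
    qed
    then show ?thesis by (auto simp: B_def)
  qed
  have "emeasure ?M (B n) \<le> emeasure ?N A" for n
  proof -
    have "emeasure ?M (B n) \<le> emeasure ?M (B n) + emeasure (interval_measure F2) (B n)"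
      by simp
    also have "\<dots> = emeasure ?N (B n)"
      unfolding B_def by (rule interval_measure_add_eq_density[OF assms])
    also have "\<dots> \<le> emeasure ?N A" using A by (intro emeasure_mono) (auto simp: B_def)
    finally show ?thesis .
  qed
  moreover have "emeasure ?M A = (SUP n. emeasure ?M (B n))"
    using SUP_emeasure_incseq[of B ?M, OF _ inc] UB by (simp add: image_subset_iff)
  ultimately show ?thesis by (auto intro: SUP_least)
qed

theorem absolutely_continuous_integral_representation:
  fixes f g :: "real \<Rightarrow> real"
  assumes g: "integrable lborel g"
    and bd: "\<And>s t. s \<le> t \<Longrightarrow> \<bar>f t - f s\<bar> \<le> (LINT r:{s..t}|lborel. g r)"
  obtains k where "integrable lborel k" "\<And>s t. s \<le> t \<Longrightarrow> f t - f s = (LINT r:{s..t}|lborel. k r)"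
    "AE x in lborel. \<bar>k x\<bar> \<le> g x"
proof -
  define P where "P x = (LINT r:{..x}|lborel. \<bar>g r\<bar>)" for x
  have ag: "integrable lborel (\<lambda>r. \<bar>g r\<bar>)" using g by simp
  have P: "P t - P s = (LINT r:{s..t}|lborel. \<bar>g r\<bar>)" if "s \<le> t" for s t
    unfolding P_def by (rule set_integral_atMost_diff[OF ag that])
  have bdP: "\<bar>f t - f s\<bar> \<le> P t - P s" if "s \<le> t" for s t
  proof -
    have "(LINT r:{s..t}|lborel. g r) \<le> (LINT r:{s..t}|lborel. \<bar>g r\<bar>)"
      by (intro set_integral_mono set_integrable_of_integrable g ag) auto
    then show ?thesis using bd[OF that] P[OF that] by linarith
  qed
  have bdP': "\<bar>f t - f s\<bar> \<le> \<bar>P t - P s\<bar>" for s t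
    using bdP[of s t] bdP[of t s] by (cases "s \<le> t") (auto simp: abs_minus_commute)
  have contP: "isCont P x" for x
    unfolding P_def by (rule continuous_indefinite_integral[OF ag])
  have contf: "isCont f x" for x
    unfolding isCont_def
  proof (rule metric_tendsto_imp_tendsto)
    show "(P \<longlongrightarrow> P x) (at x)" using contP by (simp add: isCont_def)
    show "\<forall>\<^sub>F t in at x. dist (f t) (f x) \<le> dist (P t) (P x)"
      using bdP' by (simp add: dist_real_def)
  qed
  define F1 where "F1 x = P x + f x" for x
  define F2 where "F2 x = P x - f x" for x
  have mono: "F1 x \<le> F1 y" "F2 x \<le> F2 y" if "x \<le> y" for x y
    using bdP[OF that] by (auto simp: F1_def F2_def abs_le_iff)
  have cont: "isCont F1 x" "isCont F2 x" for x
    unfolding F1_def F2_def by (intro continuous_intros contP contf)+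
  have g2: "integrable lborel (\<lambda>r. 2 * \<bar>g r\<bar>)" using g by simp
  have sum: "(F1 b - F1 a) + (F2 b - F2 a) = (LINT r:{a..b}|lborel. 2 * \<bar>g r\<bar>)" if "a \<le> b" for a b
    using P[OF that] by (simp add: F1_def F2_def)
  have [measurable]: "g \<in> borel_measurable borel" using g by (simp add: borel_measurable_integrable)
  let ?M = "interval_measure F1" and ?N = "density lborel (\<lambda>x. ennreal (2 * \<bar>g x\<bar>))"
  have le: "emeasure ?M A \<le> emeasure ?N A" if "A \<in> sets borel" for A
    by (rule interval_measure_le_density[OF mono cont g2 _ sum that]) auto
  have [measurable]: "g \<in> borel_measurable borel" using g by (simp add: borel_measurable_integrable)
  have "absolutely_continuous lborel ?M"
    unfolding absolutely_continuous_def
  proof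
    fix A :: "real set" assume A: "A \<in> null_sets lborel"
    have "A \<in> null_sets ?N"
      using A AE_not_in[OF A] by (subst null_sets_density_iff) (auto simp: null_sets_def elim!: eventually_mono)
    then show "A \<in> null_sets ?M" using le[of A] A by (auto simp: null_sets_def)
  qed
  then obtain h where h: "h \<in> borel_measurable lborel" "density lborel h = ?M"
    using sigma_finite_measure.Radon_Nikodym[OF sigma_finite_lborel, of ?M] by auto
  note h(1)[measurable]
  have hint: "(\<integral>\<^sup>+x. h x \<partial>lborel) < \<infinity>"
  proof -
    have "(\<integral>\<^sup>+x. h x \<partial>lborel) = emeasure ?M UNIV"
      unfolding h(2)[symmetric] by (simp add: emeasure_density)
    also have "\<dots> \<le> emeasure ?N UNIV" by (rule le) simp
    also have "\<dots> = (\<integral>\<^sup>+x. ennreal (2 * \<bar>g x\<bar>) \<partial>lborel)" by (simp add: emeasure_density)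
    also have "\<dots> = ennreal (\<integral>x. 2 * \<bar>g x\<bar> \<partial>lborel)" by (rule nn_integral_eq_integral[OF g2]) auto
    also have "\<dots> < \<infinity>" by simp
    finally show ?thesis .
  qed
  have hfin: "AE x in lborel. h x = ennreal (enn2real (h x))"
    using nn_integral_PInf_AE[OF h(1)] hint by (auto elim!: eventually_mono simp: less_top)
  define k1 where "k1 x = enn2real (h x)" for x
  have [measurable]: "k1 \<in> borel_measurable borel" unfolding k1_def using h(1) by simp
  have k1nn: "k1 x \<ge> 0" for x by (simp add: k1_def)
  have k1int: "integrable lborel k1"
  proof (rule integrableI_nonneg)
    have "(\<integral>\<^sup>+x. ennreal (k1 x) \<partial>lborel) = (\<integral>\<^sup>+x. h x \<partial>lborel)"
      using hfin by (intro nn_integral_cong_AE) (auto elim!: eventually_mono simp: k1_def)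
    then show "(\<integral>\<^sup>+x. ennreal (k1 x) \<partial>lborel) < \<infinity>" using hint by simp
  qed (use k1nn in auto)
  have F1: "F1 b - F1 a = (LINT r:{a..b}|lborel. k1 r)" if "a \<le> b" for a b
  proof -
    have "ennreal (F1 b - F1 a) = emeasure ?M {a<..b}"
      using that mono cont by (subst emeasure_interval_measure_Ioc) (auto intro: continuous_at_imp_continuous_at_within)
    also have "\<dots> = (\<integral>\<^sup>+x. h x * indicator {a<..b} x \<partial>lborel)"
      unfolding h(2)[symmetric] by (simp add: emeasure_density)
    also have "\<dots> = (\<integral>\<^sup>+x. ennreal (indicator {a<..b} x * k1 x) \<partial>lborel)"
      using hfin by (intro nn_integral_cong_AE) (auto elim!: eventually_mono simp: k1_def split: split_indicator)
    also have "\<dots> = ennreal (LINT x|lborel. indicator {a<..b} x * k1 x)"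
      using k1nn set_integrable_of_integrable[OF k1int, of "{a<..b}"]
      by (intro nn_integral_eq_integral) (auto simp: set_integrable_def)
    also have "(LINT x|lborel. indicator {a<..b} x * k1 x) = (LINT r:{a<..b}|lborel. k1 r)"
      by (simp add: set_lebesgue_integral_def)
    also have "\<dots> = (LINT r:{a..b}|lborel. k1 r)"
      by (rule set_integral_discrete_difference[where X="{a}"]) auto
    finally show ?thesis
      using mono(1)[OF that] k1nn by (subst (asm) ennreal_inj) (auto simp: set_lebesgue_integral_def intro!: integral_nonneg_AE)
  qed
  define k where "k x = k1 x - \<bar>g x\<bar>" for x
  have kint: "integrable lborel k" unfolding k_def using k1int ag by simp
  have f: "f t - f s = (LINT r:{s..t}|lborel. k r)" if "s \<le> t" for s t
  proof -
    have "(LINT r:{s..t}|lborel. k r) = (LINT r:{s..t}|lborel. k1 r) - (LINT r:{s..t}|lborel. \<bar>g r\<bar>)"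
      unfolding k_def by (intro set_integral_diff set_integrable_of_integrable k1int ag) auto
    then show ?thesis using F1[OF that] P[OF that] by (simp add: F1_def)
  qed
  have "AE x in lborel. \<bar>k x\<bar> \<le> g x"
    using Lebesgue_differentiation[OF kint] Lebesgue_differentiation[OF g]
  proof eventually_elim
    case (elim x)
    define K where "K y = (LINT r:{..y}|lborel. k r)" for y
    define H where "H y = (LINT r:{..y}|lborel. g r)" for y
    have "\<bar>K t - K s\<bar> \<le> H t - H s" if "s \<le> t" for s t
      using bd[OF that] f[OF that] set_integral_atMost_diff[OF kint that] set_integral_atMost_diff[OF g that]
      by (simp add: K_def H_def)
    then have m: "mono_on UNIV (\<lambda>x. H x - K x)" "mono_on UNIV (\<lambda>x. H x + K x)"
      by (force simp: mono_on_def abs_le_iff)+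
    have d: "(K has_real_derivative k x) (at x)" "(H has_real_derivative g x) (at x)"
      using elim by (simp_all add: K_def[abs_def] H_def[abs_def])
    have "0 \<le> g x - k x"
      by (rule mono_on_imp_deriv_nonneg[OF m(1) DERIV_diff[OF d(2,1)]]) simp
    moreover have "0 \<le> g x + k x"
      by (rule mono_on_imp_deriv_nonneg[OF m(2) DERIV_add[OF d(2,1)]]) simp
    ultimately show ?case by (simp add: abs_le_iff)
  qed
  with kint f show thesis by (rule that)
qed

section \<open>The metric derivative\<close>

lemma continuous_of_dist_le_integral:
  fixes U :: "real \<Rightarrow> 'a::metric_space"
  assumes g: "integrable lborel g"
    and bd: "\<And>s t. s \<le> t \<Longrightarrow> dist (U s) (U t) \<le> (LINT r:{s..t}|lborel. g r)"
  shows "isCont U x"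
  unfolding isCont_def
proof (rule metric_tendsto_imp_tendsto)
  let ?G = "\<lambda>x. LINT r:{..x}|lborel. g r"
  show "(?G \<longlongrightarrow> ?G x) (at x)" using continuous_indefinite_integral[OF g] by (simp add: isCont_def)
  have "dist (U s) (U t) \<le> \<bar>?G s - ?G t\<bar>" for s t
    using bd[of s t] bd[of t s] set_integral_atMost_diff[OF g, of s t] set_integral_atMost_diff[OF g, of t s]
    by (cases "s \<le> t") (auto simp: abs_minus_commute dist_commute)
  then show "\<forall>\<^sub>F t in at x. dist (U t) (U x) \<le> dist (?G t) (?G x)"
    by (simp add: dist_real_def)
qed

lemma tendsto_abs_difference_quotient:
  fixes f :: "real \<Rightarrow> real"
  assumes "(f has_real_derivative D) (at t)"
  shows "((\<lambda>r. \<bar>f r - f t\<bar> / \<bar>t - r\<bar>) \<longlongrightarrow> \<bar>D\<bar>) (at t)"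
proof -
  have "((\<lambda>r. \<bar>(f r - f t) / (r - t)\<bar>) \<longlongrightarrow> \<bar>D\<bar>) (at t)"
    using assms by (intro tendsto_rabs) (simp add: has_field_derivative_iff)
  then show ?thesis by (simp add: abs_minus_commute)
qed

text \<open>The density \<open>k\<close> is the supremum, over rational \<open>q\<close>, of the derivatives of the
  real functions \<open>t \<mapsto> dist (U t) (U q)\<close>.\<close>

theorem metric_derivative_exists:
  fixes U :: "real \<Rightarrow> 'a::metric_space"
  assumes g: "integrable lborel g"
    and bd: "\<And>s t. s \<le> t \<Longrightarrow> dist (U s) (U t) \<le> (LINT r:{s..t}|lborel. g r)"
  obtains k where "integrable lborel k" "AE x in lborel. k x \<le> g x"
    "\<And>s t. s \<le> t \<Longrightarrow> dist (U s) (U t) \<le> (LINT r:{s..t}|lborel. k r)"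
    "AE t in lborel. ((\<lambda>r. dist (U r) (U t) / \<bar>t - r\<bar>) \<longlongrightarrow> k t) (at t)"
proof -
  obtain q :: "nat \<Rightarrow> real" where q: "range q = \<rat>"
    using countable_rat range_from_nat_into[of "\<rat>::real set"] by (metis Rats_0 empty_iff)
  define f where "f n t = dist (U t) (U (q n))" for n t
  have fU: "\<bar>f n t - f n s\<bar> \<le> dist (U s) (U t)" for n s t
    unfolding f_def by (metis abs_dist_diff_le dist_commute)
  have "\<exists>k. integrable lborel k \<and> (\<forall>s t. s \<le> t \<longrightarrow> f n t - f n s = (LINT r:{s..t}|lborel. k r)) \<and>
    (AE x in lborel. \<bar>k x\<bar> \<le> g x)" for n
  proof -
    have "\<bar>f n t - f n s\<bar> \<le> (LINT r:{s..t}|lborel. g r)" if "s \<le> t" for s t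
      using fU[of n t s] bd[OF that] by linarith
    then show ?thesis by (rule absolutely_continuous_integral_representation[OF g, of "f n"]) blast+
  qed
  then obtain kn where kn: "\<And>n. integrable lborel (kn n)"
    "\<And>n s t. s \<le> t \<Longrightarrow> f n t - f n s = (LINT r:{s..t}|lborel. kn n r)"
    "\<And>n. AE x in lborel. \<bar>kn n x\<bar> \<le> g x"
    by metis
  have [measurable]: "g \<in> borel_measurable borel" "kn n \<in> borel_measurable borel" for n
    using g kn by (auto simp: borel_measurable_integrable)
  define \<kappa> where "\<kappa> n x = min \<bar>kn n x\<bar> \<bar>g x\<bar>" for n x
  define k where "k x = (SUP n. \<kappa> n x)" for x
  have bdd: "bdd_above (range (\<lambda>n. \<kappa> n x))" for x
    by (rule bdd_aboveI[of _ "\<bar>g x\<bar>"]) (auto simp: \<kappa>_def)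
  have \<kappa>k: "\<kappa> n x \<le> k x" for n x unfolding k_def by (rule cSUP_upper[OF _ bdd]) simp
  have knn: "0 \<le> k x" for x using \<kappa>k[of 0 x] by (auto simp: \<kappa>_def)
  have kg: "k x \<le> \<bar>g x\<bar>" for x unfolding k_def by (rule cSUP_least) (auto simp: \<kappa>_def)
  have [measurable]: "k \<in> borel_measurable borel"
    unfolding k_def[abs_def] by (rule borel_measurable_cSUP) (use bdd in \<open>auto simp: \<kappa>_def\<close>)
  have kint: "integrable lborel k"
    by (rule Bochner_Integration.integrable_bound[OF g]) (use knn kg in auto)
  have AE1: "AE x in lborel. \<forall>n. \<bar>kn n x\<bar> \<le> g x"
    using kn(3) by (simp add: AE_all_countable)
  have kg': "AE x in lborel. k x \<le> g x"
    using AE1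
  proof eventually_elim
    case (elim x)
    then have "0 \<le> g x" using abs_ge_zero order_trans by blast
    then show ?case using kg[of x] by simp
  qed
  have f_le: "\<bar>f n t - f n s\<bar> \<le> (LINT r:{s..t}|lborel. k r)" if "s \<le> t" for n s t
  proof -
    have "\<bar>f n t - f n s\<bar> \<le> (LINT r:{s..t}|lborel. \<bar>kn n r\<bar>)"
      unfolding kn(2)[OF that]
      using set_integral_norm_bound[of lborel "{s..t}" "kn n"] kn(1) by (simp add: set_integrable_of_integrable)
    also have "\<dots> \<le> (LINT r:{s..t}|lborel. k r)"
    proof (rule set_integral_mono_AE)
      show "AE x\<in>{s..t} in lborel. \<bar>kn n x\<bar> \<le> k x"
        using AE1
      proof eventually_elim
        case (elim x)
        then have "\<kappa> n x = \<bar>kn n x\<bar>" by (auto simp: \<kappa>_def min_def intro: order_trans[OF _ abs_ge_self])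
        then show ?case using \<kappa>k[of n x] by simp
      qed
    qed (use kn kint in \<open>auto intro!: set_integrable_of_integrable\<close>)
    finally show ?thesis .
  qed
  have contU: "isCont U x" for x by (rule continuous_of_dist_le_integral[OF g bd])
  have d_le: "dist (U s) (U t) \<le> (LINT r:{s..t}|lborel. k r)" if "s \<le> t" for s t
  proof (rule field_le_epsilon)
    fix e :: real assume "e > 0"
    then obtain d where d: "d > 0" "\<And>y. dist y s < d \<Longrightarrow> dist (U y) (U s) < e/2"
      using contU[of s] unfolding continuous_at_eps_delta by (metis half_gt_zero)
    obtain y where "y \<in> \<rat>" "s < y" "y < s + d" using Rats_dense_in_real[of s "s + d"] d by auto
    then obtain n where n: "y = q n" using q by auto
    have "dist (U (q n)) (U s) < e/2" using d(2)[of y] \<open>s < y\<close> \<open>y < s + d\<close> n by (auto simp: dist_real_def)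
    then have "dist (U s) (U t) \<le> \<bar>f n t - f n s\<bar> + e"
      using dist_triangle[of "U s" "U t" "U (q n)"] by (simp add: f_def dist_commute)
    then show "dist (U s) (U t) \<le> (LINT r:{s..t}|lborel. k r) + e" using f_le[OF that, of n] by linarith
  qed
  define H where "H x = (LINT r:{..x}|lborel. k r)" for x
  have dH: "dist (U s) (U t) \<le> \<bar>H s - H t\<bar>" for s t
    using d_le[of s t] d_le[of t s] set_integral_atMost_diff[OF kint, of s t] set_integral_atMost_diff[OF kint, of t s]
    unfolding H_def by (cases "s \<le> t") (auto simp: abs_minus_commute dist_commute)
  have AE2: "AE x in lborel. \<forall>n. ((\<lambda>x. LINT r:{..x}|lborel. kn n r) has_real_derivative kn n x) (at x)"
    using Lebesgue_differentiation[OF kn(1)] by (simp add: AE_all_countable)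
  have "AE t in lborel. ((\<lambda>r. dist (U r) (U t) / \<bar>t - r\<bar>) \<longlongrightarrow> k t) (at t)"
    using AE1 AE2 Lebesgue_differentiation[OF kint]
  proof eventually_elim
    case (elim t)
    have H': "((\<lambda>r. \<bar>H r - H t\<bar> / \<bar>t - r\<bar>) \<longlongrightarrow> k t) (at t)"
      using tendsto_abs_difference_quotient[of H "k t" t] elim(3) knn[of t] by (simp add: H_def[abs_def])
    have f': "((\<lambda>r. \<bar>f n r - f n t\<bar> / \<bar>t - r\<bar>) \<longlongrightarrow> \<bar>kn n t\<bar>) (at t)" for n
    proof -
      define Kn where "Kn x = (LINT r:{..x}|lborel. kn n r)" for x
      have "f n r - f n s = Kn r - Kn s" for r s
        using kn(2)[of s r n] kn(2)[of r s n] set_integral_atMost_diff[OF kn(1), of s r n] set_integral_atMost_diff[OF kn(1), of r s n]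
        unfolding Kn_def by (cases "s \<le> r") auto
      moreover have "((\<lambda>r. \<bar>Kn r - Kn t\<bar> / \<bar>t - r\<bar>) \<longlongrightarrow> \<bar>kn n t\<bar>) (at t)"
        by (rule tendsto_abs_difference_quotient) (use elim(2) in \<open>simp add: Kn_def[abs_def]\<close>)
      ultimately show ?thesis by simp
    qed
    show ?case
    proof (rule order_tendstoI)
      fix a assume "k t < a"
      with H' have "\<forall>\<^sub>F r in at t. \<bar>H r - H t\<bar> / \<bar>t - r\<bar> < a" by (rule order_tendstoD)
      then show "\<forall>\<^sub>F r in at t. dist (U r) (U t) / \<bar>t - r\<bar> < a"
        by eventually_elim (rule le_less_trans[OF divide_right_mono[OF dH]], auto)
    next
      fix a assume "a < k t"
      then obtain n where "a < \<kappa> n t" unfolding k_def using less_cSUP_iff[OF _ bdd] by auto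
      then have "a < \<bar>kn n t\<bar>" by (simp add: \<kappa>_def)
      with f' have "\<forall>\<^sub>F r in at t. a < \<bar>f n r - f n t\<bar> / \<bar>t - r\<bar>" by (rule order_tendstoD)
      then show "\<forall>\<^sub>F r in at t. a < dist (U r) (U t) / \<bar>t - r\<bar>"
        by eventually_elim (erule less_le_trans, rule divide_right_mono, metis fU dist_commute, simp)
    qed
  qed
  with kint kg' d_le show thesis by (rule that)
qed

text \<open>A Borel representative of \<open>metric_deriv {0..} u\<close>: a limit along one fixed sequence, with the value
  at points of divergence made nonnegative by \<open>max 0\<close>.\<close>

definition speed :: "(real \<Rightarrow> 'a::metric_space) \<Rightarrow> real \<Rightarrow> real" where
  "speed u t = (if 0 < t then
     max 0 (lim (\<lambda>n. real (Suc n) * dist (u (max 0 (t + inverse (real (Suc n))))) (u (max 0 t)))) else 0)"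

definition arc_bound :: "(real \<Rightarrow> 'a::metric_space) \<Rightarrow> (real \<Rightarrow> real) \<Rightarrow> real \<Rightarrow> bool" where
  "arc_bound u g T \<longleftrightarrow> set_integrable lborel {0..T} g \<and>
     (\<forall>s t. 0 \<le> s \<longrightarrow> s \<le> t \<longrightarrow> t \<le> T \<longrightarrow> dist (u s) (u t) \<le> (LINT r:{s..t}|lborel. g r))"

lemma speed_nonneg: "0 \<le> speed u t"
  by (simp add: speed_def)

lemma speed_eqI:
  assumes "0 < t" and lim: "((\<lambda>r. dist (u r) (u t) / \<bar>t - r\<bar>) \<longlongrightarrow> L) (at t)"
  shows "speed u t = L" "metric_deriv {0..} u t = L"
proof -
  let ?s = "\<lambda>n. t + inverse (real (Suc n))"
  have "(\<lambda>n. t + inverse (real (Suc n))) \<longlonglongrightarrow> t + 0"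
    by (intro tendsto_intros LIMSEQ_inverse_real_of_nat)
  then have "filterlim ?s (at t) sequentially"
    by (intro filterlim_atI) (auto intro!: always_eventually)
  then have "(\<lambda>n. dist (u (?s n)) (u t) / \<bar>t - ?s n\<bar>) \<longlonglongrightarrow> L"
    by (rule filterlim_compose[OF lim])
  moreover have "dist (u (?s n)) (u t) / \<bar>t - ?s n\<bar> = real (Suc n) * dist (u (max 0 (?s n))) (u (max 0 t))" for n
    using \<open>0 < t\<close> by (simp add: divide_inverse add_pos_pos max_absorb2 less_imp_le mult.commute)
  ultimately have "(\<lambda>n. real (Suc n) * dist (u (max 0 (?s n))) (u (max 0 t))) \<longlonglongrightarrow> L" by simp
  moreover have "L \<ge> 0"
    by (rule tendsto_lowerbound[OF lim]) (auto intro!: always_eventually)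
  ultimately show "speed u t = L" using \<open>0 < t\<close> by (simp add: speed_def limI)
  have "at t within {0..} = at t" using \<open>0 < t\<close> by (intro at_within_interior) simp
  then show "metric_deriv {0..} u t = L"
    unfolding metric_deriv_def using lim by (auto intro!: tendsto_Lim)
qed

lemma dist_clamp_le:
  fixes u :: "real \<Rightarrow> 'a::metric_space"
  assumes bd: "arc_bound u g T" and "0 \<le> T" "s \<le> t"
  shows "dist (u (max 0 (min T s))) (u (max 0 (min T t))) \<le> (LINT r:{s..t}|lborel. indicator {0..T} r * g r)"
proof -
  let ?s = "max 0 (min T s)" and ?t = "max 0 (min T t)"
  have "(LINT r:{s..t}|lborel. indicator {0..T} r * g r) = (LINT r:{s..t} \<inter> {0..T}|lborel. g r)"
    unfolding set_lebesgue_integral_def by (intro Bochner_Integration.integral_cong) (auto split: split_indicator)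
  moreover have "dist (u ?s) (u ?t) \<le> (LINT r:{s..t} \<inter> {0..T}|lborel. g r)"
  proof (cases "{s..t} \<inter> {0..T} = {}")
    case True
    then have "\<not> (max s 0 \<le> min t T)" by (auto simp: Int_atLeastAtMost)
    then have "?s = ?t" using assms by auto
    then have "dist (u ?s) (u ?t) = 0" by simp
    then show ?thesis unfolding True by (simp add: set_lebesgue_integral_def del: min.commute)
  next
    case False
    then have "max s 0 \<le> min t T" by (auto simp: Int_atLeastAtMost)
    then have "?s = max s 0" "?t = min t T" using assms by auto
    then have "{s..t} \<inter> {0..T} = {?s..?t}" by (simp only: Int_atLeastAtMost)
    moreover have "dist (u ?s) (u ?t) \<le> (LINT r:{?s..?t}|lborel. g r)"
      using bd assms unfolding arc_bound_def by auto
    ultimately show ?thesis by (simp only:)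
  qed
  ultimately show ?thesis by simp
qed

lemma speed_local:
  fixes u :: "real \<Rightarrow> 'a::metric_space"
  assumes bd: "arc_bound u g T" and "0 < T"
  shows "AE t in lborel. 0 < t \<and> t < T \<longrightarrow> ((\<lambda>r. dist (u r) (u t) / \<bar>t - r\<bar>) \<longlongrightarrow> speed u t) (at t) \<and> speed u t \<le> g t"
    and "speed u \<in> borel_measurable borel \<Longrightarrow> arc_bound u (speed u) T"
    and "isCont (\<lambda>t. u (max 0 (min T t))) x"
proof -
  define U where "U t = u (max 0 (min T t))" for t
  define h where "h r = indicator {0..T} r * g r" for r
  have h: "integrable lborel h" using bd by (simp add: h_def[abs_def] arc_bound_def set_integrable_def)
  have Ubd: "dist (U s) (U t) \<le> (LINT r:{s..t}|lborel. h r)" if "s \<le> t" for s t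
    using dist_clamp_le[OF bd _ that] \<open>0 < T\<close> by (simp add: U_def h_def)
  show "isCont (\<lambda>t. u (max 0 (min T t))) x"
    using continuous_of_dist_le_integral[OF h Ubd, of x] by (simp add: U_def[abs_def])
  obtain k where k: "integrable lborel k" "AE x in lborel. k x \<le> h x"
    "\<And>s t. s \<le> t \<Longrightarrow> dist (U s) (U t) \<le> (LINT r:{s..t}|lborel. k r)"
    "AE t in lborel. ((\<lambda>r. dist (U r) (U t) / \<bar>t - r\<bar>) \<longlongrightarrow> k t) (at t)"
    by (rule metric_derivative_exists[OF h Ubd]) auto
  have main: "AE t in lborel. 0 < t \<and> t < T \<longrightarrow> ((\<lambda>r. dist (u r) (u t) / \<bar>t - r\<bar>) \<longlongrightarrow> k t) (at t)"
    using k(4)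
  proof eventually_elim
    case (elim t)
    show ?case
    proof
      assume t: "0 < t \<and> t < T"
      have "\<forall>\<^sub>F r in at t. r \<in> {0<..<T}"
        using t by (intro eventually_at_in_open'[of "{0<..<T}"]) auto
      then have "\<forall>\<^sub>F r in at t. dist (U r) (U t) / \<bar>t - r\<bar> = dist (u r) (u t) / \<bar>t - r\<bar>"
        by eventually_elim (use t in \<open>simp add: U_def max_absorb2 min_absorb2 less_imp_le\<close>)
      then show "((\<lambda>r. dist (u r) (u t) / \<bar>t - r\<bar>) \<longlongrightarrow> k t) (at t)"
        using elim by (simp only: tendsto_cong)
    qed
  qed
  have ks: "AE t in lborel. 0 < t \<and> t < T \<longrightarrow> speed u t = k t"
    using main by eventually_elim (auto intro: speed_eqI)
  show "AE t in lborel. 0 < t \<and> t < T \<longrightarrow> ((\<lambda>r. dist (u r) (u t) / \<bar>t - r\<bar>) \<longlongrightarrow> speed u t) (at t) \<and> speed u t \<le> g t"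
    using main ks k(2) by eventually_elim (auto simp: h_def indicator_def)
  assume meas: "speed u \<in> borel_measurable borel"
  have ks': "AE t\<in>{0..T} in lborel. speed u t = k t"
    using ks AE_lborel_singleton[of 0] AE_lborel_singleton[of T] by eventually_elim auto
  show "arc_bound u (speed u) T"
    unfolding arc_bound_def
  proof (intro conjI allI impI)
    have "set_integrable lborel {0..T} k" using k(1) by (simp add: set_integrable_of_integrable)
    then show "set_integrable lborel {0..T} (speed u)"
      using ks' meas k(1) unfolding set_integrable_def
      by (subst integrable_cong_AE) (auto elim!: eventually_mono simp: indicator_def borel_measurable_integrable)
    fix s t assume st: "0 \<le> s" "s \<le> t" "t \<le> T"
    have "dist (u s) (u t) = dist (U s) (U t)" using st by (simp add: U_def)
    also have "\<dots> \<le> (LINT r:{s..t}|lborel. k r)" by (rule k(3)[OF st(2)])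
    also have "\<dots> = (LINT r:{s..t}|lborel. speed u r)"
      using ks' meas k(1) st by (intro set_lebesgue_integral_cong_AE) (auto elim!: eventually_mono simp: borel_measurable_integrable)
    finally show "dist (u s) (u t) \<le> (LINT r:{s..t}|lborel. speed u r)" .
  qed
qed

definition locally_rectifiable :: "(real \<Rightarrow> 'a::metric_space) \<Rightarrow> bool" where
  "locally_rectifiable u \<longleftrightarrow> (\<forall>T. \<exists>g. arc_bound u g T)"

lemma locally_rectifiable_continuous:
  fixes u :: "real \<Rightarrow> 'a::metric_space"
  assumes "locally_rectifiable u"
  shows "isCont (\<lambda>t. u (max 0 t)) x"
proof -
  define T where "T = \<bar>x\<bar> + 1"
  obtain g where "arc_bound u g T" using assms unfolding locally_rectifiable_def by blast
  then have c: "isCont (\<lambda>t. u (max 0 (min T t))) x"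
    by (rule speed_local(3)) (simp add: T_def add_nonneg_pos)
  have "\<forall>\<^sub>F t in nhds x. t \<in> {..<T}"
    by (intro eventually_nhds_in_open) (auto simp: T_def)
  then have "\<forall>\<^sub>F t in nhds x. u (max 0 (min T t)) = u (max 0 t)"
    by eventually_elim (simp add: min_absorb2 less_imp_le)
  from isCont_cong[OF this] show ?thesis using c by simp
qed

lemma speed_measurable:
  fixes u :: "real \<Rightarrow> 'a::metric_space"
  assumes "locally_rectifiable u"
  shows "speed u \<in> borel_measurable borel"
proof -
  have c: "continuous_on UNIV (\<lambda>t. u (max 0 t))"
    using locally_rectifiable_continuous[OF assms] by (simp add: continuous_on_eq_continuous_at)
  have "continuous_on UNIV (\<lambda>t. u (max 0 (t + inverse (real (Suc n)))))" for n
    by (rule continuous_on_compose2[OF c, of UNIV "\<lambda>t. t + inverse (real (Suc n))"]) (auto intro!: continuous_intros)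
  then have "(\<lambda>t. real (Suc n) * dist (u (max 0 (t + inverse (real (Suc n))))) (u (max 0 t))) \<in> borel_measurable borel" for n
    using c by (intro borel_measurable_continuous_onI continuous_intros)
  then have [measurable]: "(\<lambda>t. lim (\<lambda>n. real (Suc n) * dist (u (max 0 (t + inverse (real (Suc n))))) (u (max 0 t)))) \<in> borel_measurable borel"
    by (rule borel_measurable_lim_metric)
  show ?thesis unfolding speed_def[abs_def] by measurable
qed

lemma AE_all_horizons:
  assumes "\<And>n::nat. AE t in lborel. 0 < t \<and> t < real (Suc n) \<longrightarrow> P t"
  shows "AE t in lborel. 0 < t \<longrightarrow> P t"
proof -
  have "AE t in lborel. \<forall>n::nat. 0 < t \<and> t < real (Suc n) \<longrightarrow> P t"
    unfolding AE_all_countable by (intro allI assms)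
  then show ?thesis
  proof eventually_elim
    case (elim t)
    obtain n :: nat where "t < real n" using reals_Archimedean2 by blast
    then have "t < real (Suc n)" by simp
    then show ?case using elim by blast
  qed
qed

theorem metric_speed:
  fixes u :: "real \<Rightarrow> 'a::metric_space"
  assumes u: "locally_rectifiable u"
  shows "AE t in lborel. 0 < t \<longrightarrow> metric_deriv {0..} u t = speed u t"
    and "arc_bound u (speed u) T"
    and "(\<And>T. arc_bound u g T) \<Longrightarrow> AE t in lborel. 0 < t \<longrightarrow> speed u t \<le> g t"
proof -
  show "AE t in lborel. 0 < t \<longrightarrow> metric_deriv {0..} u t = speed u t"
  proof (rule AE_all_horizons)
    fix n :: nat
    obtain g where "arc_bound u g (real (Suc n))" using u unfolding locally_rectifiable_def by blast
    from speed_local(1)[OF this] show "AE t in lborel. 0 < t \<and> t < real (Suc n) \<longrightarrow> metric_deriv {0..} u t = speed u t"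
      by (auto elim!: eventually_mono intro: speed_eqI(2))
  qed
  show "arc_bound u (speed u) T"
  proof -
    define S where "S = \<bar>T\<bar> + 1"
    have "S > 0" "T \<le> S" unfolding S_def by linarith+
    obtain g where "arc_bound u g S" using u unfolding locally_rectifiable_def by blast
    then have *: "arc_bound u (speed u) S"
      by (rule speed_local(2)[OF _ \<open>S > 0\<close> speed_measurable[OF u]])
    then have "set_integrable lborel {0..S} (speed u)" by (simp add: arc_bound_def)
    then have "set_integrable lborel {0..T} (speed u)"
      by (rule set_integrable_subset) (use \<open>T \<le> S\<close> in auto)
    then show ?thesis using * \<open>T \<le> S\<close> unfolding arc_bound_def by (meson order_trans)
  qed
  show "AE t in lborel. 0 < t \<longrightarrow> speed u t \<le> g t" if "\<And>T. arc_bound u g T"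
  proof (rule AE_all_horizons)
    fix n :: nat
    from speed_local(1)[OF that[of "real (Suc n)"]] show "AE t in lborel. 0 < t \<and> t < real (Suc n) \<longrightarrow> speed u t \<le> g t"
      by (auto elim!: eventually_mono)
  qed
qed

section \<open>The exponential measure\<close>

definition exp_weight :: "real \<Rightarrow> real \<Rightarrow> real" where
  "exp_weight \<epsilon> t = indicator {0<..} t * exp (- t / \<epsilon>) / \<epsilon>"

lemma exp_weight_measurable[measurable]: "exp_weight \<epsilon> \<in> borel_measurable borel"
  unfolding exp_weight_def[abs_def] by measurable

lemma wed_measure_eq: "wed_measure \<epsilon> = density lborel (\<lambda>t. ennreal (exp_weight \<epsilon> t))"
  unfolding wed_measure_def exp_weight_def
  by (intro arg_cong2[where f=density] refl ext) (auto split: split_indicator)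

lemma sets_wed_measure[simp, measurable_cong]: "sets (wed_measure \<epsilon>) = sets borel"
  by (simp add: wed_measure_def)

lemma space_wed_measure[simp]: "space (wed_measure \<epsilon>) = UNIV"
  by (simp add: wed_measure_def)

context
  fixes \<epsilon> :: real
  assumes eps: "0 < \<epsilon>"
begin

lemma exp_weight_nonneg: "0 \<le> exp_weight \<epsilon> t"
  using eps by (simp add: exp_weight_def)

lemma exp_weight_pos_iff: "0 < exp_weight \<epsilon> t \<longleftrightarrow> 0 < t"
  using eps by (auto simp: exp_weight_def split: split_indicator)

lemma AE_wed_measure: "(AE t in wed_measure \<epsilon>. P t) \<longleftrightarrow> (AE t in lborel. 0 < t \<longrightarrow> P t)"
  unfolding wed_measure_eq by (subst AE_density) (auto simp: exp_weight_pos_iff)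

lemma integrable_wed_measure:
  fixes f :: "real \<Rightarrow> real"
  assumes "f \<in> borel_measurable borel"
  shows "integrable (wed_measure \<epsilon>) f \<longleftrightarrow> integrable lborel (\<lambda>t. exp_weight \<epsilon> t * f t)"
  unfolding wed_measure_eq using assms exp_weight_nonneg by (subst integrable_real_density) auto

lemma integral_wed_measure:
  fixes f :: "real \<Rightarrow> real"
  assumes "f \<in> borel_measurable borel"
  shows "integral\<^sup>L (wed_measure \<epsilon>) f = (LINT t|lborel. exp_weight \<epsilon> t * f t)"
  unfolding wed_measure_eq using assms exp_weight_nonneg by (subst integral_real_density) auto

lemma nn_integral_exp_tail:
  assumes "0 < c"
  shows "(\<integral>\<^sup>+t. ennreal (exp (- t / c)) * indicator {a..} t \<partial>lborel) = ennreal (c * exp (- a / c))"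
proof -
  have "LIM t at_top. (- 1 / c) * t :> at_bot"
    by (rule filterlim_tendsto_neg_mult_at_bot[OF tendsto_const _ filterlim_ident]) (use assms in simp)
  then have "((\<lambda>t. exp (- t / c)) \<longlongrightarrow> 0) at_top"
    using filterlim_compose[OF exp_at_bot] by simp
  then have "((\<lambda>t. - c * exp (- t / c)) \<longlongrightarrow> - c * 0) at_top"
    by (intro tendsto_intros)
  moreover have "((\<lambda>t. - c * exp (- t / c)) has_real_derivative exp (- t / c)) (at t)" for t
    using assms by (auto intro!: derivative_eq_intros)
  ultimately show ?thesis
    using nn_integral_FTC_atLeast[of "\<lambda>t. exp (- t / c)" a "\<lambda>t. - c * exp (- t / c)" "- c * 0"] by simp
qed

lemma emeasure_wed_measure_tail:
  assumes "0 \<le> a"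
  shows "emeasure (wed_measure \<epsilon>) {a<..} = ennreal (exp (- a / \<epsilon>))"
proof -
  have "emeasure (wed_measure \<epsilon>) {a<..} = (\<integral>\<^sup>+t. ennreal (exp_weight \<epsilon> t) * indicator {a<..} t \<partial>lborel)"
    unfolding wed_measure_eq by (subst emeasure_density) auto
  also have "\<dots> = (\<integral>\<^sup>+t. ennreal (1 / \<epsilon>) * (ennreal (exp (- t / \<epsilon>)) * indicator {a..} t) \<partial>lborel)"
  proof (intro nn_integral_cong_AE)
    show "AE t in lborel. ennreal (exp_weight \<epsilon> t) * indicator {a<..} t = ennreal (1 / \<epsilon>) * (ennreal (exp (- t / \<epsilon>)) * indicator {a..} t)"
      using AE_lborel_singleton[of a]
    proof eventually_elim
      case (elim t)
      then show ?case using assms eps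
        by (auto simp: exp_weight_def ennreal_mult[symmetric] split: split_indicator)
    qed
  qed
  also have "\<dots> = ennreal (1 / \<epsilon>) * ennreal (\<epsilon> * exp (- a / \<epsilon>))"
    by (subst nn_integral_cmult) (measurable, simp only: nn_integral_exp_tail[OF eps])
  also have "\<dots> = ennreal (exp (- a / \<epsilon>))"
    using eps by (simp add: ennreal_mult[symmetric])
  finally show ?thesis .
qed

lemma emeasure_wed_measure_UNIV: "emeasure (wed_measure \<epsilon>) UNIV = 1"
proof -
  have "emeasure (wed_measure \<epsilon>) UNIV = emeasure (wed_measure \<epsilon>) {0<..}"
    by (rule emeasure_eq_AE) (auto simp: AE_wed_measure)
  then show ?thesis using emeasure_wed_measure_tail[of 0] by simp
qed

lemma finite_wed_measure: "finite_measure (wed_measure \<epsilon>)"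
  by standard (simp add: emeasure_wed_measure_UNIV)

lemma measure_wed_measure_UNIV: "measure (wed_measure \<epsilon>) UNIV = 1"
  by (simp add: measure_def emeasure_wed_measure_UNIV)

lemma measure_wed_measure_tail: "0 \<le> a \<Longrightarrow> measure (wed_measure \<epsilon>) {a<..} = exp (- a / \<epsilon>)"
  by (simp add: measure_def emeasure_wed_measure_tail)

lemma
  fixes f :: "real \<Rightarrow> real"
  assumes [measurable]: "f \<in> borel_measurable borel" and "0 \<le> t"
  shows integrable_wed_measure_shift:
      "integrable (wed_measure \<epsilon>) (\<lambda>r. f (t + r)) \<longleftrightarrow> integrable (wed_measure \<epsilon>) (\<lambda>r. indicator {t<..} r * f r)"
    and integral_wed_measure_shift:
      "(\<integral>r. indicator {t<..} r * f r \<partial>wed_measure \<epsilon>) = exp (- t / \<epsilon>) * (\<integral>r. f (t + r) \<partial>wed_measure \<epsilon>)"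
proof -
  let ?h = "\<lambda>r. exp_weight \<epsilon> r * (indicator {t<..} r * f r)"
  have h: "(\<lambda>r. ?h (t + 1 * r)) = (\<lambda>r. exp (- t / \<epsilon>) * (exp_weight \<epsilon> r * f (t + r)))"
    using \<open>0 \<le> t\<close> eps by (auto simp: exp_weight_def exp_add[symmetric] add_divide_distrib diff_divide_distrib intro!: ext split: split_indicator)
  have "integrable (wed_measure \<epsilon>) (\<lambda>r. f (t + r)) \<longleftrightarrow> integrable lborel (\<lambda>r. exp (- t / \<epsilon>) * (exp_weight \<epsilon> r * f (t + r)))"
    by (subst integrable_wed_measure) auto
  also have "\<dots> \<longleftrightarrow> integrable lborel ?h"
    using lborel_integrable_real_affine_iff[of 1 ?h t] unfolding h by simp
  also have "\<dots> \<longleftrightarrow> integrable (wed_measure \<epsilon>) (\<lambda>r. indicator {t<..} r * f r)"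
    by (subst integrable_wed_measure) auto
  finally show "integrable (wed_measure \<epsilon>) (\<lambda>r. f (t + r)) \<longleftrightarrow> integrable (wed_measure \<epsilon>) (\<lambda>r. indicator {t<..} r * f r)" .
  have "(\<integral>r. indicator {t<..} r * f r \<partial>wed_measure \<epsilon>) = (LINT r|lborel. ?h r)"
    by (subst integral_wed_measure) auto
  also have "\<dots> = (LINT r|lborel. exp (- t / \<epsilon>) * (exp_weight \<epsilon> r * f (t + r)))"
    using lborel_integral_real_affine[of 1 ?h t] unfolding h by simp
  also have "\<dots> = exp (- t / \<epsilon>) * (\<integral>r. f (t + r) \<partial>wed_measure \<epsilon>)"
    by (subst integral_wed_measure) auto
  finally show "(\<integral>r. indicator {t<..} r * f r \<partial>wed_measure \<epsilon>) = exp (- t / \<epsilon>) * (\<integral>r. f (t + r) \<partial>wed_measure \<epsilon>)" .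
qed

lemma Hardy_finite:
  fixes f :: "real \<Rightarrow> ennreal"
  assumes [measurable]: "f \<in> borel_measurable borel"
    and fin: "(\<integral>\<^sup>+r. (f r)\<^sup>2 \<partial>wed_measure \<epsilon>) < \<infinity>"
  shows "(\<integral>\<^sup>+t. (\<integral>\<^sup>+r. f r * indicator {0..t} r \<partial>lborel)\<^sup>2 \<partial>wed_measure \<epsilon>) < \<infinity>"
proof -
  have [measurable]: "Measurable.pred (borel \<Otimes>\<^sub>M borel) (\<lambda>x::real \<times> real. snd x \<in> {0..fst x})"
    unfolding atLeastAtMost_iff by measurable
  have [measurable]: "Measurable.pred (borel \<Otimes>\<^sub>M borel) (\<lambda>x::real \<times> real. fst x \<in> {0..snd x})"
    unfolding atLeastAtMost_iff by measurable
  have two: "2 * ennreal a * ennreal b = ennreal (2 * a * b)" if "0 \<le> a" "0 \<le> b" for a b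
    using that by (metis ennreal_mult ennreal_numeral mult_nonneg_nonneg zero_le_numeral)
  define c where "c = 2 * \<epsilon>"
  have c: "0 < c" "1 / \<epsilon> = 2 / c" using eps by (simp_all add: c_def)
  let ?A = "\<lambda>t. \<integral>\<^sup>+r. (f r)\<^sup>2 * ennreal (exp (- r / c)) * indicator {0..t} r \<partial>lborel"
  have CS: "(\<integral>\<^sup>+r. f r * indicator {0..t} r \<partial>lborel)\<^sup>2 \<le> ennreal (c * exp (t / c)) * ?A t" for t
  proof -
    have e: "ennreal (exp (- r / (2 * c))) * ennreal (exp (r / (2 * c))) = 1" for r
      by (simp add: ennreal_mult[symmetric] exp_add[symmetric])
    have sq: "(ennreal (exp (x / (2 * c))))\<^sup>2 = ennreal (exp (x / c))" for x
      by (simp add: ennreal_power exp_double[symmetric])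
    have "(\<integral>\<^sup>+r. f r * indicator {0..t} r \<partial>lborel) =
        (\<integral>\<^sup>+r. (f r * ennreal (exp (- r / (2 * c))) * indicator {0..t} r) * (ennreal (exp (r / (2 * c))) * indicator {0..t} r) \<partial>lborel)"
      using e by (intro nn_integral_cong) (auto simp: mult.assoc split: split_indicator)
    then have "(\<integral>\<^sup>+r. f r * indicator {0..t} r \<partial>lborel)\<^sup>2 \<le>
       (\<integral>\<^sup>+r. (f r * ennreal (exp (- r / (2 * c))) * indicator {0..t} r)\<^sup>2 \<partial>lborel) * (\<integral>\<^sup>+r. (ennreal (exp (r / (2 * c))) * indicator {0..t} r)\<^sup>2 \<partial>lborel)"
      by (simp only:) (rule Cauchy_Schwarz_nn_integral; measurable)
    also have "(\<integral>\<^sup>+r. (f r * ennreal (exp (- r / (2 * c))) * indicator {0..t} r)\<^sup>2 \<partial>lborel) = ?A t"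
      by (intro nn_integral_cong) (auto simp: power_mult_distrib sq[of "- _", simplified] split: split_indicator)
    also have "?A t * (\<integral>\<^sup>+r. (ennreal (exp (r / (2 * c))) * indicator {0..t} r)\<^sup>2 \<partial>lborel) \<le> ?A t * ennreal (c * exp (t / c))"
    proof (rule mult_left_mono)
      have "(\<integral>\<^sup>+r. (ennreal (exp (r / (2 * c))) * indicator {0..t} r)\<^sup>2 \<partial>lborel) = (\<integral>\<^sup>+r. ennreal (exp (r / c)) * indicator {0..t} r \<partial>lborel)"
        by (intro nn_integral_cong) (auto simp: power_mult_distrib sq split: split_indicator)
      also have "\<dots> \<le> ennreal (c * exp (t / c))"
      proof (cases "0 \<le> t")
        case True
        have "(\<integral>\<^sup>+r. ennreal (exp (r / c)) * indicator {0..t} r \<partial>lborel) = ennreal (c * exp (t / c) - c * exp (0 / c))"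
          by (rule nn_integral_FTC_Icc) (use c True in \<open>auto intro!: derivative_eq_intros\<close>)
        also have "\<dots> \<le> ennreal (c * exp (t / c))" using c by (intro ennreal_leI) simp
        finally show ?thesis .
      qed simp
      finally show "(\<integral>\<^sup>+r. (ennreal (exp (r / (2 * c))) * indicator {0..t} r)\<^sup>2 \<partial>lborel) \<le> ennreal (c * exp (t / c))" .
    qed simp
    finally show ?thesis by (simp only: mult.commute)
  qed
  have wc: "ennreal (exp_weight \<epsilon> t) * ennreal (c * exp (t / c)) = 2 * ennreal (exp (- t / c)) * indicator {0<..} t" for t
  proof -
    have "exp (- t / \<epsilon>) * exp (t / c) = exp (- t / c)"
      unfolding exp_add[symmetric] using eps by (intro arg_cong[where f=exp]) (simp add: c_def field_simps)
    then have "exp_weight \<epsilon> t * (c * exp (t / c)) = 2 * exp (- t / c) * indicator {0<..} t"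
      using eps by (simp add: c_def exp_weight_def split: split_indicator)
    then show ?thesis using eps c
      by (auto simp: ennreal_mult[symmetric] exp_weight_nonneg ennreal_numeral[symmetric] simp del: ennreal_numeral split: split_indicator)
  qed
  have "(\<integral>\<^sup>+t. (\<integral>\<^sup>+r. f r * indicator {0..t} r \<partial>lborel)\<^sup>2 \<partial>wed_measure \<epsilon>) \<le> (\<integral>\<^sup>+t. ennreal (c * exp (t / c)) * ?A t \<partial>wed_measure \<epsilon>)"
    by (intro nn_integral_mono CS)
  also have "\<dots> = (\<integral>\<^sup>+t. ennreal (exp_weight \<epsilon> t) * (ennreal (c * exp (t / c)) * ?A t) \<partial>lborel)"
    unfolding wed_measure_eq by (rule nn_integral_density) measurable
  also have "\<dots> = (\<integral>\<^sup>+t. 2 * (ennreal (exp (- t / c)) * indicator {0<..} t) * ?A t \<partial>lborel)"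
    by (intro nn_integral_cong) (simp only: mult.assoc[symmetric] wc)
  also have "\<dots> = (\<integral>\<^sup>+t. (\<integral>\<^sup>+r. 2 * (ennreal (exp (- t / c)) * indicator {0<..} t) * ((f r)\<^sup>2 * ennreal (exp (- r / c)) * indicator {0..t} r) \<partial>lborel) \<partial>lborel)"
    by (intro nn_integral_cong nn_integral_cmult[symmetric]) measurable
  also have "\<dots> = (\<integral>\<^sup>+r. (\<integral>\<^sup>+t. 2 * (ennreal (exp (- t / c)) * indicator {0<..} t) * ((f r)\<^sup>2 * ennreal (exp (- r / c)) * indicator {0..t} r) \<partial>lborel) \<partial>lborel)"
    by (rule lborel_pair.Fubini') measurable
  also have "\<dots> \<le> (\<integral>\<^sup>+r. ennreal (4 * \<epsilon>\<^sup>2) * (ennreal (exp_weight \<epsilon> r) * (f r)\<^sup>2) \<partial>lborel)"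
  proof (rule nn_integral_mono_AE)
    show "AE r in lborel. (\<integral>\<^sup>+t. 2 * (ennreal (exp (- t / c)) * indicator {0<..} t) * ((f r)\<^sup>2 * ennreal (exp (- r / c)) * indicator {0..t} r) \<partial>lborel)
        \<le> ennreal (4 * \<epsilon>\<^sup>2) * (ennreal (exp_weight \<epsilon> r) * (f r)\<^sup>2)"
      using AE_lborel_singleton[of 0]
    proof eventually_elim
      case (elim r)
      show ?case
      proof (cases "r < 0")
        case True
        then show ?thesis by (simp add: indicator_def)
      next
        case False
        then have r: "0 < r" using elim by simp
        have "(\<integral>\<^sup>+t. 2 * (ennreal (exp (- t / c)) * indicator {0<..} t) * ((f r)\<^sup>2 * ennreal (exp (- r / c)) * indicator {0..t} r) \<partial>lborel)
           = (\<integral>\<^sup>+t. (2 * (f r)\<^sup>2 * ennreal (exp (- r / c))) * (ennreal (exp (- t / c)) * indicator {r..} t) \<partial>lborel)"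
          using r by (intro nn_integral_cong) (auto simp: mult_ac split: split_indicator)
        also have "\<dots> = (2 * (f r)\<^sup>2 * ennreal (exp (- r / c))) * ennreal (c * exp (- r / c))"
          using nn_integral_exp_tail[of c r] c by (subst nn_integral_cmult) auto
        also have "\<dots> = (2 * ennreal (exp (- r / c)) * ennreal (c * exp (- r / c))) * (f r)\<^sup>2" by (simp add: mult_ac)
        also have "2 * ennreal (exp (- r / c)) * ennreal (c * exp (- r / c)) = ennreal (2 * exp (- r / c) * (c * exp (- r / c)))"
          using c by (intro two) auto
        also have "2 * exp (- r / c) * (c * exp (- r / c)) = 4 * \<epsilon> * (exp (- r / c) * exp (- r / c))" by (simp add: c_def)
        also have "exp (- r / c) * exp (- r / c) = exp (- r / \<epsilon>)"
          unfolding exp_add[symmetric] using eps by (intro arg_cong[where f=exp]) (simp add: c_def field_simps)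
        also have "4 * \<epsilon> * exp (- r / \<epsilon>) = 4 * \<epsilon>\<^sup>2 * exp_weight \<epsilon> r"
          using r eps by (simp add: exp_weight_def power2_eq_square)
        also have "ennreal (4 * \<epsilon>\<^sup>2 * exp_weight \<epsilon> r) = ennreal (4 * \<epsilon>\<^sup>2) * ennreal (exp_weight \<epsilon> r)"
          by (simp add: ennreal_mult exp_weight_nonneg)
        finally show ?thesis by (simp add: mult.assoc)
      qed
    qed
  qed
  also have "\<dots> = ennreal (4 * \<epsilon>\<^sup>2) * (\<integral>\<^sup>+r. (f r)\<^sup>2 \<partial>wed_measure \<epsilon>)"
    unfolding wed_measure_eq by (subst nn_integral_cmult) (auto simp: nn_integral_density)
  also have "\<dots> < \<infinity>" using fin by (simp add: ennreal_mult_less_top)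
  finally show ?thesis .
qed

end

section \<open>The functional on competing curves\<close>

lemma abs_le_one_plus_power2: "\<bar>x\<bar> \<le> 1 + x\<^sup>2" for x :: real
proof -
  have "0 \<le> (\<bar>x\<bar> - 1)\<^sup>2" by simp
  then show ?thesis by (simp add: power2_diff)
qed

lemma ereal_integral_le:
  assumes le: "AE x in M. f x \<le> ereal (h x)" and h: "integrable M h"
  shows "ereal_integral M f \<le> ereal (integral\<^sup>L M h)"
proof -
  obtain r q where rq: "0 \<le> r" "0 \<le> q" "(\<integral>\<^sup>+x. ennreal (h x) \<partial>M) = ennreal r"
    "(\<integral>\<^sup>+x. ennreal (- h x) \<partial>M) = ennreal q" "integral\<^sup>L M h = r - q"
    using h by (rule integrableE)
  have "(\<integral>\<^sup>+x. e2ennreal (f x) \<partial>M) \<le> ennreal r"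
    unfolding rq(3)[symmetric] using le
    by (intro nn_integral_mono_AE) (auto elim!: eventually_mono dest: e2ennreal_mono)
  moreover have "ennreal q \<le> (\<integral>\<^sup>+x. e2ennreal (- f x) \<partial>M)"
    unfolding rq(4)[symmetric]
  proof (intro nn_integral_mono_AE, use le in eventually_elim)
    fix x assume "f x \<le> ereal (h x)"
    then have "ereal (- h x) \<le> - f x" by (metis ereal_minus_le_minus uminus_ereal.simps(1))
    from e2ennreal_mono[OF this] show "ennreal (- h x) \<le> e2ennreal (- f x)" by simp
  qed
  ultimately have "ereal_integral M f \<le> enn2ereal (ennreal r) - enn2ereal (ennreal q)"
    unfolding ereal_integral_def by (intro ereal_minus_mono) (simp_all add: less_eq_ennreal.rep_eq)
  then show ?thesis using rq by simp
qed

lemma ereal_integral_ge: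
  assumes le: "AE x in M. ereal (h x) \<le> f x" and h: "integrable M h"
  shows "ereal (integral\<^sup>L M h) \<le> ereal_integral M f"
proof -
  obtain r q where rq: "0 \<le> r" "0 \<le> q" "(\<integral>\<^sup>+x. ennreal (h x) \<partial>M) = ennreal r"
    "(\<integral>\<^sup>+x. ennreal (- h x) \<partial>M) = ennreal q" "integral\<^sup>L M h = r - q"
    using h by (rule integrableE)
  have "ennreal r \<le> (\<integral>\<^sup>+x. e2ennreal (f x) \<partial>M)"
    unfolding rq(3)[symmetric] using le
    by (intro nn_integral_mono_AE) (auto elim!: eventually_mono dest: e2ennreal_mono)
  moreover have "(\<integral>\<^sup>+x. e2ennreal (- f x) \<partial>M) \<le> ennreal q"
    unfolding rq(4)[symmetric]
  proof (intro nn_integral_mono_AE, use le in eventually_elim)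
    fix x assume "ereal (h x) \<le> f x"
    then have "- f x \<le> ereal (- h x)" by (metis ereal_minus_le_minus uminus_ereal.simps(1))
    from e2ennreal_mono[OF this] show "e2ennreal (- f x) \<le> ennreal (- h x)" by simp
  qed
  ultimately have "enn2ereal (ennreal r) - enn2ereal (ennreal q) \<le> ereal_integral M f"
    unfolding ereal_integral_def by (intro ereal_minus_mono) (simp_all add: less_eq_ennreal.rep_eq)
  then show ?thesis using rq by simp
qed

lemma ereal_integral_finite_imp_integrable:
  assumes f[measurable]: "f \<in> borel_measurable M"
    and le: "AE x in M. ereal (h x) \<le> f x" and h: "integrable M h"
    and fin: "ereal_integral M f \<noteq> \<infinity>"
  shows "AE x in M. f x = ereal (real_of_ereal (f x))" "integrable M (\<lambda>x. real_of_ereal (f x))"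
proof -
  obtain r q where rq: "0 \<le> r" "0 \<le> q" "(\<integral>\<^sup>+x. ennreal (h x) \<partial>M) = ennreal r"
    "(\<integral>\<^sup>+x. ennreal (- h x) \<partial>M) = ennreal q" "integral\<^sup>L M h = r - q"
    using h by (rule integrableE)
  have pos: "(\<integral>\<^sup>+x. e2ennreal (f x) \<partial>M) \<noteq> \<infinity>"
    using fin unfolding ereal_integral_def by auto
  then have "AE x in M. e2ennreal (f x) \<noteq> \<infinity>"
    by (intro nn_integral_PInf_AE) auto
  with le show AE: "AE x in M. f x = ereal (real_of_ereal (f x))"
  proof eventually_elim
    case (elim x)
    then show ?case by (cases "f x") auto
  qed
  show "integrable M (\<lambda>x. real_of_ereal (f x))"
    unfolding real_integrable_def
  proof (intro conjI)
    have "(\<integral>\<^sup>+x. ennreal (real_of_ereal (f x)) \<partial>M) = (\<integral>\<^sup>+x. e2ennreal (f x) \<partial>M)"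
      using AE by (intro nn_integral_cong_AE, eventually_elim) (metis e2ennreal_ereal)
    then show "(\<integral>\<^sup>+x. ennreal (real_of_ereal (f x)) \<partial>M) \<noteq> \<infinity>" using pos by simp
    have "(\<integral>\<^sup>+x. ennreal (- real_of_ereal (f x)) \<partial>M) \<le> (\<integral>\<^sup>+x. ennreal (- h x) \<partial>M)"
      using AE le
    proof (intro nn_integral_mono_AE, eventually_elim)
      case (elim x)
      then have "h x \<le> real_of_ereal (f x)" by (metis ereal_less_eq(3))
      then show ?case by (intro ennreal_leI) simp
    qed
    then show "(\<integral>\<^sup>+x. ennreal (- real_of_ereal (f x)) \<partial>M) \<noteq> \<infinity>"
      using rq by (auto simp: top_unique)
  qed simp
qed

lemma ereal_integral_cong_AE:
  assumes "AE x in M. f x = g x"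
  shows "ereal_integral M f = ereal_integral M g"
  unfolding ereal_integral_def
  using assms by (intro arg_cong2[where f="(-)"] arg_cong[where f=enn2ereal] nn_integral_cong_AE)
    (auto elim!: eventually_mono)

context
  fixes \<epsilon> :: real
  assumes eps: "0 < \<epsilon>"
begin

lemma set_integrable_of_wed_integrable:
  fixes f :: "real \<Rightarrow> real"
  assumes [measurable]: "f \<in> borel_measurable borel" and f: "integrable (wed_measure \<epsilon>) f"
  shows "set_integrable lborel {0..T} f"
proof -
  have "integrable lborel (\<lambda>t. (\<epsilon> * exp (\<bar>T\<bar> / \<epsilon>)) * (exp_weight \<epsilon> t * f t))"
    using f by (subst (asm) integrable_wed_measure[OF eps]) auto
  then show ?thesis
    unfolding set_integrable_def
  proof (rule Bochner_Integration.integrable_bound)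
    show "AE t in lborel. norm (indicator {0..T} t *\<^sub>R f t) \<le> norm ((\<epsilon> * exp (\<bar>T\<bar> / \<epsilon>)) * (exp_weight \<epsilon> t * f t))"
      using AE_lborel_singleton[of 0]
    proof eventually_elim
      case (elim t)
      show ?case
      proof (cases "t \<in> {0..T}")
        case True
        then have t: "0 < t" "t \<le> T" using elim by auto
        then have "t / \<epsilon> \<le> \<bar>T\<bar> / \<epsilon>" using eps by (intro divide_right_mono) auto
        then have "1 \<le> exp (\<bar>T\<bar> / \<epsilon>) * exp (- t / \<epsilon>)" unfolding exp_add[symmetric] by simp
        then have "1 \<le> (\<epsilon> * exp (\<bar>T\<bar> / \<epsilon>)) * exp_weight \<epsilon> t" using t eps by (simp add: exp_weight_def)
        then have "1 * \<bar>f t\<bar> \<le> ((\<epsilon> * exp (\<bar>T\<bar> / \<epsilon>)) * exp_weight \<epsilon> t) * \<bar>f t\<bar>" by (intro mult_right_mono) auto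
        then show ?thesis using True eps exp_weight_nonneg[OF eps, of t] by (simp add: abs_mult mult.assoc)
      qed simp
    qed
  qed simp
qed

lemma set_integrable_of_wed_square_integrable:
  fixes g :: "real \<Rightarrow> real"
  assumes [measurable]: "g \<in> borel_measurable borel" and g: "integrable (wed_measure \<epsilon>) (\<lambda>t. (g t)\<^sup>2)"
  shows "set_integrable lborel {0..T} g"
proof (rule set_integrable_bound)
  show "set_integrable lborel {0..T} (\<lambda>t. 1 + (g t)\<^sup>2)"
    by (intro set_integral_add set_integrable_const_interval set_integrable_of_wed_integrable g) measurable
  show "set_borel_measurable lborel {0..T} g" unfolding set_borel_measurable_def by measurable
  show "AE t in lborel. t \<in> {0..T} \<longrightarrow> norm (g t) \<le> norm (1 + (g t)\<^sup>2)"
    by (auto intro!: AE_I2 simp: abs_le_one_plus_power2)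
qed

lemma Hardy_integrable:
  fixes g :: "real \<Rightarrow> real"
  assumes [measurable]: "g \<in> borel_measurable borel" and nn: "\<And>t. 0 \<le> g t"
    and g: "integrable (wed_measure \<epsilon>) (\<lambda>t. (g t)\<^sup>2)"
  shows "integrable (wed_measure \<epsilon>) (\<lambda>t. (LINT r:{0..t}|lborel. g r)\<^sup>2)"
proof -
  have loc: "set_integrable lborel {0..T} g" for T
    by (rule set_integrable_of_wed_square_integrable[OF _ g]) measurable
  have [measurable]: "Measurable.pred (borel \<Otimes>\<^sub>M borel) (\<lambda>x::real \<times> real. snd x \<in> {0..fst x})"
    unfolding atLeastAtMost_iff by measurable
  have y: "ennreal (LINT r:{0..t}|lborel. g r) = (\<integral>\<^sup>+r. ennreal (g r) * indicator {0..t} r \<partial>lborel)" for t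
  proof -
    have "(\<integral>\<^sup>+r. ennreal (g r) * indicator {0..t} r \<partial>lborel) = (\<integral>\<^sup>+r. ennreal (indicator {0..t} r *\<^sub>R g r) \<partial>lborel)"
      by (intro nn_integral_cong) (auto split: split_indicator)
    also have "\<dots> = ennreal (LINT r|lborel. indicator {0..t} r *\<^sub>R g r)"
      using loc[of t] nn unfolding set_integrable_def by (intro nn_integral_eq_integral) auto
    finally show ?thesis by (simp add: set_lebesgue_integral_def)
  qed
  have nn': "0 \<le> (LINT r:{0..t}|lborel. g r)" for t
    using nn unfolding set_lebesgue_integral_def by (intro integral_nonneg_AE) auto
  have "(\<integral>\<^sup>+t. (ennreal (g t))\<^sup>2 \<partial>wed_measure \<epsilon>) < \<infinity>"
    using g nn unfolding real_integrable_def by (simp add: ennreal_power less_top)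
  then have "(\<integral>\<^sup>+t. (\<integral>\<^sup>+r. ennreal (g r) * indicator {0..t} r \<partial>lborel)\<^sup>2 \<partial>wed_measure \<epsilon>) < \<infinity>"
    by (intro Hardy_finite[OF eps]) measurable
  then have "(\<integral>\<^sup>+t. ennreal ((LINT r:{0..t}|lborel. g r)\<^sup>2) \<partial>wed_measure \<epsilon>) < \<infinity>"
    unfolding y[symmetric] by (simp add: ennreal_power nn')
  moreover have "(\<lambda>t. (LINT r:{0..t}|lborel. g r)\<^sup>2) \<in> borel_measurable borel"
    unfolding set_lebesgue_integral_def by measurable
  ultimately show ?thesis by (intro integrableI_nonneg) auto
qed

lemma arc_bound_imp_wed_curve:
  fixes v :: "real \<Rightarrow> 'a::metric_space"
  assumes [measurable]: "g \<in> borel_measurable borel" and g: "integrable (wed_measure \<epsilon>) (\<lambda>t. (g t)\<^sup>2)"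
    and bd: "\<And>s t. 0 \<le> s \<Longrightarrow> s \<le> t \<Longrightarrow> dist (v s) (v t) \<le> (LINT r:{s..t}|lborel. g r)"
  shows "locally_rectifiable v" "AE t in lborel. 0 < t \<longrightarrow> (metric_deriv {0..} v t)\<^sup>2 \<le> (g t)\<^sup>2"
    "v \<in> wed_curves \<epsilon> (v 0)"
proof -
  have ab: "arc_bound v g T" for T
    using bd set_integrable_of_wed_square_integrable[OF _ g] by (simp add: arc_bound_def)
  then show lr: "locally_rectifiable v" by (auto simp: locally_rectifiable_def)
  show sq: "AE t in lborel. 0 < t \<longrightarrow> (metric_deriv {0..} v t)\<^sup>2 \<le> (g t)\<^sup>2"
    using metric_speed(1)[OF lr] metric_speed(3)[OF lr ab]
    by eventually_elim (auto intro!: power_mono speed_nonneg)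
  have "AC 2 {a..b} v" if "{a..b} \<subseteq> {0..}" for a b
    unfolding AC_def
  proof (intro exI[of _ g] conjI ballI impI)
    show "set_borel_measurable lborel {a..b} g" unfolding set_borel_measurable_def by measurable
    have "set_integrable lborel {a..b} (\<lambda>t. (g t)\<^sup>2)"
      by (rule set_integrable_subset[OF set_integrable_of_wed_integrable[OF _ g, of b]]) (use that in auto)
    then show "set_integrable lborel {a..b} (\<lambda>t. \<bar>g t\<bar> powr 2)" by simp
    fix s t assume "s \<in> {a..b}" "t \<in> {a..b}" "s \<le> t"
    then show "dist (v s) (v t) \<le> (LINT r:{s..t}|lborel. g r)" using that by (intro bd) auto
  qed
  then have "AC_loc 2 {0..} v" by (simp add: AC_loc_def)
  moreover have "(\<integral>\<^sup>+t. ennreal ((metric_deriv {0..} v t)\<^sup>2) \<partial>wed_measure \<epsilon>) \<le> (\<integral>\<^sup>+t. ennreal ((g t)\<^sup>2) \<partial>wed_measure \<epsilon>)"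
    using sq by (intro nn_integral_mono_AE) (auto simp: AE_wed_measure[OF eps] elim!: eventually_mono intro: ennreal_leI)
  moreover have "(\<integral>\<^sup>+t. ennreal ((g t)\<^sup>2) \<partial>wed_measure \<epsilon>) < \<infinity>"
    using g unfolding real_integrable_def by (simp add: less_top)
  ultimately show "v \<in> wed_curves \<epsilon> (v 0)"
    by (simp add: wed_curves_def le_less_trans)
qed

lemma wed_le:
  fixes v :: "real \<Rightarrow> 'a::metric_space"
  assumes "g \<in> borel_measurable borel" and g: "integrable (wed_measure \<epsilon>) (\<lambda>t. (g t)\<^sup>2)"
    and bd: "\<And>s t. 0 \<le> s \<Longrightarrow> s \<le> t \<Longrightarrow> dist (v s) (v t) \<le> (LINT r:{s..t}|lborel. g r)"
    and \<Psi>: "AE t in lborel. 0 < t \<longrightarrow> \<phi> (v t) \<le> ereal (\<Psi> t)" "integrable (wed_measure \<epsilon>) \<Psi>"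
  shows "wed \<epsilon> \<phi> v \<le> ereal (\<integral>t. \<epsilon> / 2 * (g t)\<^sup>2 + \<Psi> t \<partial>wed_measure \<epsilon>)"
  unfolding wed_def
proof (rule ereal_integral_le)
  have md: "AE t in lborel. 0 < t \<longrightarrow> (metric_deriv {0..} v t)\<^sup>2 \<le> (g t)\<^sup>2"
    by (rule arc_bound_imp_wed_curve(2)[OF assms(1) g]) (rule bd)
  show "AE t in wed_measure \<epsilon>. ereal (\<epsilon> / 2 * (metric_deriv {0..} v t)\<^sup>2) + \<phi> (v t) \<le> ereal (\<epsilon> / 2 * (g t)\<^sup>2 + \<Psi> t)"
    unfolding AE_wed_measure[OF eps]
    using md \<Psi>(1)
  proof eventually_elim
    case (elim t)
    show ?case
    proof
      assume t: "0 < t"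
      have "ereal (\<epsilon> / 2 * (metric_deriv {0..} v t)\<^sup>2) + \<phi> (v t) \<le> ereal (\<epsilon> / 2 * (g t)\<^sup>2) + ereal (\<Psi> t)"
        using elim t eps by (intro add_mono) (auto intro!: mult_left_mono)
      then show "ereal (\<epsilon> / 2 * (metric_deriv {0..} v t)\<^sup>2) + \<phi> (v t) \<le> ereal (\<epsilon> / 2 * (g t)\<^sup>2 + \<Psi> t)" by simp
    qed
  qed
  show "integrable (wed_measure \<epsilon>) (\<lambda>t. \<epsilon> / 2 * (g t)\<^sup>2 + \<Psi> t)" using g \<Psi>(2) by simp
qed

lemma wed_curve_locally_rectifiable:
  assumes "u \<in> wed_curves \<epsilon> ubar"
  shows "locally_rectifiable u"
  unfolding locally_rectifiable_def
proof
  fix T :: real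
  have "AC 2 {0..T} u" using assms by (auto simp: wed_curves_def AC_loc_def)
  then obtain m where m: "set_borel_measurable lborel {0..T} m" "set_integrable lborel {0..T} (\<lambda>r. \<bar>m r\<bar> powr 2)"
    "\<forall>s\<in>{0..T}. \<forall>t\<in>{0..T}. s \<le> t \<longrightarrow> dist (u s) (u t) \<le> (LINT r:{s..t}|lborel. m r)"
    unfolding AC_def by blast
  have "set_integrable lborel {0..T} m"
  proof (rule set_integrable_bound[OF _ m(1)])
    show "set_integrable lborel {0..T} (\<lambda>t. 1 + \<bar>m t\<bar> powr 2)"
      by (intro set_integral_add set_integrable_const_interval m(2))
    show "AE t in lborel. t \<in> {0..T} \<longrightarrow> norm (m t) \<le> norm (1 + \<bar>m t\<bar> powr 2)"
      by (auto intro!: AE_I2 simp: abs_le_one_plus_power2)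
  qed
  then show "\<exists>g. arc_bound u g T" using m(3) by (intro exI[of _ m]) (auto simp: arc_bound_def)
qed

lemma wed_curve_speed_square_integrable:
  assumes "u \<in> wed_curves \<epsilon> ubar"
  shows "integrable (wed_measure \<epsilon>) (\<lambda>t. (speed u t)\<^sup>2)"
proof (rule integrableI_nonneg)
  note lr = wed_curve_locally_rectifiable[OF assms]
  note [measurable] = speed_measurable[OF lr]
  show "(\<lambda>t. (speed u t)\<^sup>2) \<in> borel_measurable (wed_measure \<epsilon>)" by measurable
  have "(\<integral>\<^sup>+t. ennreal ((speed u t)\<^sup>2) \<partial>wed_measure \<epsilon>) = (\<integral>\<^sup>+t. ennreal ((metric_deriv {0..} u t)\<^sup>2) \<partial>wed_measure \<epsilon>)"
    using metric_speed(1)[OF lr] by (intro nn_integral_cong_AE) (auto simp: AE_wed_measure[OF eps] elim!: eventually_mono)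
  also have "\<dots> < \<infinity>" using assms by (simp add: wed_curves_def)
  finally show "(\<integral>\<^sup>+t. ennreal ((speed u t)\<^sup>2) \<partial>wed_measure \<epsilon>) < \<infinity>" .
qed simp

end

definition splice :: "real \<Rightarrow> (real \<Rightarrow> 'b) \<Rightarrow> (real \<Rightarrow> 'b) \<Rightarrow> real \<Rightarrow> 'b" where
  "splice c f h t = (if t \<le> c then f t else h (t - c))"

lemma splice_measurable[measurable]:
  assumes [measurable]: "f \<in> borel_measurable borel" "h \<in> borel_measurable borel"
  shows "splice c f h \<in> borel_measurable borel"
  unfolding splice_def[abs_def] by measurable

lemma set_integral_translate:
  fixes g :: "real \<Rightarrow> real"
  shows "(LINT r:{a + c..b + c}|lborel. g (r - c)) = (LINT r:{a..b}|lborel. g r)"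
proof -
  have "(LINT r|lborel. indicator {a + c..b + c} r * g (r - c)) = (LINT r|lborel. indicator {a..b} r * g r)"
    by (subst lborel_integral_real_affine[of 1 _ c])
       (auto intro!: Bochner_Integration.integral_cong split: split_indicator)
  then show ?thesis by (simp add: set_lebesgue_integral_def)
qed

lemma set_integrable_translate:
  fixes g :: "real \<Rightarrow> real"
  shows "set_integrable lborel {a + c..b + c} (\<lambda>r. g (r - c)) \<longleftrightarrow> set_integrable lborel {a..b} g"
proof -
  have "(\<lambda>r. indicator {a + c..b + c} (c + 1 * r) *\<^sub>R g (c + 1 * r - c)) = (\<lambda>r. indicator {a..b} r *\<^sub>R g r)"
    by (auto split: split_indicator)
  then show ?thesis
    unfolding set_integrable_def
    using lborel_integrable_real_affine_iff[of 1 "\<lambda>r. indicator {a + c..b + c} r *\<^sub>R g (r - c)" c] by simp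
qed

lemma set_integral_Icc_combine:
  fixes g :: "real \<Rightarrow> real"
  assumes "set_integrable lborel {a..c} g" "a \<le> b" "b \<le> c"
  shows "(LINT r:{a..c}|lborel. g r) = (LINT r:{a..b}|lborel. g r) + (LINT r:{b..c}|lborel. g r)"
proof -
  have "(LINT r:{a..b} \<union> {b<..c}|lborel. g r) = (LINT r:{a..b}|lborel. g r) + (LINT r:{b<..c}|lborel. g r)"
    by (rule set_integral_Un) (use assms in \<open>auto intro: set_integrable_subset\<close>)
  moreover have "(LINT r:{b<..c}|lborel. g r) = (LINT r:{b..c}|lborel. g r)"
    by (rule set_integral_discrete_difference[where X="{b}"]) auto
  moreover have "{a..b} \<union> {b<..c} = {a..c}" using assms by auto
  ultimately show ?thesis by simp
qed

lemma splice_dist_le: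
  fixes u v :: "real \<Rightarrow> 'a::metric_space"
  assumes c: "0 \<le> c"
    and u: "\<And>s t. 0 \<le> s \<Longrightarrow> s \<le> t \<Longrightarrow> t \<le> c \<Longrightarrow> dist (u s) (u t) \<le> (LINT r:{s..t}|lborel. g r)"
    and v: "\<And>s t. 0 \<le> s \<Longrightarrow> s \<le> t \<Longrightarrow> dist (v s) (v t) \<le> (LINT r:{s..t}|lborel. h r)"
    and eq: "u c = v 0"
    and g: "set_integrable lborel {0..c} g" and h: "\<And>T. set_integrable lborel {0..T} h"
    and st: "0 \<le> s" "s \<le> t"
  shows "dist (splice c u v s) (splice c u v t) \<le> (LINT r:{s..t}|lborel. splice c g h r)"
proof -
  have left: "(LINT r:{a..b}|lborel. splice c g h r) = (LINT r:{a..b}|lborel. g r)" if "b \<le> c" for a b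
    using that by (intro set_lebesgue_integral_cong) (auto simp: splice_def)
  have right: "(LINT r:{a..b}|lborel. splice c g h r) = (LINT r:{a - c..b - c}|lborel. h r)" if "c \<le> a" for a b
  proof -
    have "(LINT r:{a..b}|lborel. splice c g h r) = (LINT r:{a<..b}|lborel. splice c g h r)"
      by (rule set_integral_discrete_difference[where X="{a}"]) auto
    also have "\<dots> = (LINT r:{a<..b}|lborel. h (r - c))"
      using that by (intro set_lebesgue_integral_cong) (auto simp: splice_def)
    also have "\<dots> = (LINT r:{a..b}|lborel. h (r - c))"
      by (rule set_integral_discrete_difference[where X="{a}"]) auto
    also have "\<dots> = (LINT r:{a - c..b - c}|lborel. h r)"
      using set_integral_translate[of "a - c" c "b - c" h] by simp
    finally show ?thesis .
  qed
  consider "t \<le> c" | "c \<le> s" | "s < c" "c < t" by linarith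
  then show ?thesis
  proof cases
    case 1
    then show ?thesis using u[OF st] st left[OF 1] by (simp add: splice_def)
  next
    case 2
    have "splice c u v r = v (r - c)" if "c \<le> r" for r using that eq by (auto simp: splice_def)
    then show ?thesis using v[of "s - c" "t - c"] 2 st right[OF 2] by simp
  next
    case 3
    have "dist (splice c u v s) (splice c u v t) \<le> dist (u s) (u c) + dist (v 0) (v (t - c))"
      using 3 eq dist_triangle[of "u s" "v (t - c)" "u c"] by (simp add: splice_def)
    also have "\<dots> \<le> (LINT r:{s..c}|lborel. g r) + (LINT r:{0..t - c}|lborel. h r)"
      using 3 st by (intro add_mono u v) auto
    also have "\<dots> = (LINT r:{s..c}|lborel. splice c g h r) + (LINT r:{c..t}|lborel. splice c g h r)"
      using left[of c s] right[of c t] by simp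
    also have "\<dots> = (LINT r:{s..t}|lborel. splice c g h r)"
    proof (rule set_integral_Icc_combine[symmetric])
      have "set_integrable lborel {s..c} g" by (rule set_integrable_subset[OF g]) (use st in auto)
      then have 1: "set_integrable lborel {s..c} (splice c g h)"
        by (rule set_integrable_cong[THEN iffD1, rotated -1]) (auto simp: splice_def)
      have "set_integrable lborel {0 + c..(t - c) + c} (\<lambda>r. h (r - c))"
        unfolding set_integrable_translate by (rule h)
      then have "set_integrable lborel {c<..t} (\<lambda>r. h (r - c))"
        by (rule set_integrable_subset) auto
      then have 2: "set_integrable lborel {c<..t} (splice c g h)"
        by (rule set_integrable_cong[THEN iffD1, rotated -1]) (auto simp: splice_def)
      have "{s..t} = {s..c} \<union> {c<..t}" using 3 by auto
      then show "set_integrable lborel {s..t} (splice c g h)"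
        using set_integrable_Un[OF 1 2] by simp
    qed (use 3 in auto)
    finally show ?thesis .
  qed
qed

lemma splice_wed_integral:
  fixes f h :: "real \<Rightarrow> real"
  assumes eps: "0 < \<epsilon>" and c: "0 \<le> c" and f: "integrable (wed_measure \<epsilon>) f" and h: "integrable (wed_measure \<epsilon>) h"
  shows "integrable (wed_measure \<epsilon>) (splice c f h)"
    and "integral\<^sup>L (wed_measure \<epsilon>) (splice c f h) =
      (\<integral>r. indicator {..c} r * f r \<partial>wed_measure \<epsilon>) + exp (- c / \<epsilon>) * integral\<^sup>L (wed_measure \<epsilon>) h"
proof -
  have [measurable]: "f \<in> borel_measurable borel" "h \<in> borel_measurable borel"
    using f h by (auto dest: borel_measurable_integrable)
  have hs: "(\<lambda>r. h (c + r - c)) = h" by simp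
  have eq: "splice c f h = (\<lambda>r. indicator {..c} r * f r + indicator {c<..} r * h (r - c))"
    by (auto simp: splice_def split: split_indicator)
  have 1: "integrable (wed_measure \<epsilon>) (\<lambda>r. indicator {..c} r * f r)"
    using integrable_mult_indicator[OF _ f, of "{..c}"] by simp
  have 2: "integrable (wed_measure \<epsilon>) (\<lambda>r. indicator {c<..} r * h (r - c))"
    using integrable_wed_measure_shift[OF eps _ c, of "\<lambda>r. h (r - c)"] h unfolding hs by simp
  show "integrable (wed_measure \<epsilon>) (splice c f h)" unfolding eq using 1 2 by simp
  show "integral\<^sup>L (wed_measure \<epsilon>) (splice c f h) =
      (\<integral>r. indicator {..c} r * f r \<partial>wed_measure \<epsilon>) + exp (- c / \<epsilon>) * integral\<^sup>L (wed_measure \<epsilon>) h"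
    unfolding eq using 1 2 integral_wed_measure_shift[OF eps _ c, of "\<lambda>r. h (r - c)"] unfolding hs by simp
qed

section \<open>Minimality of the tails\<close>

lemma AE_lborel_translate:
  fixes P :: "real \<Rightarrow> bool"
  assumes "AE t in lborel. 0 < t \<longrightarrow> P t"
  shows "AE r in lborel. 0 < c + r \<longrightarrow> P (c + r)"
proof -
  obtain N where N: "{t. \<not> (0 < t \<longrightarrow> P t)} \<subseteq> N" "N \<in> null_sets lborel"
    using assms(1) by (auto elim!: AE_E simp: null_sets_def)
  then have "AE t in lborel. t \<notin> N" by (simp add: AE_not_in)
  moreover have [measurable]: "N \<in> sets borel" using N(2) by (auto simp: null_sets_def)
  ultimately have "AE r in lborel. c + 1 * r \<notin> N"
    by (intro AE_borel_affine) auto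
  then show ?thesis
  proof eventually_elim
    case (elim r)
    then have "c + r \<notin> {t. \<not> (0 < t \<longrightarrow> P t)}" using N(1) by auto
    then show ?case by simp
  qed
qed

locale wed_minimizer =
  fixes \<sigma> :: "'a::complete_space topology" and \<phi> :: "'a \<Rightarrow> ereal"
    and B \<epsilon> :: real and ubar :: 'a and u :: "real \<Rightarrow> 'a"
  assumes compat: "compatible \<sigma>" and proper: "proper \<phi>" and lscc: "LSCC \<sigma> \<phi> B"
    and geoconvex: "geodesically_convex 0 \<phi>"
    and eps: "0 < \<epsilon>" and minimizer: "u \<in> wed_minimizers \<epsilon> \<phi> ubar"
begin

abbreviation \<mu> :: "real measure" where "\<mu> \<equiv> wed_measure \<epsilon>"

abbreviation m :: "real \<Rightarrow> real" where "m \<equiv> speed u"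

text \<open>\<open>real_of_ereal \<infinity> = 0\<close> is harmless: \<open>\<phi> \<circ> u\<close> is finite on \<open>{0<..}\<close> by \<open>phi_u_finite\<close>.\<close>

definition \<Phi> :: "real \<Rightarrow> real" where "\<Phi> t = real_of_ereal (\<phi> (u (max 0 t)))"

text \<open>\<open>s\<close> is the arclength of \<open>u\<close>, and \<open>G t\<close> is the value function at \<open>u t\<close>: the least energy of a curve
  starting from there, by \<open>tail_minimality\<close> below.\<close>

definition s :: "real \<Rightarrow> real" where "s t = (LINT r:{0..t}|lborel. m r)"

definition e :: "real \<Rightarrow> real" where "e t = \<epsilon> / 2 * (m t)\<^sup>2 + \<Phi> t"

definition G :: "real \<Rightarrow> real" where "G t = (\<integral>r. e (t + r) \<partial>\<mu>)"

lemma curve: "u \<in> wed_curves \<epsilon> ubar"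
  and minimal: "v \<in> wed_curves \<epsilon> ubar \<Longrightarrow> wed \<epsilon> \<phi> u \<le> wed \<epsilon> \<phi> v"
  and wed_finite: "wed \<epsilon> \<phi> u \<noteq> \<infinity>"
proof -
  have *: "(INF v\<in>wed_curves \<epsilon> ubar. wed \<epsilon> \<phi> v) \<noteq> \<infinity>" "u \<in> wed_curves \<epsilon> ubar"
    "\<forall>v\<in>wed_curves \<epsilon> ubar. wed \<epsilon> \<phi> u \<le> wed \<epsilon> \<phi> v"
    using minimizer by (auto simp: wed_minimizers_def split: if_splits)
  then show "u \<in> wed_curves \<epsilon> ubar" "v \<in> wed_curves \<epsilon> ubar \<Longrightarrow> wed \<epsilon> \<phi> u \<le> wed \<epsilon> \<phi> v" by auto
  have "wed \<epsilon> \<phi> u \<le> (INF v\<in>wed_curves \<epsilon> ubar. wed \<epsilon> \<phi> v)" using * by (intro INF_greatest) auto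
  then show "wed \<epsilon> \<phi> u \<noteq> \<infinity>" using * by auto
qed

lemma rect: "locally_rectifiable u"
  by (rule wed_curve_locally_rectifiable[OF eps curve])

lemma m_measurable[measurable]: "m \<in> borel_measurable borel"
  by (rule speed_measurable[OF rect])

lemma m_square: "integrable \<mu> (\<lambda>t. (m t)\<^sup>2)"
  by (rule wed_curve_speed_square_integrable[OF eps curve])

lemma m_integrable: "set_integrable lborel {0..T} m"
  by (rule set_integrable_of_wed_square_integrable[OF eps m_measurable m_square])

lemma m_integrable_Icc: "0 \<le> a \<Longrightarrow> set_integrable lborel {a..b} m"
  by (rule set_integrable_subset[OF m_integrable[of b]]) auto

lemma dist_le_speed: "0 \<le> a \<Longrightarrow> a \<le> b \<Longrightarrow> dist (u a) (u b) \<le> (LINT r:{a..b}|lborel. m r)"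
  using metric_speed(2)[OF rect, of b] by (simp add: arc_bound_def)

lemma s_diff: "0 \<le> a \<Longrightarrow> a \<le> b \<Longrightarrow> s b - s a = (LINT r:{a..b}|lborel. m r)"
  unfolding s_def by (subst set_integral_Icc_combine[OF m_integrable, of a b]) auto

lemma dist_le_s: "0 \<le> a \<Longrightarrow> a \<le> b \<Longrightarrow> dist (u a) (u b) \<le> s b - s a"
  using dist_le_speed s_diff by simp

lemma dist_le_abs_s: "0 \<le> a \<Longrightarrow> 0 \<le> b \<Longrightarrow> dist (u a) (u b) \<le> \<bar>s b - s a\<bar>"
  using dist_le_s[of a b] dist_le_s[of b a] by (cases "a \<le> b") (auto simp: dist_commute)

lemma s_mono: "0 \<le> a \<Longrightarrow> a \<le> b \<Longrightarrow> s a \<le> s b"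
  using dist_le_s[of a b] zero_le_dist[of "u a" "u b"] by linarith

lemma s_eq_imp_u_eq: "0 \<le> a \<Longrightarrow> 0 \<le> b \<Longrightarrow> s a = s b \<Longrightarrow> u a = u b"
  using dist_le_abs_s[of a b] by simp

lemma s_cont: "continuous_on {0..} s"
proof -
  have c: "continuous_on {0..T} s" for T
  proof -
    have "m integrable_on {0..T}"
      by (rule set_borel_integral_eq_integral(1)[OF m_integrable])
    then have "continuous_on {0..T} (\<lambda>y. integral {0..y} m)"
      by (rule indefinite_integral_continuous_1)
    moreover have "integral {0..y} m = s y" for y
      unfolding s_def by (rule set_borel_integral_eq_integral(2)[OF m_integrable, symmetric])
    ultimately show ?thesis by simp
  qed
  show ?thesis
    unfolding continuous_on_eq_continuous_within
  proof
    fix t :: real assume "t \<in> {0..}"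
    then have "continuous (at t within {0..t + 1}) s"
      using c[of "t + 1"] by (simp add: continuous_on_eq_continuous_within)
    moreover have "at t within {0..} = at t within {0..t + 1}"
      using \<open>t \<in> {0..}\<close> by (intro at_within_nhd[of _ "{..<t + 1}"]) auto
    ultimately show "continuous (at t within {0..}) s" by simp
  qed
qed

lemma s_IVT:
  assumes "0 \<le> a" "a \<le> b" "s a \<le> y" "y \<le> s b"
  obtains t where "a \<le> t" "t \<le> b" "s t = y"
proof -
  have "continuous_on {a..b} s" by (rule continuous_on_subset[OF s_cont]) (use assms in auto)
  from IVT'[of s a y b, OF assms(3,4,2) this] obtain t where "a \<le> t" "t \<le> b" "s t = y" by blast
  then show thesis by (rule that)
qed

lemma u_cont: "isCont (\<lambda>t. u (max 0 t)) x"
  by (rule locally_rectifiable_continuous[OF rect])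

lemma phi_lsc:
  assumes "X \<longlonglongrightarrow> x"
  shows "\<phi> x \<le> liminf (\<lambda>n. \<phi> (X n))"
proof -
  have "limitin \<sigma> X x sequentially"
    unfolding limitin_def
  proof (intro conjI allI impI)
    show "x \<in> topspace \<sigma>" using compat by (simp add: compatible_def)
    fix U assume "openin \<sigma> U \<and> x \<in> U"
    then obtain V \<delta> where V: "openin \<sigma> V" "x \<in> V" "0 < \<delta>" "\<forall>y. infdist y V < \<delta> \<longrightarrow> y \<in> U"
      using compat unfolding compatible_def by blast
    have "\<forall>\<^sub>F n in sequentially. dist (X n) x < \<delta>" using assms V(3) by (rule tendstoD)
    then show "\<forall>\<^sub>F n in sequentially. X n \<in> U"
    proof eventually_elim
      case (elim n)
      then show ?case using V(4) infdist_le[OF V(2), of "X n"] by (meson le_less_trans)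
    qed
  qed
  moreover have "bounded (range X)" using assms by (rule convergent_imp_bounded)
  ultimately show ?thesis using lscc unfolding LSCC_def lsc_bounded_def by blast
qed

lemma phi_not_MInfty: "\<phi> x \<noteq> - \<infinity>"
  using proper by (simp add: proper_def)

lemma closed_sublevel:
  assumes S: "closed S" and c: "continuous_on S c"
  shows "closed {t \<in> S. \<phi> (u (max 0 t)) \<le> ereal (c t)}"
  unfolding closed_sequential_limits
proof (intro allI impI, elim conjE)
  fix X :: "nat \<Rightarrow> real" and x assume X: "\<forall>n. X n \<in> {t \<in> S. \<phi> (u (max 0 t)) \<le> ereal (c t)}" "X \<longlonglongrightarrow> x"
  then have XS: "\<And>n. X n \<in> S" by blast
  then have "x \<in> S" using S X(2) closed_sequentially by blast
  have "(\<lambda>n. c (X n)) \<longlonglongrightarrow> c x"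
    using c X(2) \<open>x \<in> S\<close> XS unfolding continuous_on_sequentially comp_def by blast
  then have "(\<lambda>n. ereal (c (X n))) \<longlonglongrightarrow> ereal (c x)" by simp
  then have cl: "liminf (\<lambda>n. ereal (c (X n))) = ereal (c x)" by (simp add: lim_imp_Liminf)
  have "(\<lambda>n. u (max 0 (X n))) \<longlonglongrightarrow> u (max 0 x)"
    using isCont_tendsto_compose[OF u_cont X(2)] .
  then have "\<phi> (u (max 0 x)) \<le> liminf (\<lambda>n. \<phi> (u (max 0 (X n))))" by (rule phi_lsc)
  also have "\<dots> \<le> liminf (\<lambda>n. ereal (c (X n)))" using X(1) by (intro Liminf_mono) (auto intro: always_eventually)
  finally show "x \<in> {t \<in> S. \<phi> (u (max 0 t)) \<le> ereal (c t)}" using cl \<open>x \<in> S\<close> by simp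
qed

lemma phi_u_measurable[measurable]: "(\<lambda>t. \<phi> (u (max 0 t))) \<in> borel_measurable borel"
  unfolding borel_measurable_iff_Iic_ereal
proof
  fix a :: ereal
  have fin: "closed ((\<lambda>t. \<phi> (u (max 0 t))) -` {..ereal r})" for r
    using closed_sublevel[of UNIV "\<lambda>_. r"] by (simp add: vimage_def)
  show "(\<lambda>t. \<phi> (u (max 0 t))) -` {..a} \<inter> space borel \<in> sets borel"
  proof (cases a)
    case (real r)
    then show ?thesis using fin[of r] by auto
  next
    case PInf
    then show ?thesis by (auto simp: vimage_def)
  next
    case MInf
    then have "(\<lambda>t. \<phi> (u (max 0 t))) -` {..a} = {}" using phi_not_MInfty by auto
    then show ?thesis by simp
  qed
qed

lemma Phi_measurable[measurable]: "\<Phi> \<in> borel_measurable borel"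
  unfolding \<Phi>_def[abs_def] by measurable

lemma e_measurable[measurable]: "e \<in> borel_measurable borel"
  unfolding e_def[abs_def] by measurable

lemma phi_lower:
  obtains h where "integrable \<mu> h" "\<And>t. 0 < t \<Longrightarrow> ereal (h t) \<le> \<phi> (u t)"
proof -
  obtain ustar A where B: "0 \<le> B" and
      A: "\<And>x y. ereal (- B * (dist x y)\<^sup>2 - (B * (dist y ustar)\<^sup>2 + A)) \<le> \<phi> x"
    using lscc unfolding LSCC_def coercive_def by blast
  interpret finite_measure \<mu> by (rule finite_wed_measure[OF eps])
  define d where "d = dist (u 0) ustar"
  define h where "h t = - B * (2 * d\<^sup>2 + 2 * (LINT r:{0..t}|lborel. m r)\<^sup>2) - A" for t
  have "integrable \<mu> (\<lambda>t. (LINT r:{0..t}|lborel. m r)\<^sup>2)"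
    by (rule Hardy_integrable[OF eps m_measurable speed_nonneg m_square])
  then have "integrable \<mu> h" unfolding h_def by (intro Bochner_Integration.integrable_diff integrable_mult_right Bochner_Integration.integrable_add) auto
  moreover have "ereal (h t) \<le> \<phi> (u t)" if "0 < t" for t
  proof -
    let ?y = "LINT r:{0..t}|lborel. m r"
    have "dist (u t) ustar \<le> d + ?y"
      using dist_triangle[of "u t" ustar "u 0"] dist_le_speed[of 0 t] that by (simp add: d_def dist_commute)
    then have "(dist (u t) ustar)\<^sup>2 \<le> (d + ?y)\<^sup>2" by (intro power_mono) auto
    also have "\<dots> \<le> 2 * d\<^sup>2 + 2 * ?y\<^sup>2"
      using sum_squares_bound[of d ?y] by (simp add: power2_sum)
    finally have "B * (dist (u t) ustar)\<^sup>2 \<le> B * (2 * d\<^sup>2 + 2 * ?y\<^sup>2)" using B by (rule mult_left_mono)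
    then have "ereal (h t) \<le> ereal (- B * (dist (u t) ustar)\<^sup>2 - (B * (dist ustar ustar)\<^sup>2 + A))"
      by (simp add: h_def)
    also have "\<dots> \<le> \<phi> (u t)" by (rule A)
    finally show ?thesis .
  qed
  ultimately show thesis by (rule that)
qed

lemma wed_eq: "wed \<epsilon> \<phi> u = ereal_integral \<mu> (\<lambda>t. ereal (\<epsilon> / 2 * (m t)\<^sup>2) + \<phi> (u (max 0 t)))"
  unfolding wed_def
  using metric_speed(1)[OF rect] by (intro ereal_integral_cong_AE) (auto simp: AE_wed_measure[OF eps] elim!: eventually_mono)

lemma phi_finite_AE: "AE t in lborel. 0 < t \<longrightarrow> \<phi> (u t) = ereal (\<Phi> t)"
  and Phi_integrable: "integrable \<mu> \<Phi>"
  and wed_eq_integral: "wed \<epsilon> \<phi> u = ereal (integral\<^sup>L \<mu> e)"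
proof -
  obtain h where h: "integrable \<mu> h" "\<And>t. 0 < t \<Longrightarrow> ereal (h t) \<le> \<phi> (u t)" using phi_lower by blast
  let ?f = "\<lambda>t. ereal (\<epsilon> / 2 * (m t)\<^sup>2) + \<phi> (u (max 0 t))"
  have f: "?f \<in> borel_measurable \<mu>" by measurable
  have le: "AE t in \<mu>. ereal (h t) \<le> ?f t"
    unfolding AE_wed_measure[OF eps]
  proof (intro AE_I2 impI)
    fix t :: real assume "0 < t"
    then have "0 + ereal (h t) \<le> ?f t" using h(2)[of t] eps by (intro add_mono) auto
    then show "ereal (h t) \<le> ?f t" by simp
  qed
  have fin: "ereal_integral \<mu> ?f \<noteq> \<infinity>" using wed_finite wed_eq by simp
  note 1 = ereal_integral_finite_imp_integrable[OF f le h(1) fin]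
  show AE: "AE t in lborel. 0 < t \<longrightarrow> \<phi> (u t) = ereal (\<Phi> t)"
    using 1(1) unfolding AE_wed_measure[OF eps]
  proof eventually_elim
    case (elim t)
    then show ?case using phi_not_MInfty[of "u t"] by (cases "\<phi> (u t)") (auto simp: \<Phi>_def)
  qed
  have "AE t in \<mu>. real_of_ereal (?f t) = e t"
    unfolding AE_wed_measure[OF eps] using AE
    by eventually_elim (auto simp: e_def)
  then have "integrable \<mu> e"
    using 1(2) by (subst (asm) integrable_cong_AE) auto
  moreover have "\<Phi> = (\<lambda>t. e t - \<epsilon> / 2 * (m t)\<^sup>2)" by (auto simp: e_def)
  ultimately show "integrable \<mu> \<Phi>" using m_square by simp
  have ef: "AE t in \<mu>. ?f t = ereal (e t)"
    unfolding AE_wed_measure[OF eps] using AE by eventually_elim (auto simp: e_def)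
  show "wed \<epsilon> \<phi> u = ereal (integral\<^sup>L \<mu> e)"
    unfolding wed_eq
  proof (rule antisym)
    show "ereal_integral \<mu> ?f \<le> ereal (integral\<^sup>L \<mu> e)"
      using ef by (intro ereal_integral_le \<open>integrable \<mu> e\<close>) (auto elim!: eventually_mono)
    show "ereal (integral\<^sup>L \<mu> e) \<le> ereal_integral \<mu> ?f"
      using ef by (intro ereal_integral_ge \<open>integrable \<mu> e\<close>) (auto elim!: eventually_mono)
  qed
qed

lemma e_integrable: "integrable \<mu> e"
  unfolding e_def[abs_def] using m_square Phi_integrable by simp

lemma competitor:
  assumes "g \<in> borel_measurable borel" "integrable \<mu> (\<lambda>t. (g t)\<^sup>2)" "v 0 = u 0"
    and "\<And>a b. 0 \<le> a \<Longrightarrow> a \<le> b \<Longrightarrow> dist (v a) (v b) \<le> (LINT r:{a..b}|lborel. g r)"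
    and "AE t in lborel. 0 < t \<longrightarrow> \<phi> (v t) \<le> ereal (\<Psi> t)" "integrable \<mu> \<Psi>"
  shows "integral\<^sup>L \<mu> e \<le> (\<integral>t. \<epsilon> / 2 * (g t)\<^sup>2 + \<Psi> t \<partial>\<mu>)"
proof -
  have "u 0 = ubar" using curve by (simp add: wed_curves_def)
  then have "v \<in> wed_curves \<epsilon> ubar"
    using arc_bound_imp_wed_curve(3)[OF eps assms(1,2,4)] assms(3) by simp
  then have "wed \<epsilon> \<phi> u \<le> wed \<epsilon> \<phi> v" by (rule minimal)
  also have "\<dots> \<le> ereal (\<integral>t. \<epsilon> / 2 * (g t)\<^sup>2 + \<Psi> t \<partial>\<mu>)"
    by (rule wed_le[OF eps assms(1,2,4,5,6)])
  finally show ?thesis by (simp add: wed_eq_integral)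
qed

lemma shift_integrable:
  fixes f :: "real \<Rightarrow> real"
  assumes "integrable \<mu> f" "0 \<le> t"
  shows "integrable \<mu> (\<lambda>r. f (t + r))"
proof -
  have "f \<in> borel_measurable borel" using assms by (auto dest: borel_measurable_integrable)
  then show ?thesis
    using integrable_wed_measure_shift[OF eps _ assms(2), of f] integrable_mult_indicator[OF _ assms(1), of "{t<..}"] by simp
qed

lemma e_split: "0 \<le> t \<Longrightarrow> integral\<^sup>L \<mu> e = (\<integral>r. indicator {..t} r * e r \<partial>\<mu>) + exp (- t / \<epsilon>) * G t"
proof -
  assume "0 \<le> t"
  have "splice t e (\<lambda>r. e (t + r)) = e" by (auto simp: splice_def)
  then show ?thesis
    using splice_wed_integral(2)[OF eps \<open>0 \<le> t\<close> e_integrable shift_integrable[OF e_integrable \<open>0 \<le> t\<close>]]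
    by (simp add: G_def)
qed

theorem tail_minimality:
  assumes t0: "0 \<le> t0"
    and g[measurable]: "g \<in> borel_measurable borel" and g2: "integrable \<mu> (\<lambda>t. (g t)\<^sup>2)" and v0: "v 0 = u t0"
    and v: "\<And>a b. 0 \<le> a \<Longrightarrow> a \<le> b \<Longrightarrow> dist (v a) (v b) \<le> (LINT r:{a..b}|lborel. g r)"
    and \<Psi>: "AE t in lborel. 0 < t \<longrightarrow> \<phi> (v t) \<le> ereal (\<Psi> t)" "integrable \<mu> \<Psi>"
  shows "G t0 \<le> (\<integral>t. \<epsilon> / 2 * (g t)\<^sup>2 + \<Psi> t \<partial>\<mu>)"
proof -
  have [measurable]: "\<Psi> \<in> borel_measurable borel" using \<Psi>(2) by (auto dest: borel_measurable_integrable)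
  let ?E = "\<lambda>t. \<epsilon> / 2 * (g t)\<^sup>2 + \<Psi> t"
  have E: "integrable \<mu> ?E" using g2 \<Psi>(2) by simp
  have sq: "(\<lambda>t. (splice t0 m g t)\<^sup>2) = splice t0 (\<lambda>t. (m t)\<^sup>2) (\<lambda>t. (g t)\<^sup>2)"
    by (auto simp: splice_def)
  have sE: "(\<lambda>t. \<epsilon> / 2 * (splice t0 m g t)\<^sup>2 + splice t0 \<Phi> \<Psi> t) = splice t0 e ?E"
    by (auto simp: splice_def e_def)
  have "integral\<^sup>L \<mu> e \<le> (\<integral>t. \<epsilon> / 2 * (splice t0 m g t)\<^sup>2 + splice t0 \<Phi> \<Psi> t \<partial>\<mu>)"
  proof (rule competitor)
    show "integrable \<mu> (\<lambda>t. (splice t0 m g t)\<^sup>2)"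
      unfolding sq by (rule splice_wed_integral(1)[OF eps t0 m_square g2])
    show "splice t0 u v 0 = u 0" using t0 by (simp add: splice_def)
    show "integrable \<mu> (splice t0 \<Phi> \<Psi>)" by (rule splice_wed_integral(1)[OF eps t0 Phi_integrable \<Psi>(2)])
    show "dist (splice t0 u v a) (splice t0 u v b) \<le> (LINT r:{a..b}|lborel. splice t0 m g r)" if "0 \<le> a" "a \<le> b" for a b
      by (rule splice_dist_le[OF t0 dist_le_speed v v0[symmetric] m_integrable set_integrable_of_wed_square_integrable[OF eps g g2] that])
    have sh: "AE t in lborel. 0 < t - t0 \<longrightarrow> \<phi> (v (t - t0)) \<le> ereal (\<Psi> (t - t0))"
      using AE_lborel_translate[OF \<Psi>(1), of "- t0"] by simp
    show "AE t in lborel. 0 < t \<longrightarrow> \<phi> (splice t0 u v t) \<le> ereal (splice t0 \<Phi> \<Psi> t)"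
      using sh phi_finite_AE by eventually_elim (auto simp: splice_def)
  qed measurable
  also have "\<dots> = (\<integral>r. indicator {..t0} r * e r \<partial>\<mu>) + exp (- t0 / \<epsilon>) * integral\<^sup>L \<mu> ?E"
    unfolding sE by (rule splice_wed_integral(2)[OF eps t0 e_integrable E])
  finally have "exp (- t0 / \<epsilon>) * G t0 \<le> exp (- t0 / \<epsilon>) * integral\<^sup>L \<mu> ?E"
    using e_split[OF t0] by linarith
  then show ?thesis by simp
qed

end

section \<open>The potential along arclength\<close>

lemma not_AE_outside_interval:
  fixes a b :: real
  assumes "a < b" "AE r in lborel. r \<notin> {a<..<b}"
  shows False
proof -
  have "{a<..<b} \<in> null_sets lborel" using assms(2) by (subst AE_iff_null_sets) auto
  then have "emeasure lborel {a<..<b} = 0" by (simp add: null_sets_def)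
  then show False using assms(1) by simp
qed

lemma AE_ex_in_interval:
  fixes a b :: real
  assumes "AE r in lborel. P r" "a < b"
  obtains r where "a < r" "r < b" "P r"
proof -
  have "\<exists>r. a < r \<and> r < b \<and> P r"
  proof (rule ccontr)
    assume "\<not> ?thesis"
    then have "AE r in lborel. r \<notin> {a<..<b}" using assms(1) by (auto elim!: eventually_mono)
    then show False using not_AE_outside_interval assms(2) by blast
  qed
  then show thesis using that by blast
qed

context wed_minimizer
begin

lemma dist_le_s_glue:
  assumes "\<And>p q. 0 \<le> p \<Longrightarrow> p \<le> q \<Longrightarrow> q \<le> c \<Longrightarrow> dist (v p) (v q) \<le> s q - s p"
    and "\<And>p q. c \<le> p \<Longrightarrow> p \<le> q \<Longrightarrow> dist (v p) (v q) \<le> s q - s p"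
    and "0 \<le> p" "p \<le> q"
  shows "dist (v p) (v q) \<le> s q - s p"
proof -
  consider "q \<le> c" | "c \<le> p" | "p < c" "c < q" by linarith
  then show ?thesis
  proof cases
    case 3
    then have "dist (v p) (v c) \<le> s c - s p" "dist (v c) (v q) \<le> s q - s c" using assms by auto
    then show ?thesis using dist_triangle[of "v p" "v q" "v c"] by linarith
  qed (use assms in auto)
qed

text \<open>On a maximal interval where the potential lies above the chord, \<open>u\<close> can be replaced by a geodesic run
  with the speed of \<open>u\<close>, which does not increase the kinetic energy and lowers the potential.\<close>

lemma chord_le:
  assumes t: "0 \<le> t0" "t0 \<le> t" "t \<le> t1" and st: "s t0 < s t1"
    and a0: "\<phi> (u t0) = ereal a0" and a1: "\<phi> (u t1) = ereal a1"
  shows "\<phi> (u t) \<le> ereal (a0 + (s t - s t0) * ((a1 - a0) / (s t1 - s t0)))"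
proof (rule ccontr)
  define k where "k = (a1 - a0) / (s t1 - s t0)"
  define ch where "ch r = a0 + (s r - s t0) * k" for r
  have ch0: "ch t0 = a0" and ch1: "ch t1 = a1" using st by (auto simp: ch_def k_def)
  assume "\<not> ?thesis"
  then have neg: "ereal (ch t) < \<phi> (u t)" by (simp add: ch_def k_def)
  have chc: "continuous_on {p..q} ch" if "0 \<le> p" for p q
    unfolding ch_def by (intro continuous_intros continuous_on_subset[OF s_cont]) (use that in auto)
  define F1 where "F1 = {r \<in> {t0..t}. \<phi> (u (max 0 r)) \<le> ereal (ch r)}"
  define F2 where "F2 = {r \<in> {t..t1}. \<phi> (u (max 0 r)) \<le> ereal (ch r)}"
  have cl: "closed F1" "closed F2" unfolding F1_def F2_def
    by (rule closed_sublevel[OF closed_atLeastAtMost chc]; use t in simp)+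
  have "t0 \<in> F1" "t1 \<in> F2" using t a0 a1 ch0 ch1 by (auto simp: F1_def F2_def)
  have bd: "bdd_above F1" "bdd_below F2" by (auto simp: F1_def F2_def)
  define a where "a = Sup F1"
  define b where "b = Inf F2"
  have aF: "a \<in> F1" unfolding a_def using cl bd \<open>t0 \<in> F1\<close> by (intro closed_contains_Sup) auto
  have bF: "b \<in> F2" unfolding b_def using cl bd \<open>t1 \<in> F2\<close> by (intro closed_contains_Inf) auto
  have "t \<notin> F1" "t \<notin> F2" using neg t by (auto simp: F1_def F2_def)
  have pa: "\<phi> (u a) \<le> ereal (ch a)" and pb: "\<phi> (u b) \<le> ereal (ch b)"
    using aF bF t by (auto simp: F1_def F2_def)
  have ab: "0 \<le> a" "a < t" "t < b"
    using aF bF \<open>t \<notin> F1\<close> \<open>t \<notin> F2\<close> t by (auto simp: F1_def F2_def order_less_le)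
  have above: "ereal (ch r) < \<phi> (u r)" if "a < r" "r < b" for r
  proof (cases "r \<le> t")
    case True
    then have "r \<notin> F1" using cSup_upper[OF _ bd(1), of r] that by (auto simp: a_def)
    then show ?thesis using True that ab aF by (auto simp: F1_def)
  next
    case False
    then have "r \<notin> F2" using cInf_lower[OF _ bd(2), of r] that by (auto simp: b_def)
    then show ?thesis using False that ab bF by (auto simp: F2_def)
  qed
  have "s a \<le> s b" "s a \<le> s t" "s t \<le> s b" using ab by (auto intro!: s_mono)
  have sab: "s a < s b"
  proof (rule ccontr)
    assume "\<not> ?thesis"
    then have "s t = s a" using \<open>s a \<le> s t\<close> \<open>s t \<le> s b\<close> by linarith
    then have "u t = u a" "ch t = ch a" using ab by (auto intro!: s_eq_imp_u_eq simp: ch_def)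
    then show False using pa neg by simp
  qed
  have dom: "u a \<in> eff_domain \<phi>" "u b \<in> eff_domain \<phi>"
    using pa pb by (auto simp: eff_domain_def)
  obtain \<gamma> where \<gamma>: "geodesic \<gamma>" "\<gamma> 0 = u a" "\<gamma> 1 = u b"
    "\<And>x. x \<in> {0..1} \<Longrightarrow> \<phi> (\<gamma> x) \<le> ereal (1 - x) * \<phi> (u a) + ereal x * \<phi> (u b) - ereal (0 / 2 * x * (1 - x) * (dist (u a) (u b))\<^sup>2)"
    using geoconvex dom unfolding geodesically_convex_def by blast
  have \<gamma>le: "\<phi> (\<gamma> x) \<le> ereal ((1 - x) * ch a + x * ch b)" if "x \<in> {0..1}" for x
  proof -
    have "\<phi> (\<gamma> x) \<le> ereal (1 - x) * \<phi> (u a) + ereal x * \<phi> (u b)" using \<gamma>(4)[OF that] by (simp add: zero_ereal_def[symmetric])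
    also have "\<dots> \<le> ereal (1 - x) * ereal (ch a) + ereal x * ereal (ch b)"
      using that pa pb by (intro add_mono ereal_mult_left_mono) auto
    finally show ?thesis by simp
  qed
  define X where "X r = (s r - s a) / (s b - s a)" for r
  have X: "X r \<in> {0..1}" if "a \<le> r" "r \<le> b" for r
    using s_mono[of a r] s_mono[of r b] that ab sab by (auto simp: X_def)
  have Xch: "(1 - X r) * ch a + X r * ch b = ch r" for r
  proof -
    have "X r * (s b - s a) = s r - s a" using sab by (simp add: X_def)
    then have "X r * (s b - s a) * k = (s r - s a) * k" by simp
    then show ?thesis by (simp add: ch_def algebra_simps)
  qed
  define v where "v r = (if a \<le> r \<and> r \<le> b then \<gamma> (X r) else u r)" for r
  have vab: "v r = u r" if "\<not> (a < r \<and> r < b)" for r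
    using that \<gamma>(2,3) sab ab by (cases "r = a \<or> r = b") (auto simp: v_def X_def)
  have mid: "dist (v p) (v q) \<le> s q - s p" if "a \<le> p" "p \<le> q" "q \<le> b" for p q
  proof -
    have "s p \<le> s q" using that ab by (intro s_mono) auto
    then have Xpq: "\<bar>X q - X p\<bar> = (s q - s p) / (s b - s a)"
      using sab by (simp add: X_def diff_divide_distrib[symmetric])
    have "dist (v p) (v q) = \<bar>X q - X p\<bar> * dist (u a) (u b)"
      using \<gamma>(1) X[of p] X[of q] that unfolding geodesic_def \<gamma>(2,3) by (simp add: v_def)
    also have "\<dots> \<le> \<bar>X q - X p\<bar> * (s b - s a)"
      using dist_le_s[of a b] ab by (intro mult_left_mono) auto
    also have "\<dots> = s q - s p" using sab by (simp add: Xpq)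
    finally show ?thesis .
  qed
  have right: "dist (v p) (v q) \<le> s q - s p" if "a \<le> p" "p \<le> q" for p q
  proof -
    have "dist (v p) (v q) \<le> s q - s p" if "b \<le> p" "p \<le> q" for p q
      using dist_le_s[of p q] that ab vab[of p] vab[of q] by auto
    moreover have "q \<le> b \<or> b \<le> p \<or> (p < b \<and> b < q)" by linarith
    ultimately show ?thesis
      using mid[of p q] mid[of p b] that dist_triangle[of "v p" "v q" "v b"] by (smt (verit, best))
  qed
  have left: "dist (v p) (v q) \<le> s q - s p" if "0 \<le> p" "p \<le> q" "q \<le> a" for p q
    using dist_le_s[of p q] that ab vab[of p] vab[of q] by auto
  have vd: "dist (v p) (v q) \<le> (LINT r:{p..q}|lborel. m r)" if "0 \<le> p" "p \<le> q" for p q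
    using dist_le_s_glue[OF left right that] s_diff[OF that] by simp
  interpret finite_measure \<mu> by (rule finite_wed_measure[OF eps])
  have "bounded (ch ` {a..b})"
    by (intro compact_imp_bounded compact_continuous_image chc ab compact_Icc)
  then obtain M where "\<forall>x\<in>ch ` {a..b}. norm x \<le> M" unfolding bounded_iff by blast
  then have M: "\<bar>ch r\<bar> \<le> M" if "r \<in> {a..b}" for r using that by simp
  have chi: "integrable \<mu> (\<lambda>r. indicator {a<..<b} r * ch r)"
  proof (rule integrable_const_bound[where B="\<bar>M\<bar>"])
    have "continuous_on {a<..<b} ch" by (rule continuous_on_subset[OF chc[of a b]]) (use ab in auto)
    then have "(\<lambda>r. indicator {a<..<b} r *\<^sub>R ch r) \<in> borel_measurable borel"
      by (intro borel_measurable_continuous_on_indicator) auto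
    then show "(\<lambda>r. indicator {a<..<b} r * ch r) \<in> borel_measurable \<mu>" by simp
    show "AE r in \<mu>. norm (indicator {a<..<b} r * ch r) \<le> \<bar>M\<bar>"
    proof (intro AE_I2)
      fix r
      show "norm (indicator {a<..<b} r * ch r) \<le> \<bar>M\<bar>"
        using M[of r] by (cases "r \<in> {a<..<b}") auto
    qed
  qed
  have Phii: "integrable \<mu> (\<lambda>r. indicator {a<..<b} r * \<Phi> r)"
    using integrable_mult_indicator[OF _ Phi_integrable, of "{a<..<b}"] by simp
  define \<Psi> where "\<Psi> r = \<Phi> r - (indicator {a<..<b} r * \<Phi> r - indicator {a<..<b} r * ch r)" for r
  have \<Psi>i: "integrable \<mu> \<Psi>" unfolding \<Psi>_def using Phi_integrable Phii chi by simp
  have "integral\<^sup>L \<mu> e \<le> (\<integral>r. \<epsilon> / 2 * (m r)\<^sup>2 + \<Psi> r \<partial>\<mu>)"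
  proof (rule competitor[OF m_measurable m_square _ vd _ \<Psi>i])
    show "v 0 = u 0" using ab by (intro vab) auto
    show "AE r in lborel. 0 < r \<longrightarrow> \<phi> (v r) \<le> ereal (\<Psi> r)"
      using phi_finite_AE
    proof eventually_elim
      case (elim r)
      show ?case
      proof (cases "a < r \<and> r < b")
        case True
        then have "\<phi> (v r) \<le> ereal (ch r)" using \<gamma>le[OF X[of r]] Xch[of r] by (simp add: v_def)
        then show ?thesis using True by (simp add: \<Psi>_def)
      next
        case False
        then show ?thesis using elim vab[OF False] by (auto simp: \<Psi>_def)
      qed
    qed
  qed
  also have "\<dots> = integral\<^sup>L \<mu> e - (\<integral>r. indicator {a<..<b} r * \<Phi> r - indicator {a<..<b} r * ch r \<partial>\<mu>)"
    unfolding e_def \<Psi>_def using Phi_integrable Phii chi m_square by simp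
  finally have le0: "(\<integral>r. indicator {a<..<b} r * \<Phi> r - indicator {a<..<b} r * ch r \<partial>\<mu>) \<le> 0" by simp
  have pos: "AE r in \<mu>. r \<in> {a<..<b} \<longrightarrow> ch r < \<Phi> r"
    unfolding AE_wed_measure[OF eps] using phi_finite_AE
  proof eventually_elim
    case (elim r)
    then show ?case using above[of r] by auto
  qed
  have nn: "AE r in \<mu>. 0 \<le> indicator {a<..<b} r * \<Phi> r - indicator {a<..<b} r * ch r"
    using pos by eventually_elim (auto simp: indicator_def)
  have "(\<integral>r. indicator {a<..<b} r * \<Phi> r - indicator {a<..<b} r * ch r \<partial>\<mu>) = 0"
    using le0 integral_nonneg_AE[OF nn] by linarith
  then have "AE r in \<mu>. indicator {a<..<b} r * \<Phi> r - indicator {a<..<b} r * ch r = 0"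
    using integral_nonneg_eq_0_iff_AE[OF Bochner_Integration.integrable_diff[OF Phii chi] nn] by simp
  with pos have "AE r in \<mu>. r \<notin> {a<..<b}" by eventually_elim (auto simp: indicator_def)
  then have "AE r in lborel. r \<notin> {a<..<b}"
    unfolding AE_wed_measure[OF eps] by eventually_elim (use ab in auto)
  then show False using not_AE_outside_interval[of a b] ab by auto
qed

lemma chord_le':
  assumes t: "0 \<le> t0" "t0 \<le> t1" "0 \<le> t"
    and a0: "\<phi> (u t0) = ereal a0" and a1: "\<phi> (u t1) = ereal a1"
    and x: "0 \<le> x" "x \<le> 1" "s t = (1 - x) * s t0 + x * s t1"
  shows "\<phi> (u t) \<le> ereal ((1 - x) * a0 + x * a1)"
proof (cases "s t0 = s t1")
  case True
  then have "s t = s t0" using x by (simp add: algebra_simps)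
  then have "u t = u t0" "u t1 = u t0" using t True by (auto intro: s_eq_imp_u_eq)
  then show ?thesis using a0 a1 by (simp add: algebra_simps)
next
  case False
  then have st: "s t0 < s t1" using s_mono[of t0 t1] t by simp
  have x': "s t - s t0 = x * (s t1 - s t0)" using x(3) by (simp add: algebra_simps)
  have "0 \<le> x * (s t1 - s t0)" "x * (s t1 - s t0) \<le> 1 * (s t1 - s t0)"
    using x st by (auto intro!: mult_nonneg_nonneg mult_right_mono)
  then obtain t' where t': "t0 \<le> t'" "t' \<le> t1" "s t' = s t"
    using s_IVT[of t0 t1 "s t"] t x' by auto
  have "u t = u t'" using t' t by (intro s_eq_imp_u_eq) auto
  then have "\<phi> (u t) \<le> ereal (a0 + (s t' - s t0) * ((a1 - a0) / (s t1 - s t0)))"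
    using chord_le[OF t(1) t'(1,2) st a0 a1] by simp
  also have "(s t' - s t0) * ((a1 - a0) / (s t1 - s t0)) = x * (a1 - a0)"
    using st by (simp add: t'(3) x')
  finally show ?thesis by (simp add: algebra_simps)
qed

lemma G_le:
  assumes "0 \<le> t" "\<phi> (u t) = ereal a"
  shows "G t \<le> a"
proof -
  interpret finite_measure \<mu> by (rule finite_wed_measure[OF eps])
  have "G t \<le> (\<integral>r. \<epsilon> / 2 * (0::real)\<^sup>2 + a \<partial>\<mu>)"
    by (rule tail_minimality[OF assms(1), of "\<lambda>_. 0" "\<lambda>_. u t"]) (use assms in auto)
  then show ?thesis by (simp add: measure_wed_measure_UNIV[OF eps])
qed

lemma Phi_shift_finite: "0 \<le> t \<Longrightarrow> AE r in lborel. 0 < r \<longrightarrow> \<phi> (u (t + r)) = ereal (\<Phi> (t + r))"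
  using AE_lborel_translate[OF phi_finite_AE, of t] by (auto elim!: eventually_mono)

text \<open>If the potential increased, it would by convexity stay larger after its last low point \<open>c\<close>, and stopping
  \<open>u\<close> at time \<open>c\<close> would lower the energy.\<close>

lemma phi_u_antimono:
  assumes t: "0 \<le> t1" "t1 \<le> t2"
  shows "\<phi> (u t2) \<le> \<phi> (u t1)"
proof (rule ccontr)
  assume "\<not> ?thesis"
  then have less: "\<phi> (u t1) < \<phi> (u t2)" by simp
  then obtain a1 where a1: "\<phi> (u t1) = ereal a1"
    using phi_not_MInfty[of "u t1"] by (cases "\<phi> (u t1)") auto
  define F where "F = {r \<in> {t1..t2}. \<phi> (u (max 0 r)) \<le> ereal a1}"
  have cl: "closed F" unfolding F_def by (rule closed_sublevel) auto
  have "t1 \<in> F" using t a1 by (simp add: F_def)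
  have bd: "bdd_above F" by (auto simp: F_def)
  define c where "c = Sup F"
  have cF: "c \<in> F" unfolding c_def using cl bd \<open>t1 \<in> F\<close> by (intro closed_contains_Sup) auto
  have "t2 \<notin> F" using less a1 t by (auto simp: F_def)
  then have c: "0 \<le> c" "t1 \<le> c" "c < t2" using cF t by (auto simp: F_def order_less_le)
  obtain a where a: "\<phi> (u c) = ereal a" "a \<le> a1"
    using cF c phi_not_MInfty[of "u c"] by (cases "\<phi> (u c)") (auto simp: F_def)
  have before: "ereal a1 < \<phi> (u r)" if "c < r" "r \<le> t2" for r
  proof -
    have "r \<notin> F" using cSup_upper[OF _ bd, of r] that by (auto simp: c_def)
    then show ?thesis using that c by (auto simp: F_def)
  qed
  have after: "ereal a1 < \<phi> (u r)" if "c < r" for r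
  proof (cases "r \<le> t2")
    case False
    show ?thesis
    proof (rule ccontr)
      assume "\<not> ?thesis"
      then have "\<phi> (u r) \<le> ereal a1" by simp
      then obtain b where b: "\<phi> (u r) = ereal b" "b \<le> a1"
        using phi_not_MInfty[of "u r"] by (cases "\<phi> (u r)") auto
      show False
      proof (cases "s c = s r")
        case True
        then have "s c = s t2" using s_mono[of c t2] s_mono[of t2 r] c False by auto
        then have "u t2 = u c" using c t by (intro s_eq_imp_u_eq) auto
        then show False using before[of t2] c a by auto
      next
        case False': False
        then have sc: "s c < s r" using s_mono[of c r] c False by auto
        define x where "x = (s t2 - s c) / (s r - s c)"
        have x: "0 \<le> x" "x \<le> 1" using s_mono[of c t2] s_mono[of t2 r] c False sc by (auto simp: x_def)
        have "x * (s r - s c) = s t2 - s c" using sc by (simp add: x_def)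
        then have "s t2 = (1 - x) * s c + x * s r" by (simp add: algebra_simps)
        from chord_le'[OF _ _ _ a(1) b(1) x this] have "\<phi> (u t2) \<le> ereal ((1 - x) * a + x * b)"
          using c False t by auto
        also have "(1 - x) * a + x * b \<le> (1 - x) * a1 + x * a1"
          using x a b by (intro add_mono mult_left_mono) auto
        finally show False using before[of t2] c by (simp add: algebra_simps)
      qed
    qed
  qed (use before that in auto)
  interpret finite_measure \<mu> by (rule finite_wed_measure[OF eps])
  have ei: "integrable \<mu> (\<lambda>r. e (c + r) - a)" using shift_integrable[OF e_integrable c(1)] by simp
  have "(\<integral>r. e (c + r) - a \<partial>\<mu>) = G c - a"
    using shift_integrable[OF e_integrable c(1)] by (simp add: G_def measure_wed_measure_UNIV[OF eps])
  then have le0: "(\<integral>r. e (c + r) - a \<partial>\<mu>) \<le> 0" using G_le[OF c(1) a(1)] by simp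
  have pos: "AE r in \<mu>. a < \<Phi> (c + r)"
    unfolding AE_wed_measure[OF eps] using Phi_shift_finite[OF c(1)]
  proof eventually_elim
    case (elim r)
    show ?case
    proof
      assume "0 < r"
      then have "ereal a1 < ereal (\<Phi> (c + r))" using after[of "c + r"] elim by auto
      then show "a < \<Phi> (c + r)" using a by auto
    qed
  qed
  have gt: "AE r in \<mu>. 0 < e (c + r) - a"
    using pos
  proof eventually_elim
    case (elim r)
    have "0 \<le> \<epsilon> / 2 * (m (c + r))\<^sup>2" using eps by simp
    then show ?case using elim unfolding e_def by linarith
  qed
  then have nn: "AE r in \<mu>. 0 \<le> e (c + r) - a" by eventually_elim simp
  have "(\<integral>r. e (c + r) - a \<partial>\<mu>) = 0" using le0 integral_nonneg_AE[OF nn] by linarith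
  then have "AE r in \<mu>. e (c + r) - a = 0"
    using integral_nonneg_eq_0_iff_AE[OF ei nn] by simp
  with gt have "AE r in \<mu>. r \<notin> {0<..<1}" by eventually_elim simp
  then have "AE r in lborel. r \<notin> {0<..<1::real}"
    unfolding AE_wed_measure[OF eps] by eventually_elim auto
  then show False using not_AE_outside_interval[of 0 1] by auto
qed

lemma phi_u_finite: "0 < t \<Longrightarrow> \<phi> (u t) = ereal (\<Phi> t)"
proof -
  assume t: "0 < t"
  obtain r where r: "0 < r" "r < t" "0 < r \<longrightarrow> \<phi> (u r) = ereal (\<Phi> r)"
    by (rule AE_ex_in_interval[OF phi_finite_AE t])
  then have "\<phi> (u t) \<le> ereal (\<Phi> r)" using phi_u_antimono[of r t] by auto
  then show ?thesis using phi_not_MInfty[of "u t"] t by (cases "\<phi> (u t)") (auto simp: \<Phi>_def)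
qed

lemma Phi_antimono: "0 < t1 \<Longrightarrow> t1 \<le> t2 \<Longrightarrow> \<Phi> t2 \<le> \<Phi> t1"
  using phi_u_antimono[of t1 t2] phi_u_finite[of t1] phi_u_finite[of t2] by simp

lemma Phi_chord:
  assumes "0 < t0" "t0 \<le> t1" "0 < t" "0 \<le> x" "x \<le> 1" "s t = (1 - x) * s t0 + x * s t1"
  shows "\<Phi> t \<le> (1 - x) * \<Phi> t0 + x * \<Phi> t1"
  using chord_le'[OF _ assms(2) _ phi_u_finite phi_u_finite assms(4-6)] assms phi_u_finite[of t] by simp

lemma G_le_Phi: "0 < t \<Longrightarrow> G t \<le> \<Phi> t"
  using G_le[of t "\<Phi> t"] phi_u_finite[of t] by simp

end

section \<open>The value function\<close>

lemma DERIV_nonneg_of_right_min: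
  fixes f :: "real \<Rightarrow> real"
  assumes "(f has_real_derivative D) (at t)" "t < b" "\<And>k. t < k \<Longrightarrow> k < b \<Longrightarrow> f t \<le> f k"
  shows "0 \<le> D"
proof (rule ccontr)
  assume "\<not> 0 \<le> D"
  then obtain d where d: "d > 0" "\<forall>h>0. t + h \<in> UNIV \<longrightarrow> h < d \<longrightarrow> f (t + h) < f t"
    using has_real_derivative_neg_dec_right[OF assms(1)] by auto
  define h where "h = min d (b - t) / 2"
  have "h > 0" "h < d" "t + h < b" using d(1) assms(2) by (auto simp: h_def min_def field_simps)
  then show False using d(2) assms(3)[of "t + h"] by force
qed

lemma DERIV_nonpos_of_left_min:
  fixes f :: "real \<Rightarrow> real"
  assumes "(f has_real_derivative D) (at t)" "a < t" "\<And>k. a < k \<Longrightarrow> k < t \<Longrightarrow> f t \<le> f k"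
  shows "D \<le> 0"
proof (rule ccontr)
  assume "\<not> D \<le> 0"
  then obtain d where d: "d > 0" "\<forall>h>0. t - h \<in> UNIV \<longrightarrow> h < d \<longrightarrow> f (t - h) < f t"
    using has_real_derivative_pos_inc_left[OF assms(1)] by auto
  define h where "h = min d (t - a) / 2"
  have "h > 0" "h < d" "a < t - h" using d(1) assms(2) by (auto simp: h_def min_def field_simps)
  then show False using d(2) assms(3)[of "t - h"] by force
qed

lemma convex_square:
  fixes x a b :: real
  assumes "0 \<le> x" "x \<le> 1"
  shows "((1 - x) * a + x * b)\<^sup>2 \<le> (1 - x) * a\<^sup>2 + x * b\<^sup>2"
proof -
  have "(1 - x) * a\<^sup>2 + x * b\<^sup>2 - ((1 - x) * a + x * b)\<^sup>2 = x * (1 - x) * (a - b)\<^sup>2"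
    by (simp add: power2_eq_square algebra_simps)
  also have "\<dots> \<ge> 0" using assms by simp
  finally show ?thesis by simp
qed

context wed_minimizer
begin

lemma set_integral_m_shift:
  assumes "0 \<le> t" "0 \<le> a" "a \<le> b"
  shows "(LINT r:{a..b}|lborel. m (t + r)) = s (t + b) - s (t + a)"
proof -
  have "(LINT r:{(a + t) + (- t)..(b + t) + (- t)}|lborel. m (r - (- t))) = (LINT r:{a + t..b + t}|lborel. m r)"
    by (rule set_integral_translate)
  then show ?thesis using s_diff[of "t + a" "t + b"] assms by (simp add: add.commute)
qed

lemma set_integrable_m_shift:
  assumes "0 \<le> t" "0 \<le> a"
  shows "set_integrable lborel {a..b} (\<lambda>r. m (t + r))"
  using set_integrable_translate[of "a + t" "- t" "b + t" m] m_integrable_Icc[of "a + t" "b + t"] assms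
  by (simp add: add.commute)

text \<open>The convex combination, in arclength, of two tails of \<open>u\<close> competes with a third tail.\<close>

lemma G_convex_in_s:
  assumes t: "0 < t1" "t1 \<le> t2" "0 \<le> t3" and x: "0 \<le> x" "x \<le> 1" and st: "s t3 = (1 - x) * s t1 + x * s t2"
  shows "G t3 \<le> (1 - x) * G t1 + x * G t2"
proof -
  define \<sigma>' where "\<sigma>' r = (1 - x) * s (t1 + r) + x * s (t2 + r)" for r
  have "\<exists>\<tau>. t1 + r \<le> \<tau> \<and> \<tau> \<le> t2 + r \<and> s \<tau> = \<sigma>' r" if "0 \<le> r" for r
  proof -
    have "s (t1 + r) \<le> s (t2 + r)" using that t by (intro s_mono) auto
    then have "x * s (t1 + r) \<le> x * s (t2 + r)" "(1 - x) * s (t1 + r) \<le> (1 - x) * s (t2 + r)"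
      using x by (auto intro: mult_left_mono)
    then have "s (t1 + r) \<le> \<sigma>' r" "\<sigma>' r \<le> s (t2 + r)"
      by (auto simp: \<sigma>'_def algebra_simps)
    then show ?thesis using s_IVT[of "t1 + r" "t2 + r" "\<sigma>' r"] that t by (metis add_le_cancel_right add_nonneg_nonneg less_imp_le)
  qed
  then obtain \<tau> where \<tau>: "\<And>r. 0 \<le> r \<Longrightarrow> t1 + r \<le> \<tau> r \<and> \<tau> r \<le> t2 + r \<and> s (\<tau> r) = \<sigma>' r" by metis
  have \<tau>0: "0 < \<tau> r" if "0 \<le> r" for r using \<tau>[OF that] that t by linarith
  let ?g = "\<lambda>r. (1 - x) * m (t1 + r) + x * m (t2 + r)"
  let ?\<Psi> = "\<lambda>r. (1 - x) * \<Phi> (t1 + r) + x * \<Phi> (t2 + r)"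
  have t12: "0 \<le> t1" "0 \<le> t2" using t by auto
  note sq = shift_integrable[OF m_square t12(1)] shift_integrable[OF m_square t12(2)]
  note Ph = shift_integrable[OF Phi_integrable t12(1)] shift_integrable[OF Phi_integrable t12(2)]
  note ee = shift_integrable[OF e_integrable t12(1)] shift_integrable[OF e_integrable t12(2)]
  have g2: "integrable \<mu> (\<lambda>r. (?g r)\<^sup>2)"
  proof (rule Bochner_Integration.integrable_bound)
    show "integrable \<mu> (\<lambda>r. (1 - x) * (m (t1 + r))\<^sup>2 + x * (m (t2 + r))\<^sup>2)" using sq by simp
    show "AE r in \<mu>. norm ((?g r)\<^sup>2) \<le> norm ((1 - x) * (m (t1 + r))\<^sup>2 + x * (m (t2 + r))\<^sup>2)"
      using convex_square[OF x] by (intro AE_I2) (simp add: order_trans[OF _ abs_ge_self])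
  qed measurable
  have "G t3 \<le> (\<integral>r. \<epsilon> / 2 * (?g r)\<^sup>2 + ?\<Psi> r \<partial>\<mu>)"
  proof (rule tail_minimality[OF t(3), of ?g "\<lambda>r. u (\<tau> r)"])
    show "u (\<tau> 0) = u t3" using \<tau>[of 0] \<tau>0[of 0] t st by (intro s_eq_imp_u_eq) (auto simp: \<sigma>'_def)
    fix a b :: real assume ab: "0 \<le> a" "a \<le> b"
    have "dist (u (\<tau> a)) (u (\<tau> b)) \<le> \<bar>\<sigma>' b - \<sigma>' a\<bar>"
      using dist_le_abs_s[of "\<tau> a" "\<tau> b"] \<tau>[of a] \<tau>[of b] \<tau>0[of a] \<tau>0[of b] ab by simp
    also have "\<sigma>' b - \<sigma>' a = (1 - x) * (s (t1 + b) - s (t1 + a)) + x * (s (t2 + b) - s (t2 + a))"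
      by (simp add: \<sigma>'_def algebra_simps)
    also have "\<bar>\<dots>\<bar> = \<dots>"
      using ab t x by (intro abs_of_nonneg add_nonneg_nonneg mult_nonneg_nonneg) (auto intro!: s_mono)
    also have "\<dots> = (LINT r:{a..b}|lborel. (1 - x) * m (t1 + r)) + (LINT r:{a..b}|lborel. x * m (t2 + r))"
      using ab t12 by (simp add: set_integral_m_shift)
    also have "\<dots> = (LINT r:{a..b}|lborel. ?g r)"
      using ab t12 by (intro set_integral_add(2)[symmetric] set_integrable_mult_right set_integrable_m_shift) auto
    finally show "dist (u (\<tau> a)) (u (\<tau> b)) \<le> (LINT r:{a..b}|lborel. ?g r)" .
  next
    show "AE r in lborel. 0 < r \<longrightarrow> \<phi> (u (\<tau> r)) \<le> ereal (?\<Psi> r)"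
    proof (intro AE_I2 impI)
      fix r :: real assume r: "0 < r"
      have "\<Phi> (\<tau> r) \<le> ?\<Psi> r"
        by (rule Phi_chord) (use r t x \<tau>[of r] \<tau>0[of r] in \<open>auto simp: \<sigma>'_def\<close>)
      then show "\<phi> (u (\<tau> r)) \<le> ereal (?\<Psi> r)" using phi_u_finite[OF \<tau>0, of r] r by simp
    qed
  qed (use g2 Ph in auto)
  also have "\<dots> \<le> (\<integral>r. (1 - x) * e (t1 + r) + x * e (t2 + r) \<partial>\<mu>)"
  proof (rule integral_mono)
    fix r
    have sqle: "\<epsilon> / 2 * (?g r)\<^sup>2 \<le> \<epsilon> / 2 * ((1 - x) * (m (t1 + r))\<^sup>2 + x * (m (t2 + r))\<^sup>2)"
      using eps convex_square[OF x] by (intro mult_left_mono) auto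
    show "\<epsilon> / 2 * (?g r)\<^sup>2 + ?\<Psi> r \<le> (1 - x) * e (t1 + r) + x * e (t2 + r)"
    proof -
      have "(1 - x) * e (t1 + r) + x * e (t2 + r) = \<epsilon> / 2 * ((1 - x) * (m (t1 + r))\<^sup>2 + x * (m (t2 + r))\<^sup>2) + ?\<Psi> r"
        by (simp add: e_def field_simps)
      then show ?thesis using sqle by linarith
    qed
  qed (use g2 Ph ee in auto)
  also have "\<dots> = (1 - x) * G t1 + x * G t2" using ee by (simp add: G_def)
  finally show ?thesis .
qed

lemma G_le_constant_speed:
  assumes t: "0 < t" "t \<le> t'" and p: "0 < p" and h: "h = (s t' - s t) / p"
  shows "G t \<le> (1 - exp (- h / \<epsilon>)) * (\<epsilon> / 2 * p\<^sup>2 + \<Phi> t) + exp (- h / \<epsilon>) * G t'"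
proof -
  have h0: "0 \<le> h" using s_mono[of t t'] t p by (simp add: h)
  have hp: "p * h = s t' - s t" using p by (simp add: h)
  have "\<exists>\<tau>. t \<le> \<tau> \<and> \<tau> \<le> t' \<and> s \<tau> = s t + p * r" if "0 \<le> r" "r \<le> h" for r
  proof -
    have "p * r \<le> p * h" "0 \<le> p * r" using that p by auto
    then show ?thesis using s_IVT[of t t' "s t + p * r"] t hp by (metis add_increasing2 diff_add_cancel add.commute add_le_cancel_left less_imp_le order_refl)
  qed
  then obtain \<tau> where \<tau>: "\<And>r. 0 \<le> r \<Longrightarrow> r \<le> h \<Longrightarrow> t \<le> \<tau> r \<and> \<tau> r \<le> t' \<and> s (\<tau> r) = s t + p * r" by metis
  interpret finite_measure \<mu> by (rule finite_wed_measure[OF eps])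
  have t'0: "0 \<le> t'" using t by simp
  have ci: "set_integrable lborel {a..b} (\<lambda>_. p)" for a b :: real by (rule set_integrable_const_interval(2))
  let ?v = "splice h (\<lambda>r. u (\<tau> r)) (\<lambda>r. u (t' + r))"
  let ?g = "splice h (\<lambda>_. p) (\<lambda>r. m (t' + r))"
  let ?\<Psi> = "splice h (\<lambda>_. \<Phi> t) (\<lambda>r. \<Phi> (t' + r))"
  have sq: "(\<lambda>r. (?g r)\<^sup>2) = splice h (\<lambda>_. p\<^sup>2) (\<lambda>r. (m (t' + r))\<^sup>2)" by (auto simp: splice_def)
  have E: "(\<lambda>r. \<epsilon> / 2 * (?g r)\<^sup>2 + ?\<Psi> r) = splice h (\<lambda>_. \<epsilon> / 2 * p\<^sup>2 + \<Phi> t) (\<lambda>r. e (t' + r))"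
    by (auto simp: splice_def e_def)
  have "G t \<le> (\<integral>r. \<epsilon> / 2 * (?g r)\<^sup>2 + ?\<Psi> r \<partial>\<mu>)"
  proof (rule tail_minimality[of t ?g ?v])
    show "0 \<le> t" using t by simp
    show "integrable \<mu> (\<lambda>r. (?g r)\<^sup>2)"
      unfolding sq using shift_integrable[OF m_square t'0] by (intro splice_wed_integral(1)[OF eps h0]) auto
    show "integrable \<mu> ?\<Psi>"
      using shift_integrable[OF Phi_integrable t'0] by (intro splice_wed_integral(1)[OF eps h0]) auto
    show "?v 0 = u t" using \<tau>[of 0] h0 t by (auto simp: splice_def intro!: s_eq_imp_u_eq)
    fix a b :: real assume ab: "0 \<le> a" "a \<le> b"
    show "dist (?v a) (?v b) \<le> (LINT r:{a..b}|lborel. ?g r)"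
    proof (rule splice_dist_le[OF h0 _ _ _ ci _ ab])
      fix a b :: real assume ab: "0 \<le> a" "a \<le> b" "b \<le> h"
      have "dist (u (\<tau> a)) (u (\<tau> b)) \<le> \<bar>(s t + p * b) - (s t + p * a)\<bar>"
        using dist_le_abs_s[of "\<tau> a" "\<tau> b"] \<tau>[of a] \<tau>[of b] ab t by simp
      also have "\<dots> = p * (b - a)" using p ab by (simp add: algebra_simps abs_mult)
      also have "\<dots> = (LINT r:{a..b}|lborel. p)" using ab by (simp add: set_lebesgue_integral_def)
      finally show "dist (u (\<tau> a)) (u (\<tau> b)) \<le> (LINT r:{a..b}|lborel. p)" .
    next
      fix a b :: real assume ab: "0 \<le> a" "a \<le> b"
      show "dist (u (t' + a)) (u (t' + b)) \<le> (LINT r:{a..b}|lborel. m (t' + r))"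
        using dist_le_s[of "t' + a" "t' + b"] ab t'0 by (simp add: set_integral_m_shift)
    next
      show "u (\<tau> h) = u (t' + 0)" using \<tau>[of h] h0 t hp by (intro s_eq_imp_u_eq) auto
      show "set_integrable lborel {0..T} (\<lambda>r. m (t' + r))" for T
        by (rule set_integrable_m_shift[OF t'0]) simp
    qed
  next
    show "AE r in lborel. 0 < r \<longrightarrow> \<phi> (?v r) \<le> ereal (?\<Psi> r)"
    proof (intro AE_I2 impI)
      fix r :: real assume r: "0 < r"
      show "\<phi> (?v r) \<le> ereal (?\<Psi> r)"
      proof (cases "r \<le> h")
        case True
        then have "\<phi> (u (\<tau> r)) \<le> \<phi> (u t)" using \<tau>[of r] r t by (intro phi_u_antimono) auto
        then show ?thesis using True phi_u_finite[OF t(1)] by (simp add: splice_def)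
      next
        case False
        then show ?thesis using phi_u_finite[of "t' + (r - h)"] t by (simp add: splice_def)
      qed
    qed
  qed measurable
  also have "\<dots> = (\<integral>r. indicator {..h} r * (\<epsilon> / 2 * p\<^sup>2 + \<Phi> t) \<partial>\<mu>) + exp (- h / \<epsilon>) * G t'"
    unfolding E G_def using shift_integrable[OF e_integrable t'0] by (intro splice_wed_integral(2)[OF eps h0]) auto
  also have "(\<integral>r. indicator {..h} r * (\<epsilon> / 2 * p\<^sup>2 + \<Phi> t) \<partial>\<mu>) = measure \<mu> {..h} * (\<epsilon> / 2 * p\<^sup>2 + \<Phi> t)"
    by simp
  also have "measure \<mu> {..h} = 1 - exp (- h / \<epsilon>)"
  proof -
    have "{..h} = space \<mu> - {h<..}" by auto
    then have "measure \<mu> {..h} = measure \<mu> (space \<mu>) - measure \<mu> {h<..}"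
      by (simp only:) (rule finite_measure_compl, simp)
    then show ?thesis by (simp add: measure_wed_measure_UNIV[OF eps] measure_wed_measure_tail[OF eps h0])
  qed
  finally show ?thesis .
qed


lemma G_formula:
  obtains K where "\<And>t. K t = (LINT r:{..t}|lborel. exp_weight \<epsilon> r * e r)"
    "\<And>t. 0 \<le> t \<Longrightarrow> G t = exp (t / \<epsilon>) * (integral\<^sup>L \<mu> e - K t)"
    "integrable lborel (\<lambda>r. exp_weight \<epsilon> r * e r)"
proof -
  define K where "K t = (LINT r:{..t}|lborel. exp_weight \<epsilon> r * e r)" for t
  have "G t = exp (t / \<epsilon>) * (integral\<^sup>L \<mu> e - K t)" if "0 \<le> t" for t
  proof -
    have "(\<integral>r. indicator {..t} r * e r \<partial>\<mu>) = (LINT r|lborel. exp_weight \<epsilon> r * (indicator {..t} r * e r))"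
      by (rule integral_wed_measure[OF eps]) measurable
    also have "\<dots> = K t"
      unfolding K_def set_lebesgue_integral_def by (intro Bochner_Integration.integral_cong) auto
    finally have "exp (t / \<epsilon>) * (integral\<^sup>L \<mu> e - K t) = exp (t / \<epsilon>) * (exp (- t / \<epsilon>) * G t)"
      using e_split[OF that] by simp
    also have "\<dots> = G t" by (simp add: mult.assoc[symmetric] exp_add[symmetric])
    finally show ?thesis by simp
  qed
  moreover have "integrable lborel (\<lambda>r. exp_weight \<epsilon> r * e r)"
    using e_integrable by (subst (asm) integrable_wed_measure[OF eps]) auto
  ultimately show thesis using that[of K] K_def by blast
qed

lemma G_deriv_of_K_deriv:
  assumes "\<And>t. 0 \<le> t \<Longrightarrow> G t = exp (t / \<epsilon>) * (E0 - K t)"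
    and K: "(K has_real_derivative exp_weight \<epsilon> t * E) (at t)" and t: "0 < t"
  shows "(G has_real_derivative (G t - E) / \<epsilon>) (at t)"
proof -
  have "((\<lambda>t. exp (t / \<epsilon>) * (E0 - K t)) has_real_derivative
      exp (t / \<epsilon>) * (1 / \<epsilon>) * (E0 - K t) + exp (t / \<epsilon>) * (0 - exp_weight \<epsilon> t * E)) (at t)"
  proof -
    have "((\<lambda>t. exp (t / \<epsilon>)) has_real_derivative exp (t / \<epsilon>) * (1 / \<epsilon>)) (at t)"
      using eps by (auto intro!: derivative_eq_intros)
    from DERIV_mult[OF this DERIV_diff[OF DERIV_const K, of E0]] show ?thesis
      by (rule DERIV_cong) (simp add: algebra_simps)
  qed
  also have "exp (t / \<epsilon>) * (1 / \<epsilon>) * (E0 - K t) + exp (t / \<epsilon>) * (0 - exp_weight \<epsilon> t * E) = (G t - E) / \<epsilon>"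
  proof -
    have "exp (t / \<epsilon>) * exp_weight \<epsilon> t = 1 / \<epsilon>"
      using t by (simp add: exp_weight_def exp_add[symmetric])
    then have "exp (t / \<epsilon>) * (exp_weight \<epsilon> t * E) = E / \<epsilon>" by (simp add: mult.assoc[symmetric])
    then show ?thesis using assms(1)[of t] t by (simp add: diff_divide_distrib)
  qed
  finally show ?thesis
    by (rule has_field_derivative_transform_within_open[of _ _ _ "{0<..}"]) (use t assms(1) in auto)
qed

lemma derivatives_AE:
  "AE t in lborel. 0 < t \<longrightarrow> (s has_real_derivative m t) (at t) \<and> (G has_real_derivative (G t - e t) / \<epsilon>) (at t)"
proof -
  have 1: "AE t in lborel. 0 < t \<longrightarrow> (s has_real_derivative m t) (at t)"
  proof (rule AE_all_horizons)
    fix n :: nat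
    let ?T = "real (Suc n)"
    have i: "integrable lborel (\<lambda>r. indicator {0..?T} r * m r)"
      using m_integrable[of ?T] by (simp add: set_integrable_def)
    show "AE t in lborel. 0 < t \<and> t < ?T \<longrightarrow> (s has_real_derivative m t) (at t)"
      using Lebesgue_differentiation[OF i]
    proof eventually_elim
      case (elim t)
      show ?case
      proof
        assume t: "0 < t \<and> t < ?T"
        have eq: "(LINT r:{..x}|lborel. indicator {0..?T} r * m r) = s x" if "x \<in> {0<..<?T}" for x
          unfolding s_def set_lebesgue_integral_def using that
          by (intro Bochner_Integration.integral_cong) (auto split: split_indicator)
        show "(s has_real_derivative m t) (at t)"
          by (rule has_field_derivative_transform_within_open[of "\<lambda>x. LINT r:{..x}|lborel. indicator {0..?T} r * m r" _ _ "{0<..<?T}"])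
             (use elim t eq in \<open>auto simp: indicator_def\<close>)
      qed
    qed
  qed
  obtain K where K: "\<And>t. K t = (LINT r:{..t}|lborel. exp_weight \<epsilon> r * e r)"
    "\<And>t. 0 \<le> t \<Longrightarrow> G t = exp (t / \<epsilon>) * (integral\<^sup>L \<mu> e - K t)"
    "integrable lborel (\<lambda>r. exp_weight \<epsilon> r * e r)" using G_formula by blast
  have "K = (\<lambda>t. LINT r:{..t}|lborel. exp_weight \<epsilon> r * e r)" using K(1) by blast
  then have "AE t in lborel. (K has_real_derivative exp_weight \<epsilon> t * e t) (at t)"
    using Lebesgue_differentiation[OF K(3)] by simp
  with 1 show ?thesis
    by eventually_elim (auto intro: G_deriv_of_K_deriv[OF K(2)])
qed

text \<open>Comparing with all constant speeds pins down the difference between potential and value.\<close>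

lemma speed_optimal:
  fixes \<kappa> M :: real
  assumes "0 \<le> M" "0 \<le> \<kappa>" and opt: "\<And>p. 0 < p \<Longrightarrow> \<kappa> + M\<^sup>2 \<le> M * (p + \<kappa> / p)"
  shows "\<kappa> = M\<^sup>2"
proof (cases "\<kappa> = 0")
  case True
  show ?thesis
  proof (rule ccontr)
    assume "\<not> ?thesis"
    then have "0 < M" using True assms(1) by (cases "M = 0") auto
    then have "M * M \<le> M * (M / 2)" using opt[of "M / 2"] True by (simp add: power2_eq_square)
    then show False using \<open>0 < M\<close> by simp
  qed
next
  case False
  define p where "p = sqrt \<kappa>"
  have p: "0 < p" "p\<^sup>2 = \<kappa>" using False assms(2) by (auto simp: p_def)
  then have "\<kappa> / p = p" by (simp add: power2_eq_square nonzero_divide_eq_eq)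
  then have "p\<^sup>2 + M\<^sup>2 \<le> M * (p + p)" using opt[OF p(1)] p by simp
  then have "(M - p)\<^sup>2 \<le> 0" by (simp add: power2_diff algebra_simps)
  then show ?thesis using p by simp
qed

lemma energy_identity_at:
  assumes t: "0 < t" and ds: "(s has_real_derivative m t) (at t)" and dG: "(G has_real_derivative (G t - e t) / \<epsilon>) (at t)"
  shows "\<Phi> t - G t = \<epsilon> / 2 * (m t)\<^sup>2" "(G t - e t) / \<epsilon> = - (m t)\<^sup>2"
proof -
  define \<kappa> where "\<kappa> = 2 * (\<Phi> t - G t) / \<epsilon>"
  have \<kappa>: "\<Phi> t - G t = \<epsilon> / 2 * \<kappa>" using eps by (simp add: \<kappa>_def)
  have "0 \<le> \<kappa>" using G_le_Phi[OF t] eps by (simp add: \<kappa>_def)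
  have "\<kappa> + (m t)\<^sup>2 \<le> m t * (p + \<kappa> / p)" if p: "0 < p" for p
  proof -
    define c where "c = \<epsilon> / 2 * p\<^sup>2 + \<Phi> t"
    define w where "w = - 1 / (p * \<epsilon>)"
    define R where "R k = (1 - exp ((s k - s t) * w)) * c + exp ((s k - s t) * w) * G k" for k
    have "(R has_real_derivative m t / (p * \<epsilon>) * c - m t / (p * \<epsilon>) * G t + (G t - e t) / \<epsilon>) (at t)"
    proof -
      have de: "((\<lambda>k. exp ((s k - s t) * w)) has_real_derivative m t * w) (at t)"
        using ds by (auto intro!: derivative_eq_intros)
      from DERIV_add[OF DERIV_cmult_right[OF DERIV_diff[OF DERIV_const de], of 1 c] DERIV_mult[OF de dG]]
      show ?thesis unfolding R_def[abs_def] by (rule DERIV_cong) (simp add: w_def)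
    qed
    moreover have Rk: "R t \<le> R k" if "t < k" "k < t + 1" for k
      using G_le_constant_speed[OF t _ p refl, of k] that by (simp add: R_def c_def w_def)
    ultimately have "0 \<le> m t / (p * \<epsilon>) * c - m t / (p * \<epsilon>) * G t + (G t - e t) / \<epsilon>"
      using DERIV_nonneg_of_right_min[of R _ t "t + 1"] by force
    also have "m t / (p * \<epsilon>) * c - m t / (p * \<epsilon>) * G t + (G t - e t) / \<epsilon> = m t / (p * \<epsilon>) * (\<epsilon> / 2 * p\<^sup>2 + \<epsilon> / 2 * \<kappa>) - (\<kappa> + (m t)\<^sup>2) / 2"
    proof -
      have c1: "c - G t = \<epsilon> / 2 * p\<^sup>2 + \<epsilon> / 2 * \<kappa>" using \<kappa> by (simp add: c_def)
      have c2: "(G t - e t) / \<epsilon> = - (\<kappa> + (m t)\<^sup>2) / 2"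
      proof -
        have "G t - e t = - (\<epsilon> / 2 * \<kappa>) - \<epsilon> / 2 * (m t)\<^sup>2" using \<kappa> by (simp add: e_def)
        then show ?thesis using eps by (simp add: field_simps)
      qed
      have c3: "q * c - q * G t = q * (c - G t)" for q by (simp add: right_diff_distrib)
      show ?thesis unfolding c3 c1 c2 by linarith
    qed
    also have "\<dots> = (m t * (p + \<kappa> / p) - (\<kappa> + (m t)\<^sup>2)) / 2"
      using p eps by (simp add: field_simps power2_eq_square)
    finally show ?thesis by simp
  qed
  then have "\<kappa> = (m t)\<^sup>2" by (rule speed_optimal[OF speed_nonneg \<open>0 \<le> \<kappa>\<close>])
  then show 1: "\<Phi> t - G t = \<epsilon> / 2 * (m t)\<^sup>2" using \<kappa> by simp
  have "G t - e t = - \<epsilon> * (m t)\<^sup>2" using 1 by (simp add: e_def)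
  then show "(G t - e t) / \<epsilon> = - (m t)\<^sup>2" using eps by simp
qed

definition good :: "real \<Rightarrow> bool" where
  "good t \<longleftrightarrow> 0 < t \<and> (s has_real_derivative m t) (at t) \<and> (G has_real_derivative - (m t)\<^sup>2) (at t) \<and> \<Phi> t - G t = \<epsilon> / 2 * (m t)\<^sup>2"

lemma good_AE: "AE t in lborel. 0 < t \<longrightarrow> good t"
  using derivatives_AE
proof eventually_elim
  case (elim t)
  then show ?case using energy_identity_at[of t] unfolding good_def by metis
qed

lemma G_chord:
  assumes "0 < t1" "t1 \<le> t" "t \<le> t2"
  shows "(G t - G t1) * (s t2 - s t1) \<le> (G t2 - G t1) * (s t - s t1)"
proof (cases "s t1 = s t2")
  case True
  then have "s t = s t1" using s_mono[of t1 t] s_mono[of t t2] assms by auto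
  then show ?thesis using True by simp
next
  case False
  then have st: "0 < s t2 - s t1" using s_mono[of t1 t2] assms by simp
  define x where "x = (s t - s t1) / (s t2 - s t1)"
  have x: "0 \<le> x" "x \<le> 1" using s_mono[of t1 t] s_mono[of t t2] assms st by (auto simp: x_def)
  have xx: "x * (s t2 - s t1) = s t - s t1" using st by (simp add: x_def)
  then have "s t = (1 - x) * s t1 + x * s t2" by (simp add: algebra_simps)
  then have "G t \<le> (1 - x) * G t1 + x * G t2"
    using assms x by (intro G_convex_in_s) auto
  then have "G t - G t1 \<le> x * (G t2 - G t1)" by (simp add: algebra_simps)
  then have "(G t - G t1) * (s t2 - s t1) \<le> x * (G t2 - G t1) * (s t2 - s t1)"
    using st by (intro mult_right_mono) auto
  also have "\<dots> = (G t2 - G t1) * (s t - s t1)" using xx by (metis mult.assoc mult.commute)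
  finally show ?thesis .
qed

text \<open>Where \<open>m > 0\<close>, the slope of \<open>G\<close> as a convex function of \<open>s\<close> is \<open>- (m t)\<^sup>2 / m t = - m t\<close>. A vanishing
  \<open>m t1\<close> has to be treated separately, by comparison with a curve leaving \<open>u t1\<close> at speed \<open>m t2\<close>.\<close>

lemma m_antimono_good:
  assumes g: "good t1" "good t2" and t: "t1 < t2"
  shows "m t2 \<le> m t1"
proof (rule ccontr)
  assume "\<not> ?thesis"
  then have m12: "m t1 < m t2" by simp
  then have m2: "0 < m t2" using speed_nonneg[of u t1] by linarith
  have t1: "0 < t1" using g by (simp add: good_def)
  define DG where "DG = G t2 - G t1"
  define DS where "DS = s t2 - s t1"
  define f where "f k = DG * (s k - s t1) - (G k - G t1) * DS" for k
  have fd: "(f has_real_derivative DG * m t + (m t)\<^sup>2 * DS) (at t)" if "good t" for t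
  proof -
    have d: "(s has_real_derivative m t) (at t)" "(G has_real_derivative - (m t)\<^sup>2) (at t)" using that by (auto simp: good_def)
    show ?thesis unfolding f_def[abs_def] by (rule derivative_eq_intros d refl)+ simp
  qed
  have f0: "0 \<le> f k" if "t1 \<le> k" "k \<le> t2" for k
    using G_chord[OF t1 that] by (simp add: f_def DG_def DS_def)
  have f12: "f t1 = 0" "f t2 = 0" by (auto simp: f_def DG_def DS_def)
  have A: "0 \<le> DG * m t1 + (m t1)\<^sup>2 * DS"
    by (rule DERIV_nonneg_of_right_min[OF fd[OF g(1)] t]) (use f0 f12 in auto)
  have B: "DG * m t2 + (m t2)\<^sup>2 * DS \<le> 0"
    by (rule DERIV_nonpos_of_left_min[OF fd[OF g(2)] t]) (use f0 f12 in auto)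
  have "(DG + m t2 * DS) * m t2 \<le> 0" using B by (simp add: power2_eq_square algebra_simps)
  then have B': "DG \<le> - m t2 * DS" using m2 by (simp add: mult_le_0_iff)
  have DS0: "0 \<le> DS" using s_mono[of t1 t2] t t1 by (simp add: DS_def)
  have DS: "0 < DS"
  proof (rule ccontr)
    assume "\<not> 0 < DS"
    then have "s t1 = s t2" using DS0 by (simp add: DS_def)
    then have const: "s k = s t2" if "t1 < k" "k < t2" for k
      using s_mono[of t1 k] s_mono[of k t2] that t1 by auto
    have d: "((\<lambda>k. - s k) has_real_derivative - m t2) (at t2)" "(s has_real_derivative m t2) (at t2)"
      using g(2) by (auto simp: good_def intro!: derivative_eq_intros)
    have "m t2 \<le> 0" by (rule DERIV_nonpos_of_left_min[OF d(2) t]) (use const in auto)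
    then show False using m2 by simp
  qed
  show False
  proof (cases "m t1 = 0")
    case False
    then have m1: "0 < m t1" using speed_nonneg[of u t1] by linarith
    have "0 \<le> (DG + m t1 * DS) * m t1" using A by (simp add: power2_eq_square algebra_simps)
    then have "- m t1 * DS \<le> DG" using m1 by (simp add: zero_le_mult_iff)
    then have "m t2 * DS \<le> m t1 * DS" using B' by simp
    then show False using DS m12 by simp
  next
    case True
    define p where "p = m t2"
    define h where "h = min (DS / p) (\<epsilon> / 4)"
    have p: "0 < p" using m2 by (simp add: p_def)
    have h: "0 < h" "h \<le> DS / p" "h \<le> \<epsilon> / 4"
      unfolding h_def by (simp add: DS p eps) (rule min.cobounded1, rule min.cobounded2)
    have "p * h \<le> DS" using h p by (simp add: pos_le_divide_eq mult.commute)
    then obtain t' where t': "t1 \<le> t'" "t' \<le> t2" "s t' = s t1 + p * h"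
      using s_IVT[of t1 t2 "s t1 + p * h"] t t1 p h by (auto simp: DS_def)
    have hh: "h = (s t' - s t1) / p" using t' p by simp
    have "\<Phi> t1 = G t1" using g(1) True by (simp add: good_def)
    with G_le_constant_speed[OF t1 t'(1) p hh]
    have 1: "G t1 \<le> (1 - exp (- h / \<epsilon>)) * (\<epsilon> / 2 * p\<^sup>2 + G t1) + exp (- h / \<epsilon>) * G t'" by simp
    have "(G t' - G t1) * DS \<le> DG * (p * h)"
      using G_chord[OF t1 t'(1,2)] t'(3) by (simp add: DG_def DS_def)
    also have "\<dots> \<le> (- p * DS) * (p * h)" using B' p h by (intro mult_right_mono) (auto simp: p_def)
    finally have "(G t' - G t1) * DS \<le> (- p * (p * h)) * DS" by (simp add: mult_ac)
    then have 2: "G t' - G t1 \<le> - p * (p * h)" using DS by (rule mult_right_le_imp_le)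
    have "exp (- h / \<epsilon>) * (G t1 - G t') \<le> (1 - exp (- h / \<epsilon>)) * (\<epsilon> / 2 * p\<^sup>2)"
    proof -
      have "x * (A - A') \<le> (1 - x) * Y" if "A \<le> (1 - x) * (Y + A) + x * A'" for x A A' Y :: real
        using that by (simp add: algebra_simps)
      from this[OF 1] show ?thesis .
    qed
    moreover have "exp (- h / \<epsilon>) * (p * (p * h)) \<le> exp (- h / \<epsilon>) * (G t1 - G t')"
      using 2 by (intro mult_left_mono) auto
    moreover have ex: "1 - h / \<epsilon> \<le> exp (- h / \<epsilon>)" using exp_ge_add_one_self[of "- h / \<epsilon>"] by simp
    moreover have "(1 - exp (- h / \<epsilon>)) * (\<epsilon> / 2 * p\<^sup>2) \<le> (h / \<epsilon>) * (\<epsilon> / 2 * p\<^sup>2)"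
      using ex eps by (intro mult_right_mono) auto
    ultimately have "exp (- h / \<epsilon>) * (p * (p * h)) \<le> (h / \<epsilon>) * (\<epsilon> / 2 * p\<^sup>2)" by linarith
    also have "\<dots> = 1 / 2 * (p * (p * h))" using eps by (simp add: power2_eq_square)
    finally have "exp (- h / \<epsilon>) \<le> 1 / 2" by (rule mult_right_le_imp_le) (use p h(1) in auto)
    moreover have "h / \<epsilon> \<le> 1 / 4" using h eps by (simp add: field_simps)
    ultimately show False using ex by linarith
  qed
qed

end

section \<open>Regularity in time\<close>

lemma DERIV_of_AE_eq_continuous:
  fixes F f h :: "real \<Rightarrow> real"
  assumes F: "\<And>a b. 0 < a \<Longrightarrow> a \<le> b \<Longrightarrow> F b - F a = (LINT r:{a..b}|lborel. f r)"
    and f[measurable]: "f \<in> borel_measurable borel" and fh: "AE r in lborel. 0 < r \<longrightarrow> f r = h r"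
    and h: "continuous_on {0<..} h" and t: "0 < t"
  shows "(F has_real_derivative h t) (at t)"
proof -
  let ?a = "t / 2" and ?b = "2 * t"
  have hc: "continuous_on {?a..y} h" for y by (rule continuous_on_subset[OF h]) (use t in auto)
  have hi: "set_integrable lborel {?a..y} h" for y
    by (rule borel_integrable_atLeastAtMost'[OF hc])
  have eq: "F y = F ?a + integral {?a..y} h" if "y \<in> {?a..?b}" for y
  proof -
    have "F y - F ?a = (LINT r:{?a..y}|lborel. f r)" using F[of ?a y] t that by simp
    also have "\<dots> = (LINT r|lborel. indicator {?a..y} r *\<^sub>R h r)"
      unfolding set_lebesgue_integral_def
    proof (rule integral_cong_AE)
      show "AE r in lborel. indicator {?a..y} r *\<^sub>R f r = indicator {?a..y} r *\<^sub>R h r"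
        using fh by eventually_elim (use t in \<open>auto simp: indicator_def\<close>)
      show "(\<lambda>r. indicator {?a..y} r *\<^sub>R h r) \<in> borel_measurable lborel"
        using hi[of y] unfolding set_integrable_def by (rule borel_measurable_integrable)
    qed measurable
    also have "\<dots> = integral {?a..y} h"
      using set_borel_integral_eq_integral(2)[OF hi[of y]] by (simp add: set_lebesgue_integral_def)
    finally show ?thesis by simp
  qed
  have "((\<lambda>y. integral {?a..y} h) has_real_derivative h t) (at t within {?a..?b})"
    by (rule integral_has_real_derivative[OF hc]) (use t in auto)
  then have "((\<lambda>y. F ?a + integral {?a..y} h) has_real_derivative h t) (at t within {?a..?b})"
    by (auto intro!: derivative_eq_intros)
  then have "((\<lambda>y. F ?a + integral {?a..y} h) has_real_derivative h t) (at t)"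
    using t by (subst (asm) at_within_interior) auto
  then show ?thesis
  proof (rule has_field_derivative_transform_within_open[of _ _ _ "{?a<..<?b}"])
    fix y assume "y \<in> {?a<..<?b}"
    then have "y \<in> {?a..?b}" by auto
    from eq[OF this] show "F ?a + integral {?a..y} h = F y" by (rule sym)
  qed (use t in auto)
qed

context wed_minimizer
begin

lemma s_concave:
  assumes ab: "0 \<le> a" "a \<le> b" and x: "0 \<le> x" "x \<le> 1"
  shows "(1 - x) * s a + x * s b \<le> s ((1 - x) * a + x * b)"
proof (cases "x = 0 \<or> x = 1 \<or> a = b")
  case True
  then show ?thesis by (auto simp: algebra_simps)
next
  case False
  then have x: "0 < x" "x < 1" and "a < b" using x ab by auto
  define c where "c = (1 - x) * a + x * b"
  have ca: "c - a = x * (b - a)" and bc: "b - c = (1 - x) * (b - a)" by (simp_all add: c_def algebra_simps)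
  have "0 < c - a" "0 < b - c" unfolding ca bc using x \<open>a < b\<close> by auto
  then have c: "a < c" "c < b" by auto
  have g: "AE r in lborel. 0 < r \<longrightarrow> good r" by (rule good_AE)
  define S where "S = {r. a < r \<and> r < c \<and> good r}"
  obtain r0 where "a < r0" "r0 < c" "0 < r0 \<longrightarrow> good r0" using AE_ex_in_interval[OF g c(1)] by blast
  then have S0: "S \<noteq> {}" using ab by (auto simp: S_def)
  define \<alpha> where "\<alpha> = Inf (m ` S)"
  have bd: "bdd_below (m ` S)" by (rule bdd_belowI[of _ 0]) (auto simp: speed_nonneg)
  have lo: "\<alpha> \<le> m r" if "r \<in> S" for r unfolding \<alpha>_def using that bd by (intro cInf_lower) auto
  have hi: "m r \<le> \<alpha>" if "c < r" "good r" for r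
    unfolding \<alpha>_def
  proof (rule cInf_greatest)
    fix y assume "y \<in> m ` S"
    then obtain q where "q \<in> S" "y = m q" by auto
    then show "m r \<le> y" using m_antimono_good[of q r] that by (auto simp: S_def)
  qed (use S0 in auto)
  have "\<alpha> * (c - a) \<le> s c - s a"
  proof -
    have "\<alpha> * (c - a) = (LINT r:{a..c}|lborel. \<alpha>)" using c by (simp add: set_lebesgue_integral_def)
    also have "\<dots> \<le> (LINT r:{a..c}|lborel. m r)"
    proof (rule set_integral_mono_AE[OF set_integrable_const_interval(2) m_integrable_Icc[OF ab(1)]])
      show "AE r\<in>{a..c} in lborel. \<alpha> \<le> m r"
        using g AE_lborel_singleton[of a] AE_lborel_singleton[of c]
        by eventually_elim (use ab lo in \<open>auto simp: S_def\<close>)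
    qed
    also have "\<dots> = s c - s a" using s_diff[of a c] ab c by simp
    finally show ?thesis .
  qed
  moreover have "s b - s c \<le> \<alpha> * (b - c)"
  proof -
    have "s b - s c = (LINT r:{c..b}|lborel. m r)" using s_diff[of c b] ab c by simp
    also have "\<dots> \<le> (LINT r:{c..b}|lborel. \<alpha>)"
    proof (rule set_integral_mono_AE[OF m_integrable_Icc set_integrable_const_interval(2)])
      show "AE r\<in>{c..b} in lborel. m r \<le> \<alpha>"
        using g AE_lborel_singleton[of c] by eventually_elim (use ab c hi in auto)
    qed (use ab c in auto)
    also have "\<dots> = \<alpha> * (b - c)" using c by (simp add: set_lebesgue_integral_def)
    finally show ?thesis .
  qed
  ultimately have "(1 - x) * (\<alpha> * (c - a)) \<le> (1 - x) * (s c - s a)" "x * (s b - s c) \<le> x * (\<alpha> * (b - c))"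
    using x by (auto intro!: mult_left_mono)
  moreover have "(1 - x) * (\<alpha> * (c - a)) = x * (\<alpha> * (b - c))" by (simp add: ca bc)
  ultimately have "x * (s b - s c) \<le> (1 - x) * (s c - s a)" by linarith
  then show ?thesis unfolding c_def[symmetric] by (simp add: algebra_simps)
qed

lemma phi_u_le_of_s_le:
  assumes "0 \<le> a" "0 \<le> b" "s a \<le> s b"
  shows "\<phi> (u b) \<le> \<phi> (u a)"
proof (cases "a \<le> b")
  case False
  then have "s a = s b" using s_mono[of b a] assms by auto
  then show ?thesis using s_eq_imp_u_eq[of a b] assms by simp
qed (use phi_u_antimono assms in auto)

lemma phi_u_convex_finite:
  assumes ab: "0 \<le> a" "a \<le> b" and x: "0 \<le> x" "x \<le> 1" and fin: "\<phi> (u a) = ereal A" "\<phi> (u b) = ereal B'"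
  shows "\<phi> (u ((1 - x) * a + x * b)) \<le> ereal ((1 - x) * A + x * B')"
proof -
  let ?y = "(1 - x) * s a + x * s b"
  have sab: "s a \<le> s b" by (rule s_mono[OF ab])
  have y: "?y = s a + x * (s b - s a)" by (simp add: algebra_simps)
  have "0 \<le> x * (s b - s a)" using x sab by simp
  moreover have "x * (s b - s a) \<le> s b - s a" using x sab by (intro mult_left_le_one_le) auto
  ultimately have "s a \<le> ?y" "?y \<le> s b" unfolding y by auto
  from s_IVT[OF ab this] obtain \<tau> where \<tau>: "a \<le> \<tau>" "\<tau> \<le> b" "s \<tau> = ?y" by blast
  have "0 \<le> (1 - x) * a + x * b" using ab x by auto
  then have "\<phi> (u ((1 - x) * a + x * b)) \<le> \<phi> (u \<tau>)"
    using s_concave[OF ab x] \<tau> ab by (intro phi_u_le_of_s_le) auto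
  also have "\<dots> \<le> ereal ((1 - x) * A + x * B')"
    using chord_le'[OF ab _ fin x \<tau>(3)] \<tau> ab by auto
  finally show ?thesis .
qed

lemma phi_u_convex: "ereal_convex_on {0..} (\<lambda>t. \<phi> (u t))"
proof -
  have *: "\<phi> (u ((1 - x) * a + x * b)) \<le> ereal (1 - x) * \<phi> (u a) + ereal x * \<phi> (u b)"
    if ab: "0 \<le> a" "a \<le> b" and x: "0 \<le> x" "x \<le> 1" for a b x
  proof (cases "x = 0 \<or> x = 1 \<or> a = b")
    case True
    then show ?thesis
    proof (elim disjE)
      assume "a = b"
      then have "ereal (1 - x) * \<phi> (u a) + ereal x * \<phi> (u b) = \<phi> (u a)" "(1 - x) * a + x * b = a"
        using x phi_not_MInfty[of "u a"]
        by (cases "\<phi> (u a)"; cases "x = 0"; cases "x = 1"; auto simp: algebra_simps)+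
      then show ?thesis by simp
    qed (auto simp: zero_ereal_def[symmetric] one_ereal_def[symmetric])
  next
    case False
    then have xx: "0 < x" "x < 1" and "0 < b" using x ab by auto
    have fb: "\<phi> (u b) = ereal (\<Phi> b)" by (rule phi_u_finite[OF \<open>0 < b\<close>])
    show ?thesis
    proof (cases "\<phi> (u a)")
      case (real A)
      then show ?thesis using phi_u_convex_finite[OF ab x real fb] fb by simp
    qed (use phi_not_MInfty xx fb in auto)
  qed
  show ?thesis
    unfolding ereal_convex_on_def
  proof (intro ballI)
    fix a b x :: real assume "a \<in> {0..}" "b \<in> {0..}" "x \<in> {0..1}"
    then show "\<phi> (u ((1 - x) * a + x * b)) \<le> ereal (1 - x) * \<phi> (u a) + ereal x * \<phi> (u b)"
      using *[of a b x] *[of b a "1 - x"] by (cases "a \<le> b") (auto simp: add.commute)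
  qed
qed

lemma Phi_convex: "convex_on {0<..} \<Phi>"
proof (rule convex_onI)
  fix x a b :: real assume x: "0 < x" "x < 1" and ab: "a \<in> {0<..}" "b \<in> {0<..}"
  then have "0 < (1 - x) * a + x * b" by (auto intro!: add_pos_pos)
  moreover have "\<phi> (u ((1 - x) * a + x * b)) \<le> ereal (1 - x) * \<phi> (u a) + ereal x * \<phi> (u b)"
    using phi_u_convex x ab unfolding ereal_convex_on_def by auto
  ultimately show "\<Phi> ((1 - x) *\<^sub>R a + x *\<^sub>R b) \<le> (1 - x) * \<Phi> a + x * \<Phi> b"
    using ab by (simp add: phi_u_finite)
qed simp

lemma Phi_continuous: "continuous_on {0<..} \<Phi>"
  by (rule convex_on_continuous[OF _ Phi_convex]) simp

lemma G_continuous: "continuous_on {0<..} G"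
proof -
  obtain K where K: "\<And>t. K t = (LINT r:{..t}|lborel. exp_weight \<epsilon> r * e r)"
    "\<And>t. 0 \<le> t \<Longrightarrow> G t = exp (t / \<epsilon>) * (integral\<^sup>L \<mu> e - K t)"
    "integrable lborel (\<lambda>r. exp_weight \<epsilon> r * e r)" using G_formula by blast
  have "K = (\<lambda>t. LINT r:{..t}|lborel. exp_weight \<epsilon> r * e r)" using K(1) by blast
  then have "isCont K t" for t using continuous_indefinite_integral[OF K(3)] by simp
  then have "continuous_on {0<..} (\<lambda>t. exp (t / \<epsilon>) * (integral\<^sup>L \<mu> e - K t))"
    using eps by (intro continuous_intros continuous_at_imp_continuous_on) auto
  then show ?thesis by (rule continuous_on_eq) (use K(2) in auto)
qed

definition v :: "real \<Rightarrow> real" where "v t = sqrt (2 * (\<Phi> t - G t) / \<epsilon>)"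

lemma v_continuous: "continuous_on {0<..} v"
  unfolding v_def[abs_def] using eps by (intro continuous_intros Phi_continuous G_continuous) auto

lemma v_nonneg: "0 < t \<Longrightarrow> 0 \<le> v t"
  using G_le_Phi[of t] eps by (simp add: v_def)

lemma v_square: "0 < t \<Longrightarrow> (v t)\<^sup>2 = 2 * (\<Phi> t - G t) / \<epsilon>"
  using G_le_Phi[of t] eps by (simp add: v_def)

lemma good_v: "good t \<Longrightarrow> m t = v t"
proof -
  assume "good t"
  then have "\<Phi> t - G t = \<epsilon> / 2 * (m t)\<^sup>2" by (simp add: good_def)
  then have "2 * (\<Phi> t - G t) / \<epsilon> = (m t)\<^sup>2" using eps by (simp only:) simp
  then show ?thesis unfolding v_def by (simp only:) (simp add: speed_nonneg)
qed

lemma v_AE: "AE t in lborel. 0 < t \<longrightarrow> m t = v t"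
  using good_AE by eventually_elim (auto intro: good_v)

lemma v_antimono:
  assumes "0 < a" "a \<le> b"
  shows "v b \<le> v a"
proof (rule ccontr)
  assume "\<not> ?thesis"
  then have less: "v a < v b" and "a < b" using assms by (cases "a = b", auto)+
  define c where "c = (v a + v b) / 2"
  have c: "v a < c" "c < v b" using less by (auto simp: c_def)
  have cont: "isCont v t" if "0 < t" for t
    using v_continuous that by (simp add: continuous_on_eq_continuous_at)
  have "\<forall>\<^sub>F t in at a. v t < c"
    using order_tendstoD(2)[OF _ c(1), of v "at a"] cont[of a] assms by (simp add: isCont_def)
  then obtain d1 where d1: "d1 > 0" "\<And>t. t \<noteq> a \<Longrightarrow> dist t a < d1 \<Longrightarrow> v t < c"
    unfolding eventually_at by auto
  have "\<forall>\<^sub>F t in at b. c < v t"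
    using order_tendstoD(1)[OF _ c(2), of v "at b"] cont[of b] assms by (simp add: isCont_def)
  then obtain d2 where d2: "d2 > 0" "\<And>t. t \<noteq> b \<Longrightarrow> dist t b < d2 \<Longrightarrow> c < v t"
    unfolding eventually_at by auto
  obtain a' where a': "a < a'" "a' < min b (a + d1)" "0 < a' \<longrightarrow> good a'"
    using AE_ex_in_interval[OF good_AE, of a "min b (a + d1)"] \<open>a < b\<close> d1 by auto
  obtain b' where b': "b < b'" "b' < b + d2" "0 < b' \<longrightarrow> good b'"
    using AE_ex_in_interval[OF good_AE, of b "b + d2"] d2 by auto
  have "m b' \<le> m a'" using m_antimono_good[of a' b'] a' b' assms by auto
  moreover have "m a' = v a'" "m b' = v b'" using a' b' assms by (auto intro!: good_v)
  moreover have "v a' < c" using d1(2)[of a'] a' by (auto simp: dist_real_def)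
  moreover have "c < v b'" using d2(2)[of b'] b' by (auto simp: dist_real_def)
  ultimately show False by linarith
qed

lemma s_deriv: "0 < t \<Longrightarrow> (s has_real_derivative v t) (at t)"
  by (rule DERIV_of_AE_eq_continuous[OF _ m_measurable v_AE v_continuous]) (auto simp: s_diff)

lemma G_deriv: "0 < t \<Longrightarrow> (G has_real_derivative - (v t)\<^sup>2) (at t)"
proof -
  assume t: "0 < t"
  obtain K where K: "\<And>t. K t = (LINT r:{..t}|lborel. exp_weight \<epsilon> r * e r)"
    "\<And>t. 0 \<le> t \<Longrightarrow> G t = exp (t / \<epsilon>) * (integral\<^sup>L \<mu> e - K t)"
    "integrable lborel (\<lambda>r. exp_weight \<epsilon> r * e r)" using G_formula by blast
  have AE: "AE r in lborel. 0 < r \<longrightarrow> exp_weight \<epsilon> r * e r = exp_weight \<epsilon> r * (2 * \<Phi> r - G r)"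
    using v_AE
  proof eventually_elim
    case (elim r)
    show ?case
    proof
      assume "0 < r"
      then have "(m r)\<^sup>2 = 2 * (\<Phi> r - G r) / \<epsilon>" using elim v_square by simp
      then have "\<epsilon> / 2 * (m r)\<^sup>2 = \<Phi> r - G r" using eps by simp
      then show "exp_weight \<epsilon> r * e r = exp_weight \<epsilon> r * (2 * \<Phi> r - G r)" by (simp add: e_def)
    qed
  qed
  have "continuous_on {0<..} (\<lambda>r. exp (- r / \<epsilon>) / \<epsilon>)" using eps by (intro continuous_intros) auto
  then have wc: "continuous_on {0<..} (exp_weight \<epsilon>)"
    by (rule continuous_on_eq) (auto simp: exp_weight_def)
  have "(K has_real_derivative exp_weight \<epsilon> t * (2 * \<Phi> t - G t)) (at t)"
  proof (rule DERIV_of_AE_eq_continuous[OF _ _ AE _ t])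
    show "continuous_on {0<..} (\<lambda>r. exp_weight \<epsilon> r * (2 * \<Phi> r - G r))"
      by (intro continuous_intros wc Phi_continuous G_continuous)
    show "K b - K a = (LINT r:{a..b}|lborel. exp_weight \<epsilon> r * e r)" if "a \<le> b" for a b
      unfolding K(1) by (rule set_integral_atMost_diff[OF K(3) that])
  qed measurable
  from G_deriv_of_K_deriv[OF K(2) this t] have "(G has_real_derivative (G t - (2 * \<Phi> t - G t)) / \<epsilon>) (at t)" by simp
  moreover have "(G t - (2 * \<Phi> t - G t)) / \<epsilon> = - (v t)\<^sup>2"
  proof -
    have "G t - (2 * \<Phi> t - G t) = - (2 * (\<Phi> t - G t))" by simp
    then show ?thesis unfolding v_square[OF t] by (simp only: minus_divide_left)
  qed
  ultimately show ?thesis by simp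
qed

lemma G_antimono: "0 < a \<Longrightarrow> a \<le> b \<Longrightarrow> G b \<le> G a"
proof (rule DERIV_nonpos_imp_nonincreasing[of a b G])
  fix r assume "0 < a" "a \<le> r"
  then show "\<exists>y. (G has_real_derivative y) (at r) \<and> y \<le> 0"
    using G_deriv[of r] by (intro exI[of _ "- (v r)\<^sup>2"]) auto
qed

lemma s_increment_le: "0 < a \<Longrightarrow> a \<le> b \<Longrightarrow> s b - s a \<le> v a * (b - a)"
proof -
  assume ab: "0 < a" "a \<le> b"
  have "s b - v a * b \<le> s a - v a * a"
  proof (rule DERIV_nonpos_imp_nonincreasing[of a b "\<lambda>r. s r - v a * r"])
    fix r assume "a \<le> r" "r \<le> b"
    then show "\<exists>y. ((\<lambda>r. s r - v a * r) has_real_derivative y) (at r) \<and> y \<le> 0"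
      using s_deriv[of r] v_antimono[of a r] ab
      by (intro exI[of _ "v r - v a"]) (auto intro!: derivative_eq_intros)
  qed (use ab in auto)
  then show ?thesis by (simp add: algebra_simps)
qed

lemma Phi_slopes:
  assumes "0 < p" "p \<le> q" "q \<le> r"
  shows "(\<Phi> q - \<Phi> p) * (s r - s q) \<le> (\<Phi> r - \<Phi> q) * (s q - s p)"
proof (cases "s p = s r")
  case True
  then have "s q = s p" using s_mono[of p q] s_mono[of q r] assms by auto
  then show ?thesis using True by simp
next
  case False
  then have st: "0 < s r - s p" using s_mono[of p r] assms by simp
  define x where "x = (s q - s p) / (s r - s p)"
  have x: "0 \<le> x" "x \<le> 1" using s_mono[of p q] s_mono[of q r] assms st by (auto simp: x_def)
  have xx: "x * (s r - s p) = s q - s p" using st by (simp add: x_def)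
  then have "s q = (1 - x) * s p + x * s r" by (simp add: algebra_simps)
  then have "\<Phi> q \<le> (1 - x) * \<Phi> p + x * \<Phi> r"
    using assms x by (intro Phi_chord) auto
  then have "(\<Phi> q - \<Phi> p) * (s r - s p) \<le> (x * (\<Phi> r - \<Phi> p)) * (s r - s p)"
    using st by (intro mult_right_mono) (auto simp: algebra_simps)
  also have "\<dots> = (x * (s r - s p)) * (\<Phi> r - \<Phi> p)" by simp
  also have "\<dots> = (s q - s p) * (\<Phi> r - \<Phi> p)" by (simp only: xx)
  finally show ?thesis by (simp add: algebra_simps)
qed

text \<open>With \<open>Q\<close> a slope of the potential in arclength to the left of \<open>a0\<close>, the identity for \<open>(v t)\<^sup>2\<close> gives
  \<open>(v a - v b) * v a \<le> 2 * Q / \<epsilon> * v a * (b - a)\<close>.\<close>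

lemma v_lipschitz:
  assumes a0: "0 < a0"
  obtains L where "0 \<le> L" "\<And>a b. a0 \<le> a \<Longrightarrow> a \<le> b \<Longrightarrow> v a - v b \<le> L * (b - a)"
proof -
  define a1 where "a1 = a0 / 2"
  have a1: "0 < a1" "a1 < a0" using a0 by (auto simp: a1_def)
  show thesis
  proof (cases "s a1 = s a0")
    case True
    have c: "s r = s a0" if "a1 < r" "r < a0" for r
      using s_mono[of a1 r] s_mono[of r a0] that a1 True by auto
    have "((\<lambda>k. - s k) has_real_derivative - v a0) (at a0)" using s_deriv[OF a0] by (rule DERIV_minus)
    then have "0 \<ge> v a0" using DERIV_nonpos_of_left_min[OF s_deriv[OF a0] a1(2)] c by auto
    then have "v a = 0" if "a0 \<le> a" for a using v_antimono[OF a0 that] v_nonneg[of a] that a0 by auto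
    then show thesis by (intro that[of 0]) auto
  next
    case False
    then have s10: "0 < s a0 - s a1" using s_mono[of a1 a0] a1 by auto
    define Q where "Q = (\<Phi> a1 - \<Phi> a0) / (s a0 - s a1)"
    have Q0: "0 \<le> Q" using Phi_antimono[of a1 a0] a1 s10 by (simp add: Q_def)
    have QN: "\<Phi> a1 - \<Phi> a0 = Q * (s a0 - s a1)" using s10 by (simp add: Q_def)
    have PhiQ: "\<Phi> a - \<Phi> b \<le> Q * (s b - s a)" if "a0 \<le> a" "a \<le> b" for a b
    proof -
      have "(- Q * (s a - s a0)) * (s a0 - s a1) \<le> (\<Phi> a - \<Phi> a0) * (s a0 - s a1)"
      proof -
        have "\<Phi> a0 - \<Phi> a1 = - Q * (s a0 - s a1)" using QN by simp
        then have "(\<Phi> a0 - \<Phi> a1) * (s a - s a0) = (- Q * (s a - s a0)) * (s a0 - s a1)" by simp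
        then show ?thesis using Phi_slopes[of a1 a0 a] a1 that by linarith
      qed
      then have "- Q * (s a - s a0) \<le> \<Phi> a - \<Phi> a0" using s10 by (rule mult_right_le_imp_le)
      then have "- Q * (s a - s a1) \<le> \<Phi> a - \<Phi> a1" using QN by (simp add: algebra_simps)
      moreover have sb: "0 \<le> s b - s a" using s_mono[of a b] that a0 by auto
      ultimately have "(- Q * (s a - s a1)) * (s b - s a) \<le> (\<Phi> a - \<Phi> a1) * (s b - s a)" by (intro mult_right_mono)
      also have "\<dots> \<le> (\<Phi> b - \<Phi> a) * (s a - s a1)" using Phi_slopes[of a1 a b] a1 that by auto
      finally have "(- Q * (s b - s a)) * (s a - s a1) \<le> (\<Phi> b - \<Phi> a) * (s a - s a1)" by (simp add: mult_ac)
      moreover have "0 < s a - s a1" using s_mono[of a0 a] s10 that a0 by auto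
      ultimately have "- Q * (s b - s a) \<le> \<Phi> b - \<Phi> a" by (rule mult_right_le_imp_le)
      then show ?thesis by simp
    qed
    show thesis
    proof (rule that[of "2 * Q / \<epsilon>"])
      show "0 \<le> 2 * Q / \<epsilon>" using Q0 eps by simp
      fix a b assume ab: "a0 \<le> a" "a \<le> b"
      have pos: "0 < a" "0 < b" using ab a0 by auto
      show "v a - v b \<le> 2 * Q / \<epsilon> * (b - a)"
      proof (cases "v a = 0")
        case True
        then show ?thesis using v_nonneg[OF pos(2)] Q0 eps ab by (simp add: order_trans[of _ 0])
      next
        case False
        then have va: "0 < v a" using v_nonneg[OF pos(1)] by simp
        have "(v a)\<^sup>2 - (v b)\<^sup>2 = 2 / \<epsilon> * ((\<Phi> a - \<Phi> b) - (G a - G b))"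
          unfolding v_square[OF pos(1)] v_square[OF pos(2)] using eps by (simp add: field_simps)
        also have "\<dots> \<le> 2 / \<epsilon> * (Q * (v a * (b - a)))"
        proof (rule mult_left_mono)
          have "Q * (s b - s a) \<le> Q * (v a * (b - a))"
            using s_increment_le[OF pos(1) ab(2)] Q0 by (rule mult_left_mono)
          then show "(\<Phi> a - \<Phi> b) - (G a - G b) \<le> Q * (v a * (b - a))"
            using PhiQ[OF ab] G_antimono[OF pos(1) ab(2)] by linarith
        qed (use eps in auto)
        finally have 1: "(v a)\<^sup>2 - (v b)\<^sup>2 \<le> 2 / \<epsilon> * (Q * (v a * (b - a)))" .
        have "(v a - v b) * v a \<le> (v a - v b) * (v a + v b)"
          using v_antimono[OF pos(1) ab(2)] v_nonneg[OF pos(2)] by (intro mult_left_mono) auto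
        also have "\<dots> = (v a)\<^sup>2 - (v b)\<^sup>2" by (simp add: power2_eq_square algebra_simps)
        also note 1
        also have "2 / \<epsilon> * (Q * (v a * (b - a))) = (2 * Q / \<epsilon> * (b - a)) * v a" by simp
        finally show ?thesis using va by (rule mult_right_le_imp_le)
      qed
    qed
  qed
qed

text \<open>The point \<open>u (t + h)\<close> is reflected at \<open>u t\<close> in arclength, to the point \<open>u b\<close> with \<open>t - h \<le> b \<le> t\<close>. The
  potential is midpoint convex there, and decreases from \<open>t - h\<close> to \<open>b\<close> with slope at least \<open>v t\<close>.\<close>

lemma Phi_second_difference:
  assumes "0 \<le> h" "h < t"
  shows "v t * (2 * s t - s (t + h) - s (t - h)) \<le> \<Phi> (t + h) + \<Phi> (t - h) - 2 * \<Phi> t"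
proof -
  let ?y = "2 * s t - s (t + h)"
  have t: "0 < t - h" "0 < t" using assms by auto
  have conc: "s (t - h) \<le> ?y"
  proof -
    have "(1 - 1 / 2) * (t - h) + 1 / 2 * (t + h) = t" by (simp add: field_simps)
    then show ?thesis using s_concave[of "t - h" "t + h" "1 / 2"] assms by simp
  qed
  have "?y \<le> s t" using s_mono[of t "t + h"] assms by simp
  then obtain b where b: "t - h \<le> b" "b \<le> t" "s b = ?y" using s_IVT[of "t - h" t ?y] conc assms by auto
  have "s t = (1 - 1 / 2) * s b + 1 / 2 * s (t + h)" unfolding b(3) by (simp add: field_simps)
  then have 1: "\<Phi> t \<le> (1 - 1 / 2) * \<Phi> b + 1 / 2 * \<Phi> (t + h)"
    using b assms by (intro Phi_chord) auto
  have pos: "0 < b" using b t by simp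
  have "G (t - h) - G b \<ge> v t * (s b - s (t - h))"
  proof -
    have "G b + v t * s b \<le> G (t - h) + v t * s (t - h)"
    proof (rule DERIV_nonpos_imp_nonincreasing[of "t - h" b "\<lambda>r. G r + v t * s r"])
      fix r assume r: "t - h \<le> r" "r \<le> b"
      have r0: "0 < r" "r \<le> t" using r t b by auto
      have "(v r) * (v t - v r) \<le> 0" using v_antimono[OF r0] v_nonneg[OF r0(1)] by (simp add: mult_nonneg_nonpos)
      moreover have "((\<lambda>r. G r + v t * s r) has_real_derivative - (v r)\<^sup>2 + v t * v r) (at r)"
        using G_deriv[OF r0(1)] s_deriv[OF r0(1)] by (auto intro!: derivative_eq_intros)
      ultimately show "\<exists>y. ((\<lambda>r. G r + v t * s r) has_real_derivative y) (at r) \<and> y \<le> 0"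
        by (intro exI[of _ "- (v r)\<^sup>2 + v t * v r"]) (auto simp: power2_eq_square algebra_simps)
    qed (use b in auto)
    then show ?thesis by (simp add: algebra_simps)
  qed
  moreover have "\<Phi> (t - h) - \<Phi> b \<ge> G (t - h) - G b"
  proof -
    have "(v b)\<^sup>2 \<le> (v (t - h))\<^sup>2" using v_antimono[OF t(1) b(1)] v_nonneg[OF pos] by (intro power_mono) auto
    then have "\<Phi> b - G b \<le> \<Phi> (t - h) - G (t - h)"
      unfolding v_square[OF pos] v_square[OF t(1)] using eps by (simp add: divide_le_cancel)
    then show ?thesis by simp
  qed
  ultimately have "v t * (s b - s (t - h)) \<le> \<Phi> (t - h) - \<Phi> b" by linarith
  then show ?thesis using 1 b(3) by simp
qed

end

section \<open>Weak formulation\<close>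

lemma deriv_zero_outside:
  fixes f :: "real \<Rightarrow> real"
  assumes f: "\<And>t. (f has_real_derivative f' t) (at t)" and out: "\<And>t. t \<notin> {a..b} \<Longrightarrow> f t = 0" and t: "t \<notin> {a..b}"
  shows "f' t = 0"
proof -
  have "(f has_real_derivative 0) (at t)"
    by (rule has_field_derivative_transform_within_open[of "\<lambda>_. 0" _ _ "- {a..b}"]) (use out t in auto)
  then show ?thesis using f DERIV_unique by blast
qed

lemma DERIV_translate_reflect:
  fixes f :: "real \<Rightarrow> real"
  shows "(f has_real_derivative D) (at (t + x)) \<Longrightarrow> ((\<lambda>x. f (t + x)) has_real_derivative D) (at x)"
    and "(f has_real_derivative D) (at (t - x)) \<Longrightarrow> ((\<lambda>x. f (t - x)) has_real_derivative - D) (at x)"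
proof -
  have "((\<lambda>x. t + x) has_real_derivative 1) (at x)" "((\<lambda>x. t - x) has_real_derivative - 1) (at x)"
    by (auto intro!: derivative_eq_intros)
  from DERIV_chain2[OF _ this(1), of f D] DERIV_chain2[OF _ this(2), of f D]
  show "(f has_real_derivative D) (at (t + x)) \<Longrightarrow> ((\<lambda>x. f (t + x)) has_real_derivative D) (at x)"
    "(f has_real_derivative D) (at (t - x)) \<Longrightarrow> ((\<lambda>x. f (t - x)) has_real_derivative - D) (at x)" by simp_all
qed

lemma symmetric_second_difference:
  fixes \<psi> :: "real \<Rightarrow> real"
  assumes d1: "\<And>t. (\<psi> has_real_derivative \<psi>1 t) (at t)" and d2: "\<And>t. (\<psi>1 has_real_derivative \<psi>2 t) (at t)"
    and h: "0 < h"
  obtains x where "0 < x" "x < h" "\<psi> (t + h) + \<psi> (t - h) - 2 * \<psi> t = (\<psi>2 (t + x) + \<psi>2 (t - x)) / 2 * h\<^sup>2"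
proof -
  define D where "D n x = (if n = 0 then \<psi> (t + x) + \<psi> (t - x) - 2 * \<psi> t
     else if n = 1 then \<psi>1 (t + x) - \<psi>1 (t - x) else \<psi>2 (t + x) + \<psi>2 (t - x))" for n :: nat and x
  have d: "((\<lambda>x. f (t + x)) has_real_derivative f' (t + x)) (at x)" "((\<lambda>x. f (t - x)) has_real_derivative - f' (t - x)) (at x)"
    if "\<And>t. (f has_real_derivative f' t) (at t)" for f f' x
    by (rule DERIV_translate_reflect that)+
  have "\<exists>x>0. x < h \<and> D 0 h = (\<Sum>k<2. D k 0 / fact k * h ^ k) + D 2 x / fact 2 * h ^ 2"
  proof (rule Maclaurin[OF h])
    show "\<forall>(k::nat) x. k < 2 \<and> 0 \<le> x \<and> x \<le> h \<longrightarrow> (D k has_real_derivative D (Suc k) x) (at x)"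
    proof (intro allI impI)
      fix k :: nat and x assume "k < 2 \<and> 0 \<le> x \<and> x \<le> h"
      then consider "k = 0" | "k = 1" by linarith
      then show "(D k has_real_derivative D (Suc k) x) (at x)"
      proof cases
        case 1
        have "((\<lambda>x. \<psi> (t + x) + \<psi> (t - x) - 2 * \<psi> t) has_real_derivative \<psi>1 (t + x) + - \<psi>1 (t - x) - 0) (at x)"
          by (rule DERIV_diff[OF DERIV_add[OF d(1)[OF d1] d(2)[OF d1]] DERIV_const])
        then show ?thesis using 1 by (simp add: D_def[abs_def])
      next
        case 2
        have "((\<lambda>x. \<psi>1 (t + x) - \<psi>1 (t - x)) has_real_derivative \<psi>2 (t + x) - - \<psi>2 (t - x)) (at x)"
          by (rule DERIV_diff[OF d(1)[OF d2] d(2)[OF d2]])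
        then show ?thesis using 2 by (simp add: D_def[abs_def])
      qed
    qed
  qed auto
  then obtain x where x: "0 < x" "x < h" "D 0 h = (\<Sum>k<2. D k 0 / fact k * h ^ k) + D 2 x / fact 2 * h ^ 2" by blast
  have "(\<Sum>k<2. D k 0 / fact k * h ^ k) = 0" by (simp add: numeral_2_eq_2 D_def)
  then have "D 0 h = D 2 x / 2 * h\<^sup>2" using x(3) by simp
  then show thesis using that[of x] x by (simp add: D_def)
qed

lemma weak_second_derivative_nonneg:
  fixes K \<psi> :: "real \<Rightarrow> real"
  assumes a: "0 < a" "a \<le> b" and K: "continuous_on {0<..} K" and C: "0 \<le> C"
    and sd: "\<And>t h. 0 \<le> h \<Longrightarrow> a / 4 \<le> t - h \<Longrightarrow> - C * h ^ 3 \<le> K (t + h) + K (t - h) - 2 * K t"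
    and d1: "\<And>t. (\<psi> has_real_derivative \<psi>1 t) (at t)" and d2: "\<And>t. (\<psi>1 has_real_derivative \<psi>2 t) (at t)"
    and c2: "continuous_on UNIV \<psi>2" and nn: "\<And>t. 0 \<le> \<psi> t" and out: "\<And>t. t \<notin> {a..b} \<Longrightarrow> \<psi> t = 0"
  shows "0 \<le> (LINT t:{a..b}|lborel. K t * \<psi>2 t)"
proof -
  define J where "J = {a / 4..b + a}"
  define k where "k t = indicator J t * K t" for t
  have "set_integrable lborel J K"
    unfolding J_def by (rule borel_integrable_atLeastAtMost'[OF continuous_on_subset[OF K]]) (use a in auto)
  then have ki: "integrable lborel k" by (simp add: k_def[abs_def] set_integrable_def)
  note [measurable] = borel_measurable_integrable[OF ki, simplified]
  have [measurable]: "\<psi>2 \<in> borel_measurable borel" using c2 by (rule borel_measurable_continuous_onI)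
  have "continuous_on UNIV \<psi>" by (rule DERIV_continuous_on) (use d1 in \<open>auto intro: has_field_derivative_at_within\<close>)
  then have [measurable]: "\<psi> \<in> borel_measurable borel" by (rule borel_measurable_continuous_onI)
  have out1: "\<psi>1 t = 0" if "t \<notin> {a..b}" for t by (rule deriv_zero_outside[OF d1 out that])
  have out2: "\<psi>2 t = 0" if "t \<notin> {a..b}" for t by (rule deriv_zero_outside[OF d2 out1 that])
  have bounded: "\<exists>M\<ge>0. \<forall>t. \<bar>f t\<bar> \<le> M" if "continuous_on UNIV f" "\<And>t. t \<notin> {a..b} \<Longrightarrow> f t = 0" for f :: "real \<Rightarrow> real"
  proof -
    have "bounded (f ` {a..b})"
      by (intro compact_imp_bounded compact_continuous_image continuous_on_subset[OF that(1)]) auto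
    then obtain M where "\<forall>x\<in>f ` {a..b}. norm x \<le> M" unfolding bounded_iff by blast
    then have "\<bar>f t\<bar> \<le> \<bar>M\<bar>" for t using that(2)[of t] by (cases "t \<in> {a..b}") (auto intro: order_trans[OF _ abs_ge_self])
    then show ?thesis by (intro exI[of _ "\<bar>M\<bar>"]) auto
  qed
  obtain M where M: "0 \<le> M" "\<And>t. \<bar>\<psi>2 t\<bar> \<le> M" using bounded[OF c2 out2] by blast
  obtain M0 where M0: "0 \<le> M0" "\<And>t. \<bar>\<psi> t\<bar> \<le> M0" using bounded[OF \<open>continuous_on UNIV \<psi>\<close> out] by blast
  define h where "h n = a / 4 * inverse (real (Suc n))" for n
  have h: "0 < h n" "h n \<le> a / 4" for n
    using a by (auto simp: h_def field_simps)
  have h0: "h \<longlonglongrightarrow> 0" unfolding h_def[abs_def]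
    using tendsto_mult_left[OF LIMSEQ_inverse_real_of_nat, of "a / 4"] by simp
  define q where "q n t = (\<psi> (t + h n) + \<psi> (t - h n) - 2 * \<psi> t) / (h n)\<^sup>2" for n t
  have q: "\<exists>x. 0 < x \<and> x < h n \<and> q n t = (\<psi>2 (t + x) + \<psi>2 (t - x)) / 2" for n t
  proof -
    obtain x where x: "0 < x" "x < h n"
      "\<psi> (t + h n) + \<psi> (t - h n) - 2 * \<psi> t = (\<psi>2 (t + x) + \<psi>2 (t - x)) / 2 * (h n)\<^sup>2"
      using symmetric_second_difference[OF d1 d2 h(1)] by blast
    then show ?thesis using h(1)[of n] by (intro exI[of _ x]) (simp add: q_def)
  qed
  have qM: "\<bar>q n t\<bar> \<le> M" for n t
  proof -
    obtain x where "q n t = (\<psi>2 (t + x) + \<psi>2 (t - x)) / 2" using q by blast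
    then show ?thesis using M(2)[of "t + x"] M(2)[of "t - x"] by (simp add: abs_le_iff)
  qed
  have qlim: "(\<lambda>n. q n t) \<longlonglongrightarrow> \<psi>2 t" for t
    unfolding LIMSEQ_def
  proof (intro allI impI)
    fix r :: real assume "0 < r"
    then obtain d where d: "d > 0" "\<And>y. dist y t < d \<Longrightarrow> dist (\<psi>2 y) (\<psi>2 t) < r"
      using c2 unfolding continuous_on_iff by (metis UNIV_I)
    obtain N where N: "\<And>n. N \<le> n \<Longrightarrow> h n < d"
      using order_tendstoD(2)[OF h0 d(1)] unfolding eventually_sequentially by auto
    have "dist (q n t) (\<psi>2 t) < r" if "N \<le> n" for n
    proof -
      obtain x where x: "0 < x" "x < h n" "q n t = (\<psi>2 (t + x) + \<psi>2 (t - x)) / 2" using q by blast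
      have "dist (\<psi>2 (t + x)) (\<psi>2 t) < r" "dist (\<psi>2 (t - x)) (\<psi>2 t) < r"
        using d(2)[of "t + x"] d(2)[of "t - x"] x(1,2) N[OF that] by (auto simp: dist_real_def)
      then have lt: "\<bar>\<psi>2 (t + x) - \<psi>2 t\<bar> < r" "\<bar>\<psi>2 (t - x) - \<psi>2 t\<bar> < r" by (simp_all add: dist_real_def)
      have "q n t - \<psi>2 t = ((\<psi>2 (t + x) - \<psi>2 t) + (\<psi>2 (t - x) - \<psi>2 t)) / 2"
        unfolding x(3) by (simp add: field_simps)
      then have "\<bar>q n t - \<psi>2 t\<bar> = \<bar>(\<psi>2 (t + x) - \<psi>2 t) + (\<psi>2 (t - x) - \<psi>2 t)\<bar> / 2"
        by (simp only: abs_divide abs_numeral)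
      also have "\<dots> < r" using abs_triangle_ineq[of "\<psi>2 (t + x) - \<psi>2 t" "\<psi>2 (t - x) - \<psi>2 t"] lt by simp
      finally show ?thesis by (simp add: dist_real_def)
    qed
    then show "\<exists>no. \<forall>n\<ge>no. dist (q n t) (\<psi>2 t) < r" by blast
  qed
  have [measurable]: "q n \<in> borel_measurable borel" for n unfolding q_def[abs_def] by measurable
  have "(\<lambda>n. LINT t|lborel. k t * q n t) \<longlonglongrightarrow> (LINT t|lborel. k t * \<psi>2 t)"
  proof (rule integral_dominated_convergence[where w="\<lambda>t. M * \<bar>k t\<bar>"])
    show "integrable lborel (\<lambda>t. M * \<bar>k t\<bar>)" using ki by simp
    show "AE t in lborel. (\<lambda>n. k t * q n t) \<longlonglongrightarrow> k t * \<psi>2 t" by (intro AE_I2 tendsto_intros qlim)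
    show "AE t in lborel. norm (k t * q n t) \<le> M * \<bar>k t\<bar>" for n
    proof (rule AE_I2)
      fix t
      have "\<bar>k t\<bar> * \<bar>q n t\<bar> \<le> \<bar>k t\<bar> * M" by (rule mult_left_mono[OF qM]) simp
      then show "norm (k t * q n t) \<le> M * \<bar>k t\<bar>" by (simp add: abs_mult mult.commute)
    qed
  qed measurable
  moreover have "- C * h n * (M0 * (b - a)) \<le> (LINT t|lborel. k t * q n t)" for n
  proof -
    have kp: "integrable lborel (\<lambda>t. k (t + c) * \<psi> t)" for c
    proof (rule Bochner_Integration.integrable_bound)
      have "integrable lborel (\<lambda>t. k (c + 1 * t))" by (rule lborel_integrable_real_affine[OF ki]) simp
      then show "integrable lborel (\<lambda>t. M0 * k (t + c))" by (simp add: add.commute)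
      show "AE t in lborel. norm (k (t + c) * \<psi> t) \<le> norm (M0 * k (t + c))"
        using M0 by (intro AE_I2) (auto simp: abs_mult mult.commute intro!: mult_right_mono)
    qed measurable
    have sh: "(LINT t|lborel. k t * \<psi> (t + c)) = (LINT t|lborel. k (t - c) * \<psi> t)" "integrable lborel (\<lambda>t. k t * \<psi> (t + c))" for c
      using lborel_integral_real_affine[of 1 "\<lambda>t. k t * \<psi> (t + c)" "- c"]
        lborel_integrable_real_affine_iff[of 1 "\<lambda>t. k t * \<psi> (t + c)" "- c"] kp[of "- c"] by auto
    have "(LINT t|lborel. k t * q n t) = (LINT t|lborel. (k t * \<psi> (t + h n) + k t * \<psi> (t + (- h n)) - 2 * (k t * \<psi> (t + 0))) / (h n)\<^sup>2)"
      by (intro Bochner_Integration.integral_cong) (auto simp: q_def algebra_simps)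
    also have "\<dots> = ((LINT t|lborel. k (t - h n) * \<psi> t) + (LINT t|lborel. k (t + h n) * \<psi> t) - 2 * (LINT t|lborel. k t * \<psi> t)) / (h n)\<^sup>2"
      using sh[of "h n"] sh[of "- h n"] sh[of 0] by simp
    also have "\<dots> = (LINT t|lborel. (k (t - h n) * \<psi> t + k (t + h n) * \<psi> t - 2 * (k t * \<psi> t)) / (h n)\<^sup>2)"
      using kp[of "h n"] kp[of "- h n"] kp[of 0] by simp
    also have "\<dots> \<ge> (LINT t|lborel. indicator {a..b} t * (- C * h n * M0))"
    proof (rule integral_mono)
      show "integrable lborel (\<lambda>t. indicator {a..b} t * (- C * h n * M0))"
        using set_integrable_const_interval(2)[of a b "- C * h n * M0"] by (simp add: set_integrable_def)
      show "integrable lborel (\<lambda>t. (k (t - h n) * \<psi> t + k (t + h n) * \<psi> t - 2 * (k t * \<psi> t)) / (h n)\<^sup>2)"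
        using kp[of "h n"] kp[of "- h n"] kp[of 0] by simp
      fix t
      show "indicator {a..b} t * (- C * h n * M0) \<le> (k (t - h n) * \<psi> t + k (t + h n) * \<psi> t - 2 * (k t * \<psi> t)) / (h n)\<^sup>2"
      proof (cases "t \<in> {a..b}")
        case True
        then have "t - h n \<in> J" "t + h n \<in> J" "t \<in> J" using h[of n] a by (auto simp: J_def)
        then have "(k (t - h n) * \<psi> t + k (t + h n) * \<psi> t - 2 * (k t * \<psi> t)) = (K (t + h n) + K (t - h n) - 2 * K t) * \<psi> t"
          by (simp add: k_def algebra_simps)
        also have "\<dots> \<ge> (- C * h n ^ 3) * \<psi> t"
          using h[of n] True a by (intro mult_right_mono sd nn) auto
        finally have "(- C * h n ^ 3) * \<psi> t / (h n)\<^sup>2 \<le> (k (t - h n) * \<psi> t + k (t + h n) * \<psi> t - 2 * (k t * \<psi> t)) / (h n)\<^sup>2"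
          by (intro divide_right_mono) auto
        moreover have "(- C * h n ^ 3) * \<psi> t / (h n)\<^sup>2 = - (C * h n * \<psi> t)"
          using h(1)[of n] by (simp add: power2_eq_square power3_eq_cube)
        moreover have "C * h n * \<psi> t \<le> C * h n * M0"
          using C h(1)[of n] M0(2)[of t] by (intro mult_left_mono) auto
        ultimately show ?thesis using True by simp
      qed (use out in simp)
    qed
    also have "(LINT t|lborel. indicator {a..b} t * (- C * h n * M0)) = - C * h n * (M0 * (b - a))" using a by simp
    finally show ?thesis .
  qed
  moreover have "(\<lambda>n. - C * h n * (M0 * (b - a))) \<longlonglongrightarrow> - C * 0 * (M0 * (b - a))"
    by (intro tendsto_intros h0)
  ultimately have "- C * 0 * (M0 * (b - a)) \<le> (LINT t|lborel. k t * \<psi>2 t)"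
    by (intro LIMSEQ_le) auto
  moreover have "(LINT t|lborel. k t * \<psi>2 t) = (LINT t:{a..b}|lborel. K t * \<psi>2 t)"
    unfolding set_lebesgue_integral_def
    using out2 a by (intro Bochner_Integration.integral_cong) (auto simp: k_def J_def indicator_def)
  ultimately show ?thesis by simp
qed

lemma set_integral_lebesgue_compact_support:
  fixes F h \<theta> :: "real \<Rightarrow> real"
  assumes a: "0 < a" and h: "continuous_on {0<..} h" and \<theta>: "continuous_on UNIV \<theta>"
    and out: "\<forall>t. t \<notin> {a..b} \<longrightarrow> \<theta> t = 0" and AE: "AE t in lborel. 0 < t \<longrightarrow> F t = h t"
  shows "(LINT t:{0<..}|lebesgue. F t * \<theta> t) = (LINT t:{a..b}|lborel. h t * \<theta> t)"
    and "set_integrable lborel {a..b} (\<lambda>t. h t * \<theta> t)"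
proof -
  show i: "set_integrable lborel {a..b} (\<lambda>t. h t * \<theta> t)"
    by (intro borel_integrable_atLeastAtMost' continuous_intros continuous_on_subset[OF h] continuous_on_subset[OF \<theta>]) (use a in auto)
  then have m: "(\<lambda>t. indicator {a..b} t *\<^sub>R (h t * \<theta> t)) \<in> borel_measurable lborel"
    unfolding set_integrable_def by (rule borel_measurable_integrable)
  then have m': "(\<lambda>t. indicator {a..b} t *\<^sub>R (h t * \<theta> t)) \<in> borel_measurable lebesgue"
    by (rule measurable_completion)
  have eq: "AE t in lebesgue. indicator {a..b} t *\<^sub>R (h t * \<theta> t) = indicator {0<..} t *\<^sub>R (F t * \<theta> t)"
  proof (rule AE_completion)
    show "AE t in lborel. indicator {a..b} t *\<^sub>R (h t * \<theta> t) = indicator {0<..} t *\<^sub>R (F t * \<theta> t)"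
      using AE by eventually_elim (use out a in \<open>force simp: indicator_def\<close>)
  qed
  have "(LINT t:{0<..}|lebesgue. F t * \<theta> t) = (LINT t|lebesgue. indicator {a..b} t *\<^sub>R (h t * \<theta> t))"
    unfolding set_lebesgue_integral_def
  proof (rule integral_cong_AE[OF borel_measurable_AE[OF m' eq] m'])
    show "AE t in lebesgue. indicator {0<..} t *\<^sub>R (F t * \<theta> t) = indicator {a..b} t *\<^sub>R (h t * \<theta> t)"
      using eq by eventually_elim (rule sym)
  qed
  also have "\<dots> = (LINT t:{a..b}|lborel. h t * \<theta> t)"
    unfolding set_lebesgue_integral_def by (rule integral_completion[OF m])
  finally show "(LINT t:{0<..}|lebesgue. F t * \<theta> t) = (LINT t:{a..b}|lborel. h t * \<theta> t)" .
qed

lemma test_function_support: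
  assumes "\<psi> \<in> test_functions {0<..}"
  obtains a b where "0 < a" "a \<le> b" "\<And>t. t \<notin> {a..b} \<Longrightarrow> \<psi> t = 0"
proof -
  define S where "S = closure {t. \<psi> t \<noteq> 0}"
  have S: "compact S" "S \<subseteq> {0<..}" using assms by (auto simp: test_functions_def S_def)
  have SI: "t \<in> S" if "\<psi> t \<noteq> 0" for t unfolding S_def using closure_subset that by fastforce
  show thesis
  proof (cases "S = {}")
    case True
    then show thesis using that[of 1 1] SI by auto
  next
    case False
    obtain a where a: "a \<in> S" "\<And>t. t \<in> S \<Longrightarrow> a \<le> t" using compact_attains_inf[OF S(1) False] by blast
    obtain b where b: "b \<in> S" "\<And>t. t \<in> S \<Longrightarrow> t \<le> b" using compact_attains_sup[OF S(1) False] by blast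
    show thesis
    proof (rule that[of a b])
      show "\<psi> t = 0" if "t \<notin> {a..b}" for t using that a(2) b(2) SI by force
    qed (use a b S in auto)
  qed
qed

lemma test_function_DERIV:
  assumes "\<psi> \<in> test_functions A"
  shows "((deriv ^^ n) \<psi> has_real_derivative (deriv ^^ Suc n) \<psi> t) (at t)"
proof -
  have "(deriv ^^ n) \<psi> field_differentiable at t" using assms by (auto simp: test_functions_def)
  then show ?thesis by (simp add: DERIV_deriv_iff_field_differentiable)
qed

context wed_minimizer
begin

text \<open>\<open>- G / 2\<close> is a primitive of \<open>v\<^sup>2 / 2\<close>, so the inequality to be proved is the weak convexity of
  \<open>\<Phi> - G / 2\<close>. Its second differences are bounded below by a term of third order.\<close>

lemma second_difference_bound:
  assumes a0: "0 < a0"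
  obtains C where "0 \<le> C"
    "\<And>t h. 0 \<le> h \<Longrightarrow> a0 \<le> t - h \<Longrightarrow> - C * h ^ 3 \<le>
       (\<Phi> (t + h) - G (t + h) / 2) + (\<Phi> (t - h) - G (t - h) / 2) - 2 * (\<Phi> t - G t / 2)"
proof -
  obtain L where L: "0 \<le> L" "\<And>a b. a0 \<le> a \<Longrightarrow> a \<le> b \<Longrightarrow> v a - v b \<le> L * (b - a)"
    using v_lipschitz[OF a0] by blast
  show thesis
  proof (rule that[of "2 / 3 * L\<^sup>2"])
    fix t h :: real assume h: "0 \<le> h" "a0 \<le> t - h"
    define J where "J x = v t * (2 * s t - s (t + x) - s (t - x)) - (G (t + x) + G (t - x) - 2 * G t) / 2 + 2 / 3 * L\<^sup>2 * x ^ 3" for x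
    have "J 0 \<le> J h"
    proof (rule DERIV_nonneg_imp_nondecreasing[OF h(1)])
      fix x assume x: "0 \<le> x" "x \<le> h"
      have pos: "0 < t + x" "0 < t - x" "0 < t" using x h a0 by auto
      note ds = DERIV_translate_reflect(1)[OF s_deriv[OF pos(1)]] DERIV_translate_reflect(2)[OF s_deriv[OF pos(2)]]
      note dG = DERIV_translate_reflect(1)[OF G_deriv[OF pos(1)]] DERIV_translate_reflect(2)[OF G_deriv[OF pos(2)]]
      define A where "A = v (t - x)"
      define B' where "B' = v (t + x)"
      have "(J has_real_derivative v t * (A - B') + (B'\<^sup>2 - A\<^sup>2) / 2 + 2 * L\<^sup>2 * x\<^sup>2) (at x)"
      proof -
        have p3: "((\<lambda>x. 2 / 3 * L\<^sup>2 * x ^ 3) has_real_derivative 2 * L\<^sup>2 * x\<^sup>2) (at x)"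
          by (auto intro!: derivative_eq_intros simp: power2_eq_square)
        show ?thesis unfolding J_def[abs_def] A_def B'_def
          by (rule DERIV_cong[OF DERIV_add[OF DERIV_diff[OF
               DERIV_cmult[OF DERIV_diff[OF DERIV_diff[OF DERIV_const ds(1)] ds(2)]]
               DERIV_cdivide[OF DERIV_diff[OF DERIV_add[OF dG] DERIV_const]]] p3]])
             (simp add: field_simps)
      qed
      moreover have "0 \<le> v t * (A - B') + (B'\<^sup>2 - A\<^sup>2) / 2 + 2 * L\<^sup>2 * x\<^sup>2"
      proof -
        have AB: "B' \<le> v t" "v t \<le> A" unfolding A_def B'_def using v_antimono pos x by auto
        have "A - B' \<le> L * (2 * x)" using L(2)[of "t - x" "t + x"] x h by (simp add: A_def B'_def)
        then have "(A - B')\<^sup>2 \<le> (L * (2 * x))\<^sup>2" using AB by (intro power_mono) auto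
        then have 1: "(A - B')\<^sup>2 / 2 \<le> 2 * L\<^sup>2 * x\<^sup>2" by (simp add: power_mult_distrib)
        have "v t * (A - B') + (B'\<^sup>2 - A\<^sup>2) / 2 = (A - B') * (v t - (A + B') / 2)"
          by (simp add: power2_eq_square field_simps)
        also have "\<dots> \<ge> (A - B') * (- ((A - B') / 2))" using AB by (intro mult_left_mono) (simp_all add: field_simps)
        finally show ?thesis using 1 by (simp add: power2_eq_square)
      qed
      ultimately show "\<exists>y. (J has_real_derivative y) (at x) \<and> 0 \<le> y" by blast
    qed
    moreover have "J 0 = 0" by (simp add: J_def)
    moreover have "v t * (2 * s t - s (t + h) - s (t - h)) \<le> \<Phi> (t + h) + \<Phi> (t - h) - 2 * \<Phi> t"
      using h a0 by (intro Phi_second_difference) auto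
    ultimately show "- (2 / 3 * L\<^sup>2) * h ^ 3 \<le>
       (\<Phi> (t + h) - G (t + h) / 2) + (\<Phi> (t - h) - G (t - h) / 2) - 2 * (\<Phi> t - G t / 2)"
      by (simp add: J_def field_simps)
  qed (use L in auto)
qed

lemma weak_forms:
  fixes \<psi> :: "real \<Rightarrow> real"
  defines "E \<equiv> \<lambda>t. 1 / 2 * (metric_deriv {0..} u t)\<^sup>2"
    and "PHI \<equiv> \<lambda>t. real_of_ereal (\<phi> (u t))"
  assumes \<psi>: "\<psi> \<in> test_functions {0<..}"
  shows "- \<epsilon> * distr_deriv {0<..} 2 E \<psi> + distr_deriv {0<..} 1 E \<psi> = - distr_deriv {0<..} 2 PHI \<psi> - distr_deriv {0<..} 1 E \<psi>"
    and "(\<And>t. 0 \<le> \<psi> t) \<Longrightarrow> - distr_deriv {0<..} 2 PHI \<psi> - distr_deriv {0<..} 1 E \<psi> \<le> 0"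
proof -
  obtain a b where ab: "0 < a" "a \<le> b" "\<And>t. t \<notin> {a..b} \<Longrightarrow> \<psi> t = 0" using test_function_support[OF \<psi>] by blast
  define \<psi>1 where "\<psi>1 = deriv \<psi>"
  define \<psi>2 where "\<psi>2 = deriv \<psi>1"
  have it: "(deriv ^^ 1) \<psi> = \<psi>1" "(deriv ^^ 2) \<psi> = \<psi>2" by (simp_all add: \<psi>1_def \<psi>2_def numeral_2_eq_2)
  have d1: "(\<psi> has_real_derivative \<psi>1 t) (at t)" for t using test_function_DERIV[OF \<psi>, of 0] by (simp add: \<psi>1_def)
  have d2: "(\<psi>1 has_real_derivative \<psi>2 t) (at t)" for t using test_function_DERIV[OF \<psi>, of 1] by (simp add: \<psi>1_def \<psi>2_def)
  have d3: "(\<psi>2 has_real_derivative deriv \<psi>2 t) (at t)" for t using test_function_DERIV[OF \<psi>, of 2] by (simp add: \<psi>1_def \<psi>2_def numeral_2_eq_2)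
  have out1: "\<psi>1 t = 0" if "t \<notin> {a..b}" for t by (rule deriv_zero_outside[OF d1 ab(3) that])
  have out2: "\<psi>2 t = 0" if "t \<notin> {a..b}" for t by (rule deriv_zero_outside[OF d2 out1 that])
  have cont: "continuous_on UNIV f" if "\<And>t. (f has_real_derivative f' t) (at t)" for f f' :: "real \<Rightarrow> real"
    by (rule DERIV_continuous_on) (use that in \<open>auto intro: has_field_derivative_at_within\<close>)
  note c1 = cont[OF d2] and c2 = cont[OF d3]
  have AE_E: "AE t in lborel. 0 < t \<longrightarrow> E t = (v t)\<^sup>2 / 2"
    using metric_speed(1)[OF rect] v_AE by eventually_elim (auto simp: E_def)
  have AE_P: "AE t in lborel. 0 < t \<longrightarrow> PHI t = \<Phi> t" by (intro AE_I2) (auto simp: PHI_def \<Phi>_def)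
  have cE: "continuous_on {0<..} (\<lambda>t. (v t)\<^sup>2 / 2)" by (intro continuous_intros v_continuous) auto
  have out1': "\<forall>t. t \<notin> {a..b} \<longrightarrow> \<psi>1 t = 0" and out2': "\<forall>t. t \<notin> {a..b} \<longrightarrow> \<psi>2 t = 0"
    using out1 out2 by blast+
  let ?I = "\<lambda>f. LINT t:{a..b}|lborel. f t"
  note E1 = set_integral_lebesgue_compact_support[OF ab(1) cE c1 out1' AE_E]
  note E2 = set_integral_lebesgue_compact_support[OF ab(1) cE c2 out2' AE_E]
  note P2 = set_integral_lebesgue_compact_support[OF ab(1) Phi_continuous c2 out2' AE_P]
  have cG: "AE t in lborel. 0 < t \<longrightarrow> G t = G t" by simp
  note G2 = set_integral_lebesgue_compact_support[OF ab(1) G_continuous c2 out2' cG]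
  have dd: "distr_deriv {0<..} 2 E \<psi> = ?I (\<lambda>t. (v t)\<^sup>2 / 2 * \<psi>2 t)"
    "distr_deriv {0<..} 1 E \<psi> = - ?I (\<lambda>t. (v t)\<^sup>2 / 2 * \<psi>1 t)"
    "distr_deriv {0<..} 2 PHI \<psi> = ?I (\<lambda>t. \<Phi> t * \<psi>2 t)"
    unfolding distr_deriv_def it E1(1) E2(1) P2(1) by simp_all
  have ends: "\<psi>1 (a / 2) = 0" "\<psi>1 (b + a) = 0" using ab by (auto intro!: out1)
  have parts: "?I (\<lambda>t. G t * \<psi>2 t) = 2 * ?I (\<lambda>t. (v t)\<^sup>2 / 2 * \<psi>1 t)"
  proof -
    let ?J = "{a / 2..b + a}"
    have J: "a / 2 \<le> b + a" using ab by simp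
    have ext: "(LINT t:?J|lborel. f t * \<theta> t) = ?I (\<lambda>t. f t * \<theta> t)"
      if "\<forall>t. t \<notin> {a..b} \<longrightarrow> \<theta> t = 0" for f \<theta> :: "real \<Rightarrow> real"
      unfolding set_lebesgue_integral_def using that ab
      by (intro Bochner_Integration.integral_cong) (auto simp: indicator_def)
    have cJ: "continuous_on ?J f" if "continuous_on {0<..} f" for f :: "real \<Rightarrow> real"
      by (rule continuous_on_subset[OF that]) (use ab in auto)
    have i1: "set_integrable lborel ?J (\<lambda>t. G t * \<psi>2 t)"
      by (intro borel_integrable_atLeastAtMost' continuous_intros cJ G_continuous continuous_on_subset[OF c2]) auto
    have i2: "set_integrable lborel ?J (\<lambda>t. 2 * ((v t)\<^sup>2 / 2 * \<psi>1 t))"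
      by (intro borel_integrable_atLeastAtMost' continuous_intros cJ v_continuous continuous_on_subset[OF c1]) auto
    have "((\<lambda>t. G t * \<psi>2 t - 2 * ((v t)\<^sup>2 / 2 * \<psi>1 t)) has_integral G (b + a) * \<psi>1 (b + a) - G (a / 2) * \<psi>1 (a / 2)) ?J"
    proof (rule fundamental_theorem_of_calculus[OF J])
      fix t assume "t \<in> ?J"
      then have t: "0 < t" using ab by auto
      have "((\<lambda>t. G t * \<psi>1 t) has_real_derivative - (v t)\<^sup>2 * \<psi>1 t + \<psi>2 t * G t) (at t)"
        by (rule DERIV_mult[OF G_deriv[OF t] d2])
      then have "((\<lambda>t. G t * \<psi>1 t) has_real_derivative G t * \<psi>2 t - 2 * ((v t)\<^sup>2 / 2 * \<psi>1 t)) (at t)"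
        by (rule DERIV_cong) simp
      then show "((\<lambda>t. G t * \<psi>1 t) has_vector_derivative G t * \<psi>2 t - 2 * ((v t)\<^sup>2 / 2 * \<psi>1 t)) (at t within ?J)"
        unfolding has_real_derivative_iff_has_vector_derivative by (rule has_vector_derivative_at_within)
    qed
    then have "integral ?J (\<lambda>t. G t * \<psi>2 t - 2 * ((v t)\<^sup>2 / 2 * \<psi>1 t)) = 0"
      unfolding ends by (simp add: integral_unique)
    then have "(LINT t:?J|lborel. G t * \<psi>2 t) - (LINT t:?J|lborel. 2 * ((v t)\<^sup>2 / 2 * \<psi>1 t)) = 0"
      using set_borel_integral_eq_integral(2)[OF set_integral_diff(1)[OF i1 i2]] set_integral_diff(2)[OF i1 i2] by simp
    then have "(LINT t:?J|lborel. G t * \<psi>2 t) = 2 * (LINT t:?J|lborel. (v t)\<^sup>2 / 2 * \<psi>1 t)" by simp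
    then show ?thesis unfolding ext[OF out2'] ext[OF out1'] .
  qed
  have Esq: "\<epsilon> * ((v t)\<^sup>2 / 2) = \<Phi> t - G t" if "t \<in> {a..b}" for t
    using v_square[of t] that ab eps by simp
  have "\<epsilon> * ?I (\<lambda>t. (v t)\<^sup>2 / 2 * \<psi>2 t) = ?I (\<lambda>t. \<epsilon> * ((v t)\<^sup>2 / 2 * \<psi>2 t))" by simp
  also have "\<dots> = ?I (\<lambda>t. \<Phi> t * \<psi>2 t - G t * \<psi>2 t)"
  proof (rule set_lebesgue_integral_cong)
    show "\<forall>t. t \<in> {a..b} \<longrightarrow> \<epsilon> * ((v t)\<^sup>2 / 2 * \<psi>2 t) = \<Phi> t * \<psi>2 t - G t * \<psi>2 t"
    proof (intro allI impI)
      fix t assume "t \<in> {a..b}"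
      then have "\<epsilon> * ((v t)\<^sup>2 / 2) * \<psi>2 t = (\<Phi> t - G t) * \<psi>2 t" by (simp only: Esq)
      then show "\<epsilon> * ((v t)\<^sup>2 / 2 * \<psi>2 t) = \<Phi> t * \<psi>2 t - G t * \<psi>2 t" by (simp add: left_diff_distrib)
    qed
  qed simp
  also have "\<dots> = ?I (\<lambda>t. \<Phi> t * \<psi>2 t) - ?I (\<lambda>t. G t * \<psi>2 t)" by (rule set_integral_diff(2)[OF P2(2) G2(2)])
  finally have key: "\<epsilon> * ?I (\<lambda>t. (v t)\<^sup>2 / 2 * \<psi>2 t) = ?I (\<lambda>t. \<Phi> t * \<psi>2 t) - ?I (\<lambda>t. G t * \<psi>2 t)" .
  show "- \<epsilon> * distr_deriv {0<..} 2 E \<psi> + distr_deriv {0<..} 1 E \<psi> = - distr_deriv {0<..} 2 PHI \<psi> - distr_deriv {0<..} 1 E \<psi>"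
    unfolding dd using key parts by simp
  show "- distr_deriv {0<..} 2 PHI \<psi> - distr_deriv {0<..} 1 E \<psi> \<le> 0" if nn: "\<And>t. 0 \<le> \<psi> t"
  proof -
    obtain C where C: "0 \<le> C"
      "\<And>t h. 0 \<le> h \<Longrightarrow> a / 4 \<le> t - h \<Longrightarrow> - C * h ^ 3 \<le>
       (\<Phi> (t + h) - G (t + h) / 2) + (\<Phi> (t - h) - G (t - h) / 2) - 2 * (\<Phi> t - G t / 2)"
      using second_difference_bound[of "a / 4"] ab(1) by auto
    have "0 \<le> ?I (\<lambda>t. (\<Phi> t - G t / 2) * \<psi>2 t)"
    proof (rule weak_second_derivative_nonneg[OF ab(1,2) _ C(1)])
      show "continuous_on {0<..} (\<lambda>t. \<Phi> t - G t / 2)" by (intro continuous_intros Phi_continuous G_continuous) auto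
    qed (fact C(2) d1 d2 c2 nn ab(3))+
    also have "?I (\<lambda>t. (\<Phi> t - G t / 2) * \<psi>2 t) = ?I (\<lambda>t. \<Phi> t * \<psi>2 t - 1 / 2 * (G t * \<psi>2 t))"
      by (intro set_lebesgue_integral_cong) (auto simp: algebra_simps)
    also have "\<dots> = ?I (\<lambda>t. \<Phi> t * \<psi>2 t) - ?I (\<lambda>t. 1 / 2 * (G t * \<psi>2 t))"
      by (rule set_integral_diff(2)[OF P2(2)]) (use G2(2) in auto)
    finally show ?thesis unfolding dd using parts by simp
  qed
qed

lemma E_locally_lipschitz: "locally_lipschitz_on {0<..} (\<lambda>t. (v t)\<^sup>2 / 2)"
  unfolding locally_lipschitz_on_def
proof
  fix t :: real assume "t \<in> {0<..}"
  then have t: "0 < t" by simp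
  define a0 where "a0 = t / 2"
  have a0: "0 < a0" using t by (simp add: a0_def)
  obtain L where L: "0 \<le> L" "\<And>a b. a0 \<le> a \<Longrightarrow> a \<le> b \<Longrightarrow> v a - v b \<le> L * (b - a)"
    using v_lipschitz[OF a0] by blast
  have main: "\<bar>(v x)\<^sup>2 / 2 - (v y)\<^sup>2 / 2\<bar> \<le> L * v a0 * (y - x)" if "a0 \<le> x" "x \<le> y" for x y
  proof -
    have b: "v y \<le> v x" "v x \<le> v a0" "v y \<le> v a0" "0 \<le> v y" "0 \<le> v x"
      using v_antimono v_nonneg that a0 by auto
    have "(v x)\<^sup>2 / 2 - (v y)\<^sup>2 / 2 = (v x - v y) * ((v x + v y) / 2)" by (simp add: power2_eq_square field_simps)
    moreover have "0 \<le> (v x - v y) * ((v x + v y) / 2)" using b by auto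
    moreover have "(v x - v y) * ((v x + v y) / 2) \<le> (L * (y - x)) * v a0"
      using b L(2)[OF that] L(1) that by (intro mult_mono) auto
    ultimately show ?thesis by (simp add: mult_ac)
  qed
  show "\<exists>\<delta>>0. \<exists>L. L-lipschitz_on (ball t \<delta> \<inter> {0<..}) (\<lambda>t. (v t)\<^sup>2 / 2)"
  proof (intro exI conjI)
    show "0 < a0" by (rule a0)
    show "(L * v a0)-lipschitz_on (ball t a0 \<inter> {0<..}) (\<lambda>t. (v t)\<^sup>2 / 2)"
    proof (rule lipschitz_onI)
      fix x y assume "x \<in> ball t a0 \<inter> {0<..}" "y \<in> ball t a0 \<inter> {0<..}"
      then have "\<bar>t - x\<bar> < t / 2" "\<bar>t - y\<bar> < t / 2" by (auto simp: dist_real_def a0_def)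
      then have "a0 \<le> x" "a0 \<le> y" unfolding a0_def abs_less_iff by auto
      then show "dist ((v x)\<^sup>2 / 2) ((v y)\<^sup>2 / 2) \<le> L * v a0 * dist x y"
        using main[of x y] main[of y x] by (cases "x \<le> y") (auto simp: dist_real_def abs_minus_commute)
    qed (use L v_nonneg a0 in auto)
  qed
qed

lemma phi_u_tendsto_zero: "((\<lambda>t. \<phi> (u t)) \<longlongrightarrow> \<phi> (u 0)) (at_right 0)"
proof (rule order_tendstoI)
  fix c assume c: "\<phi> (u 0) < c"
  have "\<forall>\<^sub>F t in at_right (0::real). 0 < t" by (simp add: eventually_at_right_less)
  then show "\<forall>\<^sub>F t in at_right 0. \<phi> (u t) < c"
  proof eventually_elim
    case (elim t)
    then show ?case using le_less_trans[OF phi_u_antimono[of 0 t] c] by simp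
  qed
next
  fix c assume c: "c < \<phi> (u 0)"
  have "\<exists>t>0. c < \<phi> (u t)"
  proof (rule ccontr)
    assume "\<not> ?thesis"
    then have le: "\<phi> (u t) \<le> c" if "0 < t" for t using that by (meson not_less)
    let ?X = "\<lambda>n. inverse (real (Suc n))"
    have "(\<lambda>n. u (max 0 (?X n))) \<longlonglongrightarrow> u (max 0 0)"
      by (rule isCont_tendsto_compose[OF u_cont LIMSEQ_inverse_real_of_nat])
    then have "\<phi> (u (max 0 0)) \<le> liminf (\<lambda>n. \<phi> (u (max 0 (?X n))))" by (rule phi_lsc)
    also have "\<dots> \<le> liminf (\<lambda>n. c)" by (intro Liminf_mono always_eventually allI) (simp add: le)
    also have "\<dots> = c" by (simp add: Liminf_const)
    finally show False using c by simp
  qed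
  then obtain t0 where t0: "0 < t0" "c < \<phi> (u t0)" by blast
  have "\<forall>\<^sub>F t in at_right 0. t \<in> {0<..<t0}" by (rule eventually_at_right_real[OF t0(1)])
  then show "\<forall>\<^sub>F t in at_right 0. c < \<phi> (u t)"
  proof eventually_elim
    case (elim t)
    then show ?case using less_le_trans[OF t0(2) phi_u_antimono[of t t0]] by simp
  qed
qed

end

theorem theorem6p4:
  fixes \<sigma> :: "'a::complete_space topology" and \<phi> :: "'a \<Rightarrow> ereal"
    and B \<epsilon> :: real and ubar :: 'a and u :: "real \<Rightarrow> 'a"
  assumes "compatible \<sigma>" and "proper \<phi>" and "LSCC \<sigma> \<phi> B" and "geodesically_convex 0 \<phi>"
    and "0 < \<epsilon>" and "B < 1 / (16 * \<epsilon>)"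
    and "u \<in> wed_minimizers \<epsilon> \<phi> ubar"
  shows "let E = (\<lambda>t. 1 / 2 * (metric_deriv {0..} u t)\<^sup>2);
             \<Phi> = (\<lambda>t. real_of_ereal (\<phi> (u t)))
         in
           (\<exists>g. locally_lipschitz_on {0<..} g \<and> (AE t in lborel. 0 < t \<longrightarrow> E t = g t)) \<and>
           (\<exists>v. continuous_on {0<..} v \<and>
                (AE t in lborel. 0 < t \<longrightarrow> metric_deriv {0..} u t = v t) \<and>
                antimono_on {0<..} v) \<and>
           antimono_on {0..} (\<lambda>t. \<phi> (u t)) \<and>
           ereal_convex_on {0..} (\<lambda>t. \<phi> (u t)) \<and>
           (\<forall>t>0. u t \<in> eff_domain \<phi>) \<and>
           (\<forall>\<psi>\<in>test_functions {0<..}.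
              - \<epsilon> * distr_deriv {0<..} 2 E \<psi> + distr_deriv {0<..} 1 E \<psi>
                = - distr_deriv {0<..} 2 \<Phi> \<psi> - distr_deriv {0<..} 1 E \<psi>) \<and>
           (\<forall>\<psi>\<in>test_functions {0<..}. (\<forall>t. 0 \<le> \<psi> t) \<longrightarrow>
              - distr_deriv {0<..} 2 \<Phi> \<psi> - distr_deriv {0<..} 1 E \<psi> \<le> 0) \<and>
           continuous_on {0<..} (\<lambda>t. \<phi> (u t)) \<and>
           ((\<lambda>t. \<phi> (u t)) \<longlongrightarrow> \<phi> (u 0)) (at_right 0)"
proof -
  interpret w: wed_minimizer \<sigma> \<phi> B \<epsilon> ubar u
    using assms by unfold_locales
  have AE: "AE t in lborel. 0 < t \<longrightarrow> metric_deriv {0..} u t = w.v t"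
    using metric_speed(1)[OF w.rect] w.v_AE by eventually_elim auto
  have cont: "continuous_on {0<..} (\<lambda>t. \<phi> (u t))"
  proof (rule continuous_on_eq)
    show "continuous_on {0<..} (\<lambda>t. ereal (w.\<Phi> t))"
      by (intro continuous_on_ereal w.Phi_continuous)
  qed (simp add: w.phi_u_finite)
  show ?thesis
    unfolding Let_def
  proof (intro conjI)
    show "\<exists>g. locally_lipschitz_on {0<..} g \<and> (AE t in lborel. 0 < t \<longrightarrow> 1 / 2 * (metric_deriv {0..} u t)\<^sup>2 = g t)"
    proof (intro exI conjI)
      show "locally_lipschitz_on {0<..} (\<lambda>t. (w.v t)\<^sup>2 / 2)" by (rule w.E_locally_lipschitz)
      show "AE t in lborel. 0 < t \<longrightarrow> 1 / 2 * (metric_deriv {0..} u t)\<^sup>2 = (w.v t)\<^sup>2 / 2"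
        using AE by eventually_elim auto
    qed
    show "\<exists>v. continuous_on {0<..} v \<and> (AE t in lborel. 0 < t \<longrightarrow> metric_deriv {0..} u t = v t) \<and> antimono_on {0<..} v"
      using w.v_continuous AE w.v_antimono by (intro exI[of _ w.v]) (auto simp: monotone_on_def)
    show "antimono_on {0..} (\<lambda>t. \<phi> (u t))" using w.phi_u_antimono by (auto simp: monotone_on_def)
    show "\<forall>t>0. u t \<in> eff_domain \<phi>" by (simp add: eff_domain_def w.phi_u_finite)
  qed (use w.weak_forms w.phi_u_convex cont w.phi_u_tendsto_zero in blast)+
qed

end
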